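(* Assume $\mathfrak m\subset\mathcal H_{\mathbb R}$ is a closed Lie triple system. Then for any operator $a\in\mathcal H_{\mathbb R}$ there exist unique operators $x\in\mathfrak m$ and $v\in\mathfrak m^{\perp}$ such that $$e^a=e^x\,e^v\,e^x.$$ The map $d_a:\mathcal H_{\mathbb R}\to\mathbb R$, $d_a(y)=\|\ln(e^{a/2}e^{-y}e^{a/2})\|_2$, has the operator $2x$ as its unique minimizer in $\mathfrak m$.
   Context: Let $H$ be a complex, infinite dimensional, separable Hilbert space, $\mathsf{HS}\subset B(H)$ the ideal of Hilbert-Schmidt operators, and $\mathcal H_{\mathbb R}=\{a+\lambda: a=a^*\in\mathsf{HS},\lambda\in\mathbb R\}$, a real Hilbert space with inner product $\langle a+\lambda,b+\beta\rangle_2=4\,\mathrm{tr}(ab^* )+\lambda\beta$ and norm $\|\cdot\|_2$. A real linear subspace $\mathfrak m\subset\mathcal H_{\mathbb R}$ is a Lie triple system if $[[a,b],c]\in\mathfrak m$ for all $a,b,c\in\mathfrak m$, where $[x,y]=xy-yx$. $\mathfrak m^{\perp}=\{v\in\mathcal H_{\mathbb R}:\langle v,z\rangle_2=0\ \forall z\in\mathfrak m\}$. $\ln$ is the inverse of the exponential map from $\mathcal H_{\mathbb R}$ onto the set of positive invertible operators in $\mathcal H_{\mathbb R}$. *)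

theory Defs
  imports "HOL-Analysis.Analysis"
begin

section \<open>Complex Hilbert spaces\<close>

class complex_vector = real_vector +
  fixes scaleC :: "complex \<Rightarrow> 'a \<Rightarrow> 'a" (infixr \<open>*\<^sub>C\<close> 75)
  assumes scaleC_add_right: "c *\<^sub>C (x + y) = c *\<^sub>C x + c *\<^sub>C y"
    and scaleC_add_left: "(c + d) *\<^sub>C x = c *\<^sub>C x + d *\<^sub>C x"
    and scaleC_scaleC: "c *\<^sub>C d *\<^sub>C x = (c * d) *\<^sub>C x"
    and scaleC_one: "1 *\<^sub>C x = x"
    and scaleR_scaleC: "r *\<^sub>R x = complex_of_real r *\<^sub>C x"

text \<open>The inner product is conjugate-linear in its first and linear in its second argument.\<close>

class complex_inner = complex_vector + real_normed_vector +
  fixes cinner :: "'a \<Rightarrow> 'a \<Rightarrow> complex"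
  assumes cinner_commute: "cinner x y = cnj (cinner y x)"
    and cinner_add_right: "cinner x (y + z) = cinner x y + cinner x z"
    and cinner_scaleC_right: "cinner x (c *\<^sub>C y) = c * cinner x y"
    and cinner_self: "cinner x x = complex_of_real ((norm x)\<^sup>2)"

class complex_hilbert_space = complex_inner + banach

class infdim_separable_hilbert = complex_hilbert_space +
  assumes infinite_dimensional: "finite B \<Longrightarrow> \<exists>x. \<forall>c. x \<noteq> (\<Sum>b\<in>B. c b *\<^sub>C b)"
    and separable: "\<exists>D. countable D \<and> (\<forall>x. \<forall>\<epsilon>>0. \<exists>d\<in>D. dist d x < \<epsilon>)"

lemma infdim_separable_hilbert_not_trivial: "\<exists>x :: 'h :: infdim_separable_hilbert. x \<noteq> 0"
  using infinite_dimensional[of "{} :: 'h set"] by simp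

definition is_onb :: "'h :: complex_inner set \<Rightarrow> bool" where
  "is_onb E \<longleftrightarrow>
     (\<forall>e\<in>E. \<forall>f\<in>E. cinner e f = (if e = f then 1 else 0)) \<and>
     closure (module.span scaleC E) = UNIV"


section \<open>The Banach algebra of bounded operators\<close>

typedef (overloaded) 'h bop =
  "{f :: 'h :: infdim_separable_hilbert \<Rightarrow>\<^sub>L 'h.
      \<forall>c x. blinfun_apply f (c *\<^sub>C x) = c *\<^sub>C blinfun_apply f x}"
  morphisms blinfun_of_bop Bop
proof -
  have "id_blinfun \<in> {f :: 'h \<Rightarrow>\<^sub>L 'h. \<forall>c x. blinfun_apply f (c *\<^sub>C x) = c *\<^sub>C blinfun_apply f x}"
    by simp
  then show ?thesis
    by blast
qed

setup_lifting type_definition_bop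

abbreviation bop_apply :: "'h :: infdim_separable_hilbert bop \<Rightarrow> 'h \<Rightarrow> 'h" where
  "bop_apply A x \<equiv> blinfun_apply (blinfun_of_bop A) x"

lemma bop_apply_scaleC: "bop_apply A (c *\<^sub>C x) = c *\<^sub>C bop_apply A x"
  using blinfun_of_bop[of A] by blast

lemma scaleC_scaleR_commute:
  fixes x :: "'h :: complex_vector"
  shows "c *\<^sub>C r *\<^sub>R x = r *\<^sub>R c *\<^sub>C x"
  by (simp add: scaleR_scaleC scaleC_scaleC mult.commute)

lemma scaleC_zero_right: "c *\<^sub>C (0 :: 'h :: complex_vector) = 0"
  using scaleC_add_right[of c 0 "0 :: 'h"] by simp

lemma scaleC_minus_right: "c *\<^sub>C (- x :: 'h :: complex_vector) = - (c *\<^sub>C x)"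
  using scaleC_add_right[of c x "- x"] by (simp add: scaleC_zero_right eq_neg_iff_add_eq_0 add.commute)

lemma scaleC_diff_right: "c *\<^sub>C (x - y :: 'h :: complex_vector) = c *\<^sub>C x - c *\<^sub>C y"
  using scaleC_add_right[of c x "- y"] by (simp add: scaleC_minus_right)

lemma norm_scaleC: "norm (c *\<^sub>C (x :: 'h :: complex_inner)) = cmod c * norm x"
proof -
  have "cinner (c *\<^sub>C x) (c *\<^sub>C x) = c * cnj c * cinner x x"
    using cinner_commute[of "c *\<^sub>C x" x] cinner_commute[of x x]
    by (simp add: cinner_scaleC_right mult.assoc)
  then have "complex_of_real ((norm (c *\<^sub>C x))\<^sup>2) = complex_of_real ((cmod c * norm x)\<^sup>2)"
    by (simp only: cinner_self complex_norm_square[symmetric] power_mult_distrib of_real_mult)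
  then have "(norm (c *\<^sub>C x))\<^sup>2 = (cmod c * norm x)\<^sup>2"
    by (simp only: of_real_eq_iff)
  then show ?thesis
    by simp
qed

lemma tendsto_scaleC:
  fixes f :: "'b \<Rightarrow> 'h :: complex_inner"
  assumes "(f \<longlongrightarrow> l) F"
  shows "((\<lambda>x. c *\<^sub>C f x) \<longlongrightarrow> c *\<^sub>C l) F"
proof -
  have "bounded_linear (\<lambda>x :: 'h. c *\<^sub>C x)"
    by (rule bounded_linear_intro[where K = "cmod c"])
      (simp_all add: scaleC_add_right scaleC_scaleR_commute norm_scaleC mult.commute)
  then show ?thesis
    using assms by (rule bounded_linear.tendsto)
qed

instantiation bop :: (infdim_separable_hilbert) real_normed_vector
begin

lift_definition zero_bop :: "'a bop" is 0
  by (simp add: scaleC_zero_right)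
lift_definition plus_bop :: "'a bop \<Rightarrow> 'a bop \<Rightarrow> 'a bop" is "(+)"
  by (simp add: blinfun.bilinear_simps scaleC_add_right)
lift_definition minus_bop :: "'a bop \<Rightarrow> 'a bop \<Rightarrow> 'a bop" is "(-)"
  by (simp add: blinfun.bilinear_simps scaleC_diff_right)
lift_definition uminus_bop :: "'a bop \<Rightarrow> 'a bop" is uminus
  by (simp add: blinfun.bilinear_simps scaleC_minus_right)
lift_definition scaleR_bop :: "real \<Rightarrow> 'a bop \<Rightarrow> 'a bop" is scaleR
  by (simp add: blinfun.bilinear_simps scaleC_scaleR_commute)
lift_definition norm_bop :: "'a bop \<Rightarrow> real" is norm .

definition dist_bop :: "'a bop \<Rightarrow> 'a bop \<Rightarrow> real" where
  "dist_bop A B = norm (A - B)"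
definition sgn_bop :: "'a bop \<Rightarrow> 'a bop" where
  "sgn_bop A = inverse (norm A) *\<^sub>R A"
definition uniformity_bop :: "('a bop \<times> 'a bop) filter" where
  "uniformity_bop = (INF e\<in>{0<..}. principal {(A, B). dist A B < e})"
definition open_bop :: "'a bop set \<Rightarrow> bool" where
  "open_bop S = (\<forall>A\<in>S. \<forall>\<^sub>F (A', B) in uniformity. A' = A \<longrightarrow> B \<in> S)"

instance
proof
  fix A B C :: "'a bop" and r s :: real
  show "A + B + C = A + (B + C)" "A + B = B + A" "0 + A = A" "- A + A = 0" "A - B = A + - B"
    by (transfer, simp)+
  show "r *\<^sub>R (A + B) = r *\<^sub>R A + r *\<^sub>R B" "(r + s) *\<^sub>R A = r *\<^sub>R A + s *\<^sub>R A"
    by (transfer, rule scaleR_add_right scaleR_add_left)+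
  show "r *\<^sub>R s *\<^sub>R A = (r * s) *\<^sub>R A" "1 *\<^sub>R A = A"
    by (transfer, simp)+
  show "norm A = 0 \<longleftrightarrow> A = 0" "norm (r *\<^sub>R A) = \<bar>r\<bar> * norm A"
    by (transfer, simp)+
  show "norm (A + B) \<le> norm A + norm B"
    by transfer (rule norm_triangle_ineq)
qed (rule dist_bop_def sgn_bop_def uniformity_bop_def open_bop_def)+

end

instantiation bop :: (infdim_separable_hilbert) real_normed_algebra_1
begin

lift_definition one_bop :: "'a bop" is id_blinfun
  by simp
lift_definition times_bop :: "'a bop \<Rightarrow> 'a bop \<Rightarrow> 'a bop" is blinfun_compose
  by simp

instance
proof
  fix A B C :: "'a bop" and r :: real
  show "A * B * C = A * (B * C)"
    by (transfer, rule blinfun_eqI, simp)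
  show "(A + B) * C = A * C + B * C" "A * (B + C) = A * B + A * C"
    "r *\<^sub>R A * B = r *\<^sub>R (A * B)" "A * r *\<^sub>R B = r *\<^sub>R (A * B)"
    by (transfer, rule blinfun_eqI, simp add: blinfun.bilinear_simps)+
  show "1 * A = A" "A * 1 = A"
    by (transfer, rule blinfun_eqI, simp)+
  show "norm (A * B) \<le> norm A * norm B"
    by transfer (rule norm_blinfun_compose)
  obtain x :: 'a where x: "x \<noteq> 0"
    using infdim_separable_hilbert_not_trivial by blast
  have "norm (id_blinfun :: 'a \<Rightarrow>\<^sub>L 'a) = 1"
    by (rule norm_blinfun_eqI[where x = x]) (use x in simp_all)
  then show "norm (1 :: 'a bop) = 1"
    by transfer
  have "(id_blinfun :: 'a \<Rightarrow>\<^sub>L 'a) \<noteq> 0"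
    using \<open>norm id_blinfun = 1\<close> by auto
  then show "(0 :: 'a bop) \<noteq> 1"
    by transfer simp
qed

end

instance bop :: (infdim_separable_hilbert) banach
proof
  fix X :: "nat \<Rightarrow> 'a bop"
  assume "Cauchy X"
  then have "Cauchy (\<lambda>n. blinfun_of_bop (X n))"
    unfolding Cauchy_def dist_norm by (simp add: norm_bop.rep_eq minus_bop.rep_eq)
  then have "convergent (\<lambda>n. blinfun_of_bop (X n))"
    by (rule Cauchy_convergent)
  then obtain L where L: "(\<lambda>n. blinfun_of_bop (X n)) \<longlonglongrightarrow> L"
    by (auto simp: convergent_def)
  have lim: "(\<lambda>n. bop_apply (X n) x) \<longlonglongrightarrow> blinfun_apply L x" for x
    using L by (intro tendsto_intros)
  have "blinfun_apply L (c *\<^sub>C x) = c *\<^sub>C blinfun_apply L x" for c x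
  proof (rule LIMSEQ_unique)
    show "(\<lambda>n. bop_apply (X n) (c *\<^sub>C x)) \<longlonglongrightarrow> blinfun_apply L (c *\<^sub>C x)"
      by (rule lim)
    show "(\<lambda>n. bop_apply (X n) (c *\<^sub>C x)) \<longlonglongrightarrow> c *\<^sub>C blinfun_apply L x"
      using tendsto_scaleC[OF lim[of x], of c] by (simp add: bop_apply_scaleC)
  qed
  then have "blinfun_of_bop (Bop L) = L"
    by (simp add: Bop_inverse)
  with L have "X \<longlonglongrightarrow> Bop L"
    unfolding LIMSEQ_def dist_norm by (simp add: norm_bop.rep_eq minus_bop.rep_eq)
  then show "convergent X"
    by (auto simp: convergent_def)
qed


section \<open>Adjoint, Hilbert-Schmidt operators and trace\<close>

definition adj :: "'h :: infdim_separable_hilbert bop \<Rightarrow> 'h bop" where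
  "adj A = (THE B. \<forall>x y. cinner (bop_apply B x) y = cinner x (bop_apply A y))"

definition hilbert_schmidt :: "'h :: infdim_separable_hilbert bop \<Rightarrow> bool" where
  "hilbert_schmidt A \<longleftrightarrow>
     (\<exists>E. is_onb E \<and> (\<lambda>e. (norm (bop_apply A e))\<^sup>2) summable_on E)"

text \<open>
  The trace is only ever applied to products of two Hilbert-Schmidt operators; these are of trace
  class, so the sum below converges absolutely and does not depend on the chosen basis.
\<close>

definition trace_op :: "'h :: infdim_separable_hilbert bop \<Rightarrow> complex" where
  "trace_op A = (let E = (SOME E. is_onb E) in \<Sum>\<^sub>\<infinity>e\<in>E. cinner e (bop_apply A e))"


section \<open>The real Hilbert space of self-adjoint unitized Hilbert-Schmidt operators\<close>

definition HR :: "'h :: infdim_separable_hilbert bop set" where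
  "HR = {a + of_real r | a r. hilbert_schmidt a \<and> adj a = a}"

text \<open>
  The identity is not Hilbert-Schmidt since the space is infinite dimensional, so an element of
  \<open>HR\<close> determines both summands of its decomposition.
\<close>

definition scalar_part :: "'h :: infdim_separable_hilbert bop \<Rightarrow> real" where
  "scalar_part z = (THE r. hilbert_schmidt (z - of_real r))"

definition hs_part :: "'h :: infdim_separable_hilbert bop \<Rightarrow> 'h bop" where
  "hs_part z = z - of_real (scalar_part z)"

text \<open>The trace below is real for arguments in \<open>HR\<close>; \<open>Re\<close> only adjusts the type.\<close>

definition inner2 :: "'h :: infdim_separable_hilbert bop \<Rightarrow> 'h bop \<Rightarrow> real" where
  "inner2 x y = 4 * Re (trace_op (hs_part x * adj (hs_part y))) + scalar_part x * scalar_part y"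

definition norm2 :: "'h :: infdim_separable_hilbert bop \<Rightarrow> real" where
  "norm2 x = sqrt (inner2 x x)"

definition topology2 :: "'h :: infdim_separable_hilbert bop topology" where
  "topology2 = Metric_space.mtopology HR (\<lambda>x y. norm2 (x - y))"

definition orth_compl :: "'h :: infdim_separable_hilbert bop set \<Rightarrow> 'h bop set" where
  "orth_compl m = {v \<in> HR. \<forall>z\<in>m. inner2 v z = 0}"

definition commutator :: "'a :: ring \<Rightarrow> 'a \<Rightarrow> 'a" where
  "commutator x y = x * y - y * x"

definition lie_triple_system :: "'h :: infdim_separable_hilbert bop set \<Rightarrow> bool" where
  "lie_triple_system m \<longleftrightarrow>
     subspace m \<and> m \<subseteq> HR \<and> (\<forall>a\<in>m. \<forall>b\<in>m. \<forall>c\<in>m. commutator (commutator a b) c \<in> m)"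

definition ln_op :: "'h :: infdim_separable_hilbert bop \<Rightarrow> 'h bop" where
  "ln_op = the_inv_into HR exp"

definition dist_fun :: "'h :: infdim_separable_hilbert bop \<Rightarrow> 'h bop \<Rightarrow> real" where
  "dist_fun a y = norm2 (ln_op (exp (a /\<^sub>R 2) * exp (- y) * exp (a /\<^sub>R 2)))"

end

theory Submission
  imports Defs
begin

text \<open>
  The positive operators \<open>e\<^sup>z\<close>, \<open>z \<in> HR\<close>, with the distance \<open>dist_fun\<close> form a space of nonpositive curvature,
  on which the maps \<open>p \<mapsto> e\<^sup>x p e\<^sup>x\<close> act isometrically. The exponential map does not decrease distances,
  \<open>\<parallel>a - y\<parallel> \<le> dist_fun a y\<close>: infinitesimally this is \<open>\<bar>t\<bar> \<le> \<bar>2 sinh (t/2)\<bar>\<close>, read entrywise in eigenbases,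
  and it integrates along geodesics. Applied at a midpoint it yields the semi-parallelogram law, so that
  minimizing sequences in the closed, geodesically convex set \<open>exp m\<close> converge. If \<open>2x\<close> is the
  minimizer, the first variation says that \<open>v = ln (e\<^bsup>-x\<^esup> e\<^sup>a e\<^bsup>-x\<^esup>)\<close> is orthogonal to \<open>m\<close>. Conversely, if
  \<open>e\<^sup>a = e\<^sup>x e\<^sup>v e\<^sup>x\<close> with \<open>v \<bottom> m\<close>, then for \<open>y \<in> m\<close> and \<open>e\<^sup>w = e\<^bsup>-x\<^esup> e\<^sup>y e\<^bsup>-x\<^esup>\<close>, where \<open>w \<in> m\<close>, we get
  \<open>(dist_fun a y)\<^sup>2 \<ge> \<parallel>v - w\<parallel>\<^sup>2 = \<parallel>v\<parallel>\<^sup>2 + \<parallel>w\<parallel>\<^sup>2\<close>, so \<open>2x\<close> is the unique minimizer.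
\<close>

section \<open>Complex Hilbert spaces\<close>

text \<open>The difficulty is the geodesic convexity of exp m. Since m is closed only under double
  commutators, e^x e^y e^x is placed in exp m by an infinitesimal argument. The curve s -> ln(e^(sx)
  e^w e^(sx)) has at s = 0 the velocity k = F(ad w) x, where F(u) = u coth(u/2). F is even, so k is
  a limit of polynomials in (ad w)^2 applied to x; the triple bracket makes (ad w)^2 map m into
  itself, and closedness of m keeps the limit in m. Instead of differentiating ln, a second-order
  estimate for exp in Hilbert-Schmidt norm shows that w + s k is within C s^2 of the curve in
  \<open>dist_fun\<close>, and Euler steps then follow the curve inside m. The same estimate with m
  = \<open>HR\<close> gives the first variation, because the inner product of w and k is twice that
  of w and x. Comparisons between noncommuting operators are reduced to scalar inequalities by
  taking matrix entries between an eigenbasis of one operator and an eigenbasis of the other, so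
  that only the spectral theorem for self-adjoint Hilbert-Schmidt operators is required.\<close>

interpretation cvs: vector_space "scaleC :: complex \<Rightarrow> 'a \<Rightarrow> 'a::complex_vector"
  by standard (auto simp: scaleC_add_right scaleC_add_left scaleC_scaleC scaleC_one)

section \<open>Inner product algebra\<close>

lemma cinner_add_left: "cinner (x + y) z = cinner x z + cinner y z"
  by (metis cinner_commute cinner_add_right complex_cnj_add)

lemma cinner_scaleC_left: "cinner (c *\<^sub>C x) y = cnj c * cinner x y"
  by (metis cinner_commute cinner_scaleC_right complex_cnj_mult)

lemma cinner_scaleR_right: "cinner x (r *\<^sub>R y) = of_real r * cinner x y"
  by (simp add: scaleR_scaleC cinner_scaleC_right)

lemma cinner_scaleR_left: "cinner (r *\<^sub>R x) y = of_real r * cinner x y"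
  by (simp add: scaleR_scaleC cinner_scaleC_left)

lemma cinner_zero_right [simp]: "cinner x 0 = 0"
  using cinner_scaleR_right[of x 0 0] by simp

lemma cinner_zero_left [simp]: "cinner 0 x = 0"
  using cinner_scaleR_left[of 0 0 x] by simp

lemma cinner_minus_right: "cinner x (- y) = - cinner x y"
  using cinner_scaleR_right[of x "-1" y] by simp

lemma cinner_minus_left: "cinner (- x) y = - cinner x y"
  using cinner_scaleR_left[of "-1" x y] by simp

lemma cinner_diff_right: "cinner x (y - z) = cinner x y - cinner x z"
  using cinner_add_right[of x y "- z"] by (simp add: cinner_minus_right)

lemma cinner_diff_left: "cinner (x - y) z = cinner x z - cinner y z"
  using cinner_add_left[of x "- y" z] by (simp add: cinner_minus_left)

lemmas cinner_simps = cinner_add_left cinner_add_right cinner_diff_left cinner_diff_right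
  cinner_scaleC_left cinner_scaleC_right cinner_scaleR_left cinner_scaleR_right
  cinner_minus_left cinner_minus_right

lemma cinner_sum_right: "cinner x (sum f A) = (\<Sum>i\<in>A. cinner x (f i))"
  by (induction A rule: infinite_finite_induct) (auto simp: cinner_add_right)

lemma Re_cinner_commute: "Re (cinner x y) = Re (cinner y x)"
  by (subst cinner_commute) simp

lemma cmod_cinner_commute: "cmod (cinner x y) = cmod (cinner y x)"
  by (subst cinner_commute) simp

lemma cinner_self_eq_0 [simp]: "cinner x x = 0 \<longleftrightarrow> x = 0"
  by (simp add: cinner_self)

lemma norm_sq_cinner: "(norm x)\<^sup>2 = Re (cinner x x)"
  by (simp add: cinner_self)

lemma norm_add_sq: "(norm (x + y))\<^sup>2 = (norm x)\<^sup>2 + (norm y)\<^sup>2 + 2 * Re (cinner x y)"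
  using Re_cinner_commute[of x y] by (simp add: norm_sq_cinner cinner_simps)

lemma norm_diff_sq: "(norm (x - y))\<^sup>2 = (norm x)\<^sup>2 + (norm y)\<^sup>2 - 2 * Re (cinner x y)"
  using Re_cinner_commute[of x y] by (simp add: norm_sq_cinner cinner_simps)

lemma norm_diff_scaleC_sq:
  "(norm (x - c *\<^sub>C y))\<^sup>2 = (norm x)\<^sup>2 + (cmod c * norm y)\<^sup>2 - 2 * Re (c * cinner x y)"
  by (simp add: norm_diff_sq cinner_simps norm_scaleC)

text \<open>The scalar is the optimal one. Nonnegativity of the left side is the Cauchy-Schwarz
  inequality; in \<open>hilbert_projection\<close> the same scalar is the perturbation that
  contradicts minimality unless the residual is orthogonal.\<close>

lemma norm_diff_projection_sq:
  assumes "y \<noteq> 0"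
  shows "(norm (x - (cinner y x / (norm y)\<^sup>2) *\<^sub>C y))\<^sup>2 = (norm x)\<^sup>2 - (cmod (cinner y x))\<^sup>2 / (norm y)\<^sup>2"
proof -
  have ny: "norm y \<noteq> 0"
    using assms by simp
  have "cinner y x * cinner x y = complex_of_real ((cmod (cinner y x))\<^sup>2)"
    by (subst cinner_commute[of x y]) (simp only: complex_norm_square)
  then have "cinner y x / (norm y)\<^sup>2 * cinner x y = complex_of_real ((cmod (cinner y x))\<^sup>2 / (norm y)\<^sup>2)"
    by (simp add: divide_simps)
  then have 1: "Re (cinner y x / (norm y)\<^sup>2 * cinner x y) = (cmod (cinner y x))\<^sup>2 / (norm y)\<^sup>2"
    by (metis Re_complex_of_real)
  have "cmod (cinner y x / (norm y)\<^sup>2) = cmod (cinner y x) / (norm y)\<^sup>2"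
    by (simp add: norm_divide norm_power)
  then have 2: "(cmod (cinner y x / (norm y)\<^sup>2) * norm y)\<^sup>2 = (cmod (cinner y x))\<^sup>2 / (norm y)\<^sup>2"
    unfolding \<open>cmod (cinner y x / (norm y)\<^sup>2) = _\<close> using ny
    by (simp add: power2_eq_square divide_simps)
  show ?thesis
    unfolding norm_diff_scaleC_sq 1 2 by simp
qed

lemma cinner_Cauchy_Schwarz: "cmod (cinner x y) \<le> norm x * norm y"
proof (cases "x = 0")
  case False
  then have "0 \<le> (norm y)\<^sup>2 - (cmod (cinner x y))\<^sup>2 / (norm x)\<^sup>2"
    using norm_diff_projection_sq[of x y] zero_le_power2 by metis
  with False have "(cmod (cinner x y))\<^sup>2 \<le> (norm x * norm y)\<^sup>2"
    by (simp add: field_simps power_mult_distrib)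
  then show ?thesis
    by (rule power2_le_imp_le) simp
qed simp

lemma bounded_bilinear_cinner: "bounded_bilinear cinner"
  by standard
    (auto simp: cinner_simps scaleR_conv_of_real intro!: exI[of _ 1] cinner_Cauchy_Schwarz)

lemmas tendsto_cinner = bounded_bilinear.tendsto[OF bounded_bilinear_cinner]

lemma cinner_right_cancel:
  assumes "\<And>z. cinner z x = cinner z y"
  shows "x = y"
proof -
  have "cinner (x - y) (x - y) = 0"
    unfolding cinner_diff_right assms by simp
  then show ?thesis
    by simp
qed

lemma cinner_left_cancel:
  assumes "\<And>z. cinner x z = cinner y z"
  shows "x = y"
  by (rule cinner_right_cancel) (use assms in \<open>metis cinner_commute[of _ x] cinner_commute[of _ y]\<close>)

text \<open>
  \<open>D\<close> plays the role of a squared distance and \<open>f\<close> that of the squared distance to a fixed point;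
  the hypothesis is the semi-parallelogram law.
\<close>

lemma minimizing_sequence:
  fixes f :: "'a \<Rightarrow> real"
  assumes "S \<noteq> {}" and nonneg: "\<And>a. a \<in> S \<Longrightarrow> 0 \<le> f a"
    and D: "\<And>a b. a \<in> S \<Longrightarrow> b \<in> S \<Longrightarrow> \<exists>c\<in>S. D a b \<le> 2 * f a + 2 * f b - 4 * f c"
  obtains s L where "\<And>n. s n \<in> S" "(\<lambda>n. f (s n)) \<longlonglongrightarrow> L" "\<And>c. c \<in> S \<Longrightarrow> L \<le> f c"
    "\<And>j k. D (s j) (s k) \<le> 2 / Suc j + 2 / Suc k"
proof -
  define L where "L = Inf (f ` S)"
  have bdd: "bdd_below (f ` S)"
    using nonneg by (intro bdd_belowI[where m = 0]) auto
  have lower: "L \<le> f c" if "c \<in> S" for c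
    unfolding L_def using that bdd by (intro cInf_lower) auto
  have "\<exists>c\<in>S. f c < L + 1 / Suc n" for n :: nat
  proof -
    have "Inf (f ` S) < L + 1 / Suc n"
      by (simp add: L_def)
    then show ?thesis
      using cInf_lessD[of "f ` S"] \<open>S \<noteq> {}\<close> by fastforce
  qed
  then obtain s where s: "\<And>n. s n \<in> S" "\<And>n. f (s n) < L + 1 / Suc n"
    by metis
  have "(\<lambda>n. L + 1 / real (Suc n)) \<longlonglongrightarrow> L + 0"
    by (intro tendsto_add tendsto_const) (use LIMSEQ_inverse_real_of_nat in \<open>simp add: inverse_eq_divide\<close>)
  then have up: "(\<lambda>n. L + 1 / real (Suc n)) \<longlonglongrightarrow> L"
    by simp
  have lim: "(\<lambda>n. f (s n)) \<longlonglongrightarrow> L"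
    by (rule tendsto_sandwich[OF _ _ tendsto_const up]) (use s(1) lower less_imp_le[OF s(2)] in \<open>auto intro!: always_eventually\<close>)
  have "D (s j) (s k) \<le> 2 / Suc j + 2 / Suc k" for j k
  proof -
    obtain c where c: "c \<in> S" "D (s j) (s k) \<le> 2 * f (s j) + 2 * f (s k) - 4 * f c"
      using D s(1) by blast
    then have "D (s j) (s k) \<le> 2 * (L + 1 / Suc j) + 2 * (L + 1 / Suc k) - 4 * L"
      using lower[OF c(1)] s(2)[of j] s(2)[of k] by (smt (verit))
    then show ?thesis
      by simp
  qed
  with s(1) lim lower show thesis
    by (intro that) auto
qed

text \<open>\<open>dst\<close> is an arbitrary function so that the bound serves both for the
  Hilbert space norm and for \<open>dist_fun\<close>, which is not the metric of a type
  class.\<close>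

lemma Cauchy_of_sq_bound:
  fixes dst :: "nat \<Rightarrow> nat \<Rightarrow> real"
  assumes "\<And>j k. (dst j k)\<^sup>2 \<le> 2 / Suc j + 2 / Suc k" and "e > 0"
  shows "\<exists>N. \<forall>j\<ge>N. \<forall>k\<ge>N. dst j k < e"
proof -
  obtain N :: nat where N: "4 / e\<^sup>2 < N"
    using reals_Archimedean2 by blast
  have Npos: "real N > 0"
    using N \<open>e > 0\<close> by (smt (verit) zero_le_divide_iff zero_le_power2)
  have "dst j k < e" if "j \<ge> N" "k \<ge> N" for j k
  proof -
    have "2 / Suc j + 2 / Suc k \<le> 2 / N + 2 / N"
      using that Npos by (intro add_mono divide_left_mono) auto
    also have "\<dots> < e\<^sup>2"
      using N Npos \<open>e > 0\<close> by (simp add: field_simps)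
    finally have "(dst j k)\<^sup>2 < e\<^sup>2"
      using assms(1)[of j k] by linarith
    then show ?thesis
      using \<open>e > 0\<close> by (simp add: power2_less_imp_less)
  qed
  then show ?thesis
    by blast
qed

lemma hilbert_projection:
  fixes x :: "'h::complex_hilbert_space"
  assumes "closed V" "cvs.subspace V"
  obtains p where "p \<in> V" "\<And>v. v \<in> V \<Longrightarrow> cinner v (x - p) = 0"
proof -
  have ne: "V \<noteq> {}"
    using assms(2) cvs.subspace_0 by blast
  have semi: "\<exists>c\<in>V. (norm (a - b))\<^sup>2 \<le> 2 * (norm (x - a))\<^sup>2 + 2 * (norm (x - b))\<^sup>2 - 4 * (norm (x - c))\<^sup>2"
    if "a \<in> V" "b \<in> V" for a b
  proof
    let ?c = "(1/2 :: complex) *\<^sub>C (a + b)"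
    show "?c \<in> V"
      using that assms(2) by (intro cvs.subspace_scale cvs.subspace_add)
    have "?c = (1/2 :: real) *\<^sub>R (a + b)"
      by (simp add: scaleR_scaleC)
    then have c: "2 *\<^sub>R (x - ?c) = (x - a) + (x - b)"
      by (simp add: algebra_simps scaleR_2)
    have "4 * (norm (x - ?c))\<^sup>2 = (norm ((x - a) + (x - b)))\<^sup>2"
      unfolding c[symmetric] by (simp add: power_mult_distrib)
    moreover have "norm (a - b) = norm ((x - a) - (x - b))"
      by (simp add: norm_minus_commute)
    ultimately show "(norm (a - b))\<^sup>2 \<le> 2 * (norm (x - a))\<^sup>2 + 2 * (norm (x - b))\<^sup>2 - 4 * (norm (x - ?c))\<^sup>2"
      using norm_add_sq[of "x - a" "x - b"] norm_diff_sq[of "x - a" "x - b"] by simp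
  qed
  obtain s L where s: "\<And>n. s n \<in> V" "(\<lambda>n. (norm (x - s n))\<^sup>2) \<longlonglongrightarrow> L"
      "\<And>c. c \<in> V \<Longrightarrow> L \<le> (norm (x - c))\<^sup>2" "\<And>j k. (norm (s j - s k))\<^sup>2 \<le> 2 / Suc j + 2 / Suc k"
  proof (rule minimizing_sequence[where f = "\<lambda>a. (norm (x - a))\<^sup>2" and D = "\<lambda>a b. (norm (a - b))\<^sup>2",
        OF ne zero_le_power2])
    show "\<exists>c\<in>V. (norm (a - b))\<^sup>2 \<le> 2 * (norm (x - a))\<^sup>2 + 2 * (norm (x - b))\<^sup>2 - 4 * (norm (x - c))\<^sup>2"
      if "a \<in> V" "b \<in> V" for a b
      using semi that .
  qed (rule that)
  have "Cauchy s"
    unfolding Cauchy_def dist_norm using Cauchy_of_sq_bound[OF s(4)] by blast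
  then obtain p where p: "s \<longlonglongrightarrow> p"
    using Cauchy_convergent convergent_def by blast
  have "p \<in> V"
    using closed_sequentially[OF assms(1)] s(1) p by blast
  have "(\<lambda>n. (norm (x - s n))\<^sup>2) \<longlonglongrightarrow> (norm (x - p))\<^sup>2"
    by (intro tendsto_intros p)
  then have L: "L = (norm (x - p))\<^sup>2"
    using s(2) LIMSEQ_unique by blast
  have "cinner v (x - p) = 0" if "v \<in> V" for v
  proof (cases "v = 0")
    case False
    let ?c = "cinner v (x - p) / (norm v)\<^sup>2"
    have "p + ?c *\<^sub>C v \<in> V"
      using \<open>p \<in> V\<close> that assms(2) by (intro cvs.subspace_scale cvs.subspace_add)
    then have "(norm (x - p))\<^sup>2 \<le> (norm ((x - p) - ?c *\<^sub>C v))\<^sup>2"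
      using s(3) L by (simp add: diff_diff_add)
    then show ?thesis
      unfolding norm_diff_projection_sq[OF False] using False by (simp add: field_simps)
  qed simp
  with \<open>p \<in> V\<close> show thesis
    by (rule that)
qed

lemma riesz_representation:
  fixes f :: "'h::complex_hilbert_space \<Rightarrow> complex"
  assumes add: "\<And>x y. f (x + y) = f x + f y" and scale: "\<And>c x. f (c *\<^sub>C x) = c * f x"
    and bound: "\<And>x. cmod (f x) \<le> K * norm x"
  shows "\<exists>z. \<forall>y. f y = cinner z y"
proof -
  define V where "V = {x. f x = 0}"
  have "bounded_linear f"
    by (rule bounded_linear_intro[where K = K])
      (use add scale bound in \<open>auto simp: scaleR_scaleC scaleR_conv_of_real mult.commute\<close>)
  then have "closed V"
    unfolding V_def by (intro closed_Collect_eq continuous_on_const linear_continuous_on)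
  have f0: "f 0 = 0"
    using scale[of 0 0] by simp
  have diff: "f (x - y) = f x - f y" for x y
    using add[of "x - y" y] by simp
  have "cvs.subspace V"
    by (rule cvs.subspaceI) (auto simp: V_def f0 add scale)
  show ?thesis
  proof (cases "V = UNIV")
    case True
    then show ?thesis
      by (intro exI[of _ 0]) (auto simp: V_def)
  next
    case False
    then obtain x where "x \<notin> V"
      by auto
    obtain p where p: "p \<in> V" "\<And>v. v \<in> V \<Longrightarrow> cinner v (x - p) = 0"
      using hilbert_projection[OF \<open>closed V\<close> \<open>cvs.subspace V\<close>] by metis
    \<comment> \<open>\<open>u\<close> is orthogonal to the kernel \<open>V\<close>. Every
      \<open>y\<close> differs from a multiple of \<open>u\<close> by an element of
      \<open>V\<close>, so pairing with \<open>u\<close> recovers \<open>f y\<close> up to a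
      constant.\<close>
    define u where "u = x - p"
    have fu: "f u \<noteq> 0"
      using \<open>x \<notin> V\<close> p(1) by (auto simp: u_def diff V_def)
    then have u0: "norm u \<noteq> 0"
      using f0 by auto
    have "f y = cinner ((cnj (f u) / (norm u)\<^sup>2) *\<^sub>C u) y" for y
    proof -
      have "y - (f y / f u) *\<^sub>C u \<in> V"
        using fu by (simp add: V_def diff scale)
      then have "cinner u (y - (f y / f u) *\<^sub>C u) = 0"
        using p(2) by (subst cinner_commute) (simp add: u_def)
      then have "cinner u y = f y / f u * (norm u)\<^sup>2"
        by (simp add: cinner_simps cinner_self)
      then show ?thesis
        using fu u0 by (simp add: cinner_simps)
    qed
    then show ?thesis
      by blast
  qed
qed

section \<open>Bounded operators and adjoints\<close>

lemma bop_eqI: "(\<And>x. bop_apply A x = bop_apply B x) \<Longrightarrow> A = B"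
  by (metis blinfun_eqI blinfun_of_bop_inject)

lemma bop_apply_simps [simp]:
  "bop_apply (A + B) x = bop_apply A x + bop_apply B x"
  "bop_apply (A - B) x = bop_apply A x - bop_apply B x"
  "bop_apply (A * B) x = bop_apply A (bop_apply B x)"
  "bop_apply (- A) x = - bop_apply A x"
  "bop_apply (r *\<^sub>R A) x = r *\<^sub>R bop_apply A x"
  "bop_apply 0 x = 0"
  "bop_apply 1 x = x"
  "bop_apply (of_real r) x = r *\<^sub>R x"
  by (simp_all add: of_real_def plus_bop.rep_eq minus_bop.rep_eq times_bop.rep_eq uminus_bop.rep_eq
      scaleR_bop.rep_eq zero_bop.rep_eq one_bop.rep_eq blinfun.bilinear_simps)

lemma bop_apply_linear [simp]:
  "bop_apply A (x + y) = bop_apply A x + bop_apply A y"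
  "bop_apply A (x - y) = bop_apply A x - bop_apply A y"
  "bop_apply A (r *\<^sub>R x) = r *\<^sub>R bop_apply A x"
  "bop_apply A (- x) = - bop_apply A x"
  "bop_apply A 0 = 0"
  by (simp_all add: blinfun.bilinear_simps)

lemma norm_bop_apply: "norm (bop_apply A x) \<le> norm A * norm x"
  by (simp add: norm_bop.rep_eq norm_blinfun)

lemma norm_bop_le: "0 \<le> K \<Longrightarrow> (\<And>x. norm (bop_apply A x) \<le> K * norm x) \<Longrightarrow> norm A \<le> K"
  unfolding norm_bop.rep_eq by (rule norm_blinfun_bound) auto

lemma bounded_bilinear_bop_apply: "bounded_bilinear bop_apply"
  by standard (auto intro!: exI[of _ 1] norm_bop_apply)

lemmas bounded_linear_bop_apply = bounded_bilinear.bounded_linear_left[OF bounded_bilinear_bop_apply]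
lemmas tendsto_bop_apply = bounded_bilinear.tendsto[OF bounded_bilinear_bop_apply]

lemma ex_bop:
  assumes "\<And>x y. g (x + y) = g x + g y" and "\<And>c x. g (c *\<^sub>C x) = c *\<^sub>C g x"
    and "\<And>x. norm (g x) \<le> K * norm x"
  shows "\<exists>B. \<forall>x. bop_apply B x = g x"
proof -
  have "bounded_linear g"
    by (rule bounded_linear_intro[where K = K]) (use assms in \<open>auto simp: scaleR_scaleC mult.commute\<close>)
  then have "blinfun_apply (Blinfun g) = g"
    by (rule bounded_linear_Blinfun_apply)
  then have "bop_apply (Bop (Blinfun g)) = g"
    using assms(2) by (simp add: Bop_inverse)
  then show ?thesis
    by metis
qed

text \<open>\<open>adj\<close> is a definite description, so existence and uniqueness come first:
  Riesz representation yields the value at each \<open>x\<close>, and uniqueness of representing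
  vectors makes it linear in \<open>x\<close>.\<close>

lemma cinner_adj_left: "cinner (bop_apply (adj A) x) y = cinner x (bop_apply A y)"
proof -
  have "\<exists>z. \<forall>y. cinner x (bop_apply A y) = cinner z y" for x
  proof (rule riesz_representation)
    show "cmod (cinner x (bop_apply A y)) \<le> (norm x * norm A) * norm y" for y
      using cinner_Cauchy_Schwarz[of x "bop_apply A y"] mult_left_mono[OF norm_bop_apply[of A y] norm_ge_zero[of x]]
      by (simp add: mult.assoc)
  qed (auto simp: cinner_simps bop_apply_scaleC)
  then obtain g where g: "\<And>x y. cinner (g x) y = cinner x (bop_apply A y)"
    by metis
  have "\<exists>B. \<forall>x. bop_apply B x = g x"
  proof (rule ex_bop)
    show "g (x + y) = g x + g y" for x y
      by (rule cinner_left_cancel) (simp add: g cinner_simps)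
    show "g (c *\<^sub>C x) = c *\<^sub>C g x" for c x
      by (rule cinner_left_cancel) (simp add: g cinner_simps)
    show "norm (g x) \<le> norm A * norm x" for x
    proof (cases "g x = 0")
      case False
      have "(norm (g x))\<^sup>2 = Re (cinner x (bop_apply A (g x)))"
        by (simp add: norm_sq_cinner g)
      also have "\<dots> \<le> norm x * norm (bop_apply A (g x))"
        using complex_Re_le_cmod cinner_Cauchy_Schwarz order_trans by blast
      also have "\<dots> \<le> norm x * (norm A * norm (g x))"
        by (intro mult_left_mono norm_bop_apply) auto
      finally show ?thesis
        using False by (simp add: power2_eq_square mult.assoc[symmetric] mult.commute[of "norm x"])
    qed simp
  qed
  then obtain B where "\<And>x y. cinner (bop_apply B x) y = cinner x (bop_apply A y)"
    using g by metis
  then have B: "\<forall>x y. cinner (bop_apply B x) y = cinner x (bop_apply A y)"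
    by blast
  have "B' = B" if "\<forall>x y. cinner (bop_apply B' x) y = cinner x (bop_apply A y)" for B'
    by (intro bop_eqI cinner_left_cancel) (use that B in metis)
  with B have "\<forall>x y. cinner (bop_apply (adj A) x) y = cinner x (bop_apply A y)"
    unfolding adj_def by (rule theI)
  then show ?thesis
    by blast
qed

lemma cinner_adj_right: "cinner x (bop_apply (adj A) y) = cinner (bop_apply A x) y"
  using cinner_adj_left[of A y x] cinner_commute[of x "bop_apply (adj A) y"]
    cinner_commute[of "bop_apply A x" y] by simp

lemma adj_eqI: "(\<And>x y. cinner (bop_apply B x) y = cinner x (bop_apply A y)) \<Longrightarrow> adj A = B"
  by (intro bop_eqI cinner_left_cancel) (simp add: cinner_adj_left)

lemma adj_adj [simp]: "adj (adj A) = A"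
  by (rule adj_eqI) (simp add: cinner_adj_right)

lemma adj_simps [simp]:
  "adj (A + B) = adj A + adj B"
  "adj (A - B) = adj A - adj B"
  "adj (- A) = - adj A"
  "adj (r *\<^sub>R A) = r *\<^sub>R adj A"
  "adj (A * B) = adj B * adj A"
  "adj 0 = 0"
  "adj 1 = 1"
  "adj (of_real r) = of_real r"
  by (rule adj_eqI; simp add: cinner_adj_left cinner_simps)+

lemma norm_adj [simp]: "norm (adj A) = norm A"
proof -
  have "norm (adj B) \<le> norm B" for B :: "'h :: infdim_separable_hilbert bop"
  proof (rule norm_bop_le)
    show "norm (bop_apply (adj B) x) \<le> norm B * norm x" for x
    proof (cases "bop_apply (adj B) x = 0")
      case False
      have "(norm (bop_apply (adj B) x))\<^sup>2 = Re (cinner x (bop_apply B (bop_apply (adj B) x)))"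
        by (simp add: norm_sq_cinner cinner_adj_left)
      also have "\<dots> \<le> norm x * norm (bop_apply B (bop_apply (adj B) x))"
        using complex_Re_le_cmod cinner_Cauchy_Schwarz order_trans by blast
      also have "\<dots> \<le> norm x * (norm B * norm (bop_apply (adj B) x))"
        by (intro mult_left_mono norm_bop_apply) auto
      finally show ?thesis
        using False by (simp add: power2_eq_square mult.assoc[symmetric] mult.commute[of "norm x"])
    qed simp
  qed simp
  from this[of A] this[of "adj A"] show ?thesis
    by simp
qed

lemma bounded_linear_adj: "bounded_linear adj"
  by (rule bounded_linear_intro[where K = 1]) auto

lemma adj_power [simp]: "adj (A ^ n) = adj A ^ n"
  by (induction n) (auto simp: power_commutes)

lemma adj_exp [simp]: "adj (exp A) = exp (adj A)"
proof -
  have "(\<lambda>n. adj (A ^ n /\<^sub>R fact n)) sums adj (exp A)"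
    by (intro bounded_linear.sums[OF bounded_linear_adj] exp_converges)
  then show ?thesis
    using exp_converges[of "adj A"] by (simp add: sums_unique2)
qed

section \<open>Orthonormal bases\<close>

definition orthonormal :: "'h::complex_inner set \<Rightarrow> bool" where
  "orthonormal E \<longleftrightarrow> (\<forall>e\<in>E. \<forall>f\<in>E. cinner e f = (if e = f then 1 else 0))"

lemma is_onb_orthonormal: "is_onb E \<Longrightarrow> orthonormal E"
  by (simp add: is_onb_def orthonormal_def)

lemma orthonormal_norm:
  assumes "orthonormal E" "e \<in> E"
  shows "norm e = 1"
proof -
  have "cinner e e = 1"
    using assms by (simp add: orthonormal_def)
  then have "complex_of_real ((norm e)\<^sup>2) = 1"
    by (simp only: cinner_self)
  then have "(norm e)\<^sup>2 = 1"
    by (metis of_real_1 of_real_eq_iff)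
  then show ?thesis
    by (simp add: power2_eq_1_iff) (metis norm_ge_zero not_one_le_zero neg_0_le_iff_le)
qed

text \<open>The coefficients are arbitrary: Fourier coefficients give Bessel's inequality, while
  general ones compare with any element of the span, which is how density enters Parseval's
  identity.\<close>

lemma norm_diff_combination_sq:
  assumes "orthonormal E" "finite F" "F \<subseteq> E"
  shows "(norm (x - (\<Sum>e\<in>F. c e *\<^sub>C e)))\<^sup>2 =
    (norm x)\<^sup>2 - (\<Sum>e\<in>F. (cmod (cinner e x))\<^sup>2) + (\<Sum>e\<in>F. (cmod (c e - cinner e x))\<^sup>2)"
  using assms(2,3)
proof (induction F)
  case (insert e F)
  define u where "u = x - (\<Sum>e\<in>F. c e *\<^sub>C e)"
  have "cinner e (\<Sum>f\<in>F. c f *\<^sub>C f) = (\<Sum>f\<in>F. 0)"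
    unfolding cinner_sum_right by (rule sum.cong)
      (use insert assms(1) in \<open>auto simp: cinner_simps orthonormal_def subset_iff\<close>)
  then have "cinner u e = cnj (cinner e x)"
    by (subst cinner_commute) (simp add: u_def cinner_simps)
  moreover have "norm e = 1"
    using insert assms(1) orthonormal_norm by blast
  ultimately have "(norm (u - c e *\<^sub>C e))\<^sup>2 = (norm u)\<^sup>2 + (cmod (c e))\<^sup>2 - 2 * Re (c e * cnj (cinner e x))"
    by (simp add: norm_diff_scaleC_sq)
  also have "\<dots> = (norm u)\<^sup>2 - (cmod (cinner e x))\<^sup>2 + (cmod (c e - cinner e x))\<^sup>2"
    unfolding cmod_power2 by (simp add: algebra_simps power2_eq_square)
  finally have "(norm (u - c e *\<^sub>C e))\<^sup>2 = (norm u)\<^sup>2 - (cmod (cinner e x))\<^sup>2 + (cmod (c e - cinner e x))\<^sup>2" .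
  moreover have eq: "x - (\<Sum>f\<in>insert e F. c f *\<^sub>C f) = u - c e *\<^sub>C e"
    using insert by (simp add: u_def algebra_simps)
  moreover have "(norm u)\<^sup>2 = (norm x)\<^sup>2 - (\<Sum>e\<in>F. (cmod (cinner e x))\<^sup>2) + (\<Sum>e\<in>F. (cmod (c e - cinner e x))\<^sup>2)"
    unfolding u_def using insert by simp
  ultimately show ?case
    unfolding eq using insert(1,2) by simp
qed simp

lemma bessel_inequality:
  assumes "orthonormal E" "finite F" "F \<subseteq> E"
  shows "(\<Sum>e\<in>F. (cmod (cinner e x))\<^sup>2) \<le> (norm x)\<^sup>2"
proof -
  define y where "y = (\<Sum>e\<in>F. cinner e x *\<^sub>C e)"
  have "(norm (x - y))\<^sup>2 = (norm x)\<^sup>2 - (\<Sum>e\<in>F. (cmod (cinner e x))\<^sup>2)"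
    unfolding y_def norm_diff_combination_sq[OF assms] by simp
  then show ?thesis
    by (metis diff_ge_0_iff_ge zero_le_power2)
qed

lemma parseval:
  assumes "is_onb E"
  shows "((\<lambda>e. (cmod (cinner e x))\<^sup>2) has_sum (norm x)\<^sup>2) E"
proof -
  note on = is_onb_orthonormal[OF assms]
  have summable: "(\<lambda>e. (cmod (cinner e x))\<^sup>2) summable_on E"
    by (rule nonneg_bdd_above_summable_on)
      (auto intro!: bdd_aboveI[where M = "(norm x)\<^sup>2"] bessel_inequality[OF on])
  define S where "S = (\<Sum>\<^sub>\<infinity>e\<in>E. (cmod (cinner e x))\<^sup>2)"
  have "S \<le> (norm x)\<^sup>2"
    unfolding S_def by (rule infsum_le_finite_sums[OF summable]) (use bessel_inequality[OF on] in auto)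
  moreover have "(norm x)\<^sup>2 \<le> S"
  proof (rule field_le_epsilon)
    fix d :: real
    assume "d > 0"
    have "x \<in> closure (cvs.span E)"
      using assms by (simp add: is_onb_def)
    then obtain y where y: "y \<in> cvs.span E" "dist y x < sqrt d"
      using \<open>d > 0\<close> by (metis closure_approachable real_sqrt_gt_0_iff)
    then obtain F c where F: "finite F" "F \<subseteq> E" "y = (\<Sum>e\<in>F. c e *\<^sub>C e)"
      unfolding cvs.span_explicit by blast
    have "(norm (x - y))\<^sup>2 < (sqrt d)\<^sup>2"
      using y(2) by (intro power_strict_mono) (auto simp: dist_norm norm_minus_commute)
    moreover have "(norm x)\<^sup>2 - (\<Sum>e\<in>F. (cmod (cinner e x))\<^sup>2) \<le> (norm (x - y))\<^sup>2"
      unfolding F(3) norm_diff_combination_sq[OF on F(1,2)] by (simp add: sum_nonneg)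
    moreover have "(\<Sum>e\<in>F. (cmod (cinner e x))\<^sup>2) \<le> S"
      unfolding S_def by (rule finite_sum_le_infsum[OF summable F(1,2)]) simp
    ultimately show "(norm x)\<^sup>2 \<le> S + d"
      using \<open>d > 0\<close> by simp
  qed
  ultimately show ?thesis
    using has_sum_infsum[OF summable] by (simp add: S_def)
qed

lemma onb_eq_0:
  assumes "is_onb E" "\<And>e. e \<in> E \<Longrightarrow> cinner e x = 0"
  shows "x = 0"
proof -
  have "((\<lambda>e. (cmod (cinner e x))\<^sup>2) has_sum 0) E"
    by (rule has_sum_0) (use assms(2) in auto)
  then have "(norm x)\<^sup>2 = 0"
    by (rule has_sum_unique[OF parseval[OF assms(1)]])
  then show ?thesis
    by simp
qed

text \<open>Passing to the adjoint replaces a density argument: every vector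
  \<open>adj (A - B) x\<close> is orthogonal to the basis.\<close>

lemma bop_eqI_onb:
  assumes "is_onb E" "\<And>e. e \<in> E \<Longrightarrow> bop_apply A e = bop_apply B e"
  shows "A = B"
proof -
  have "bop_apply (adj (A - B)) x = 0" for x
    by (rule onb_eq_0[OF assms(1)]) (simp add: cinner_adj_right assms(2) del: adj_simps)
  then have "adj (A - B) = 0"
    by (intro bop_eqI) simp
  then have "A - B = 0"
    by (metis adj_adj adj_simps(6))
  then show ?thesis
    by simp
qed

lemma bop_eqI_onb_entries:
  assumes "is_onb E" "is_onb F"
    and "\<And>e f. e \<in> E \<Longrightarrow> f \<in> F \<Longrightarrow> cinner e (bop_apply A f) = cinner e (bop_apply B f)"
  shows "A = B"
proof (rule bop_eqI_onb[OF assms(2)])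
  fix f assume "f \<in> F"
  then have "bop_apply A f - bop_apply B f = 0"
    by (intro onb_eq_0[OF assms(1)]) (simp add: cinner_simps assms(3))
  then show "bop_apply A f = bop_apply B f"
    by simp
qed

lemma subspace_closure:
  fixes V :: "'h::complex_inner set"
  assumes "cvs.subspace V"
  shows "cvs.subspace (closure V)"
proof (rule cvs.subspaceI)
  show "0 \<in> closure V"
    using assms cvs.subspace_0 closure_subset by blast
  show "x + y \<in> closure V" if xy: "x \<in> closure V" "y \<in> closure V" for x y
  proof -
    obtain f g where "\<forall>n. f n \<in> V" "f \<longlonglongrightarrow> x" "\<forall>n. g n \<in> V" "g \<longlonglongrightarrow> y"
      using xy unfolding closure_sequential by blast
    then show ?thesis
      unfolding closure_sequential
      by (intro exI[of _ "\<lambda>n. f n + g n"]) (auto intro: tendsto_add cvs.subspace_add[OF assms])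
  qed
  show "c *\<^sub>C x \<in> closure V" if x: "x \<in> closure V" for c x
  proof -
    obtain f where "\<forall>n. f n \<in> V" "f \<longlonglongrightarrow> x"
      using x unfolding closure_sequential by blast
    then show ?thesis
      unfolding closure_sequential
      by (intro exI[of _ "\<lambda>n. c *\<^sub>C f n"]) (auto intro: tendsto_scaleC cvs.subspace_scale[OF assms])
  qed
qed

lemma is_onbI:
  fixes E :: "'h::complex_hilbert_space set"
  assumes "orthonormal E" "\<And>x. (\<And>e. e \<in> E \<Longrightarrow> cinner e x = 0) \<Longrightarrow> x = 0"
  shows "is_onb E"
proof -
  have "x \<in> closure (cvs.span E)" for x
  proof -
    obtain p where p: "p \<in> closure (cvs.span E)"
        "\<And>v. v \<in> closure (cvs.span E) \<Longrightarrow> cinner v (x - p) = 0"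
      using hilbert_projection[OF closed_closure subspace_closure[OF cvs.subspace_span]] by metis
    have "E \<subseteq> closure (cvs.span E)"
      using cvs.span_superset closure_subset by blast
    then have "x - p = 0"
      using p(2) by (intro assms(2)) blast
    with p(1) show ?thesis
      by simp
  qed
  with assms(1) show ?thesis
    by (auto simp: is_onb_def orthonormal_def)
qed

text \<open>Zorn's lemma. The predicate allows two uses: with \<open>True\<close> it produces
  orthonormal bases, with "is an eigenvector" it starts the spectral theorem.\<close>

lemma ex_maximal_orthonormal:
  "\<exists>E. orthonormal E \<and> (\<forall>e\<in>E. P e) \<and> (\<forall>x. P x \<longrightarrow> norm x = 1 \<longrightarrow> (\<exists>e\<in>E. cinner e x \<noteq> 0))"
proof -
  define \<A> where "\<A> = {E. orthonormal E \<and> (\<forall>e\<in>E. P e)}"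
  have "{} \<in> \<A>"
    by (simp add: \<A>_def orthonormal_def)
  moreover have "\<Union>C \<in> \<A>" if "C \<noteq> {}" "subset.chain \<A> C" for C
  proof -
    have "cinner e f = (if e = f then 1 else 0)" if "e \<in> X" "f \<in> Y" "X \<in> C" "Y \<in> C" for e f X Y
    proof -
      have "X \<subseteq> Y \<or> Y \<subseteq> X" "X \<in> \<A>" "Y \<in> \<A>"
        using \<open>subset.chain \<A> C\<close> that unfolding subset.chain_def by blast+
      then have "X \<subseteq> Y \<or> Y \<subseteq> X" "orthonormal X" "orthonormal Y"
        by (simp_all add: \<A>_def)
      then show ?thesis
        using that by (auto simp: orthonormal_def subset_iff)
    qed
    then have "orthonormal (\<Union>C)"
      by (auto simp: orthonormal_def)
    moreover have "\<forall>e\<in>\<Union>C. P e"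
      using \<open>subset.chain \<A> C\<close> by (auto simp: subset.chain_def \<A>_def)
    ultimately show ?thesis
      by (simp add: \<A>_def)
  qed
  ultimately obtain E where E: "E \<in> \<A>" "\<And>X. X \<in> \<A> \<Longrightarrow> E \<subseteq> X \<Longrightarrow> X = E"
    using subset_Zorn_nonempty[of \<A>] by blast
  have "\<exists>e\<in>E. cinner e x \<noteq> 0" if "P x" "norm x = 1" for x
  proof (rule ccontr)
    assume "\<not> (\<exists>e\<in>E. cinner e x \<noteq> 0)"
    then have "cinner e x = 0 \<and> cinner x e = 0" if "e \<in> E" for e
      using that cinner_commute[of x e] by auto
    moreover have "cinner x x = 1"
      using \<open>norm x = 1\<close> by (simp add: cinner_self)
    ultimately have "insert x E \<in> \<A>"
      using E(1) \<open>P x\<close> by (auto simp: \<A>_def orthonormal_def)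
    then have "x \<in> E"
      using E(2) by blast
    then show False
      using \<open>\<not> (\<exists>e\<in>E. cinner e x \<noteq> 0)\<close> \<open>cinner x x = 1\<close> by force
  qed
  with E(1) show ?thesis
    by (auto simp: \<A>_def)
qed

lemma ex_onb: "\<exists>E :: 'h::complex_hilbert_space set. is_onb E"
proof -
  obtain E :: "'h set" where E: "orthonormal E" "\<And>x. norm x = 1 \<Longrightarrow> \<exists>e\<in>E. cinner e x \<noteq> 0"
    using ex_maximal_orthonormal[of "\<lambda>_. True"] by blast
  have "x = 0" if "\<And>e. e \<in> E \<Longrightarrow> cinner e x = 0" for x
  proof (rule ccontr)
    assume "x \<noteq> 0"
    then have "norm (x /\<^sub>R norm x) = 1"
      by simp
    then show False
      using E(2) that by (metis cinner_scaleR_right mult_zero_right)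
  qed
  with E(1) show ?thesis
    using is_onbI by blast
qed

lemma infinite_onb:
  fixes E :: "'h::infdim_separable_hilbert set"
  assumes "is_onb E"
  shows "infinite E"
proof
  assume fin: "finite E"
  have "x = (\<Sum>e\<in>E. cinner e x *\<^sub>C e)" for x
  proof -
    have "(norm x)\<^sup>2 = (\<Sum>e\<in>E. (cmod (cinner e x))\<^sup>2)"
      using parseval[OF assms] fin has_sum_finite_iff by blast
    then have "(norm (x - (\<Sum>e\<in>E. cinner e x *\<^sub>C e)))\<^sup>2 = 0"
      by (subst norm_diff_combination_sq[OF is_onb_orthonormal[OF assms] fin]) auto
    then show ?thesis
      by simp
  qed
  moreover obtain y where y: "\<forall>c. y \<noteq> (\<Sum>b\<in>E. c b *\<^sub>C b)"
    using infinite_dimensional[OF fin] by blast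
  ultimately show False
    using y[rule_format, of "\<lambda>e. cinner e y"] by simp
qed

section \<open>The Hilbert--Schmidt norm\<close>

text \<open>Sum the squared matrix entries over \<open>E \<times> F\<close> by rows and by columns.
  As the two bases are unrelated, applying this twice also shows that the sum does not depend on the
  basis.\<close>

lemma hilbert_schmidt_swap:
  assumes "is_onb E" "is_onb F" "(\<lambda>e. (norm (bop_apply A e))\<^sup>2) summable_on E"
  shows "((\<lambda>f. (norm (bop_apply (adj A) f))\<^sup>2) has_sum (\<Sum>\<^sub>\<infinity>e\<in>E. (norm (bop_apply A e))\<^sup>2)) F"
proof -
  let ?g = "\<lambda>(e, f). (cmod (cinner f (bop_apply A e)))\<^sup>2"
  have 1: "((\<lambda>f. ?g (e, f)) has_sum (norm (bop_apply A e))\<^sup>2) F" for e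
    using parseval[OF assms(2)] by simp
  have "?g summable_on E \<times> F"
    by (rule summable_on_SigmaI[OF 1 assms(3)]) auto
  then have "(?g has_sum (\<Sum>\<^sub>\<infinity>e\<in>E. (norm (bop_apply A e))\<^sup>2)) (E \<times> F)"
    by (rule has_sum_SigmaI[OF 1 has_sum_infsum[OF assms(3)]])
  then have "((\<lambda>(f, e). ?g (e, f)) has_sum (\<Sum>\<^sub>\<infinity>e\<in>E. (norm (bop_apply A e))\<^sup>2)) (F \<times> E)"
    by (subst (asm) has_sum_swap)
  moreover have "((\<lambda>e. (\<lambda>(f, e). ?g (e, f)) (f, e)) has_sum (norm (bop_apply (adj A) f))\<^sup>2) E" for f
    using parseval[OF assms(1), of "bop_apply (adj A) f"]
    by (simp add: cinner_adj_right cmod_cinner_commute[of f])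
  ultimately show ?thesis
    by (rule has_sum_SigmaD)
qed

text \<open>The chosen basis is immaterial for Hilbert-Schmidt operators. For all others the family
  is not summable and the value is the default 0, so norm estimates carry
  \<open>hilbert_schmidt\<close> hypotheses.\<close>

definition hs_norm :: "'h::infdim_separable_hilbert bop \<Rightarrow> real" where
  "hs_norm A = sqrt (\<Sum>\<^sub>\<infinity>e\<in>(SOME E. is_onb E). (norm (bop_apply A e))\<^sup>2)"

lemma hs_norm_nonneg [simp]: "0 \<le> hs_norm A"
  by (simp add: hs_norm_def infsum_nonneg)

lemma hs_norm_has_sum:
  assumes "hilbert_schmidt A" "is_onb E"
  shows "((\<lambda>e. (norm (bop_apply A e))\<^sup>2) has_sum (hs_norm A)\<^sup>2) E"
proof -
  obtain E0 where E0: "is_onb E0" "(\<lambda>e. (norm (bop_apply A e))\<^sup>2) summable_on E0"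
    using assms(1) by (auto simp: hilbert_schmidt_def)
  let ?B = "SOME E :: 'a set. is_onb E"
  have B: "is_onb ?B"
    using ex_onb by (rule someI_ex)
  have swap: "((\<lambda>e. (norm (bop_apply (adj A) e))\<^sup>2) has_sum (\<Sum>\<^sub>\<infinity>e\<in>E0. (norm (bop_apply A e))\<^sup>2)) E0"
    by (rule hilbert_schmidt_swap[OF E0(1) E0(1) E0(2)])
  have "((\<lambda>e. (norm (bop_apply A e))\<^sup>2) has_sum (\<Sum>\<^sub>\<infinity>e\<in>E0. (norm (bop_apply A e))\<^sup>2)) F" if "is_onb F" for F
    using hilbert_schmidt_swap[OF E0(1) that has_sum_imp_summable[OF swap]] infsumI[OF swap] by simp
  from this[OF assms(2)] this[OF B] show ?thesis
    unfolding hs_norm_def by (simp add: infsumI infsum_nonneg)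
qed

lemma hs_norm_eqI:
  assumes "is_onb E" "((\<lambda>e. (norm (bop_apply A e))\<^sup>2) has_sum S) E"
  shows "hilbert_schmidt A \<and> (hs_norm A)\<^sup>2 = S"
  using assms has_sum_unique hs_norm_has_sum by (metis hilbert_schmidt_def summable_on_def)

lemma hilbert_schmidt_adj: "hilbert_schmidt A \<Longrightarrow> hilbert_schmidt (adj A)"
  and hs_norm_adj: "hilbert_schmidt A \<Longrightarrow> hs_norm (adj A) = hs_norm A"
proof -
  assume A: "hilbert_schmidt A"
  obtain E :: "'a set" where E: "is_onb E"
    using ex_onb by blast
  have "((\<lambda>f. (norm (bop_apply (adj A) f))\<^sup>2) has_sum (hs_norm A)\<^sup>2) E"
    using hilbert_schmidt_swap[OF E E has_sum_imp_summable] infsumI hs_norm_has_sum[OF A E] by metis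
  from hs_norm_eqI[OF E this] show "hilbert_schmidt (adj A)" "hs_norm (adj A) = hs_norm A"
    by auto
qed

lemma hs_norm_le_columns:
  assumes F: "is_onb F" and B: "hilbert_schmidt B" and M: "0 \<le> M"
    and le: "\<And>f. f \<in> F \<Longrightarrow> norm (bop_apply A f) \<le> M * norm (bop_apply B f)"
  shows "hilbert_schmidt A" "hs_norm A \<le> M * hs_norm B"
proof -
  have le2: "(norm (bop_apply A f))\<^sup>2 \<le> M\<^sup>2 * (norm (bop_apply B f))\<^sup>2" if "f \<in> F" for f
    using power_mono[OF le[OF that], of 2] by (simp add: power_mult_distrib)
  have sB: "((\<lambda>f. M\<^sup>2 * (norm (bop_apply B f))\<^sup>2) has_sum M\<^sup>2 * (hs_norm B)\<^sup>2) F"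
    by (intro has_sum_cmult_right hs_norm_has_sum B F)
  have "(\<lambda>f. (norm (bop_apply A f))\<^sup>2) summable_on F"
    by (rule summable_on_comparison_test[OF has_sum_imp_summable[OF sB] le2]) auto
  then show A: "hilbert_schmidt A"
    using F hilbert_schmidt_def by blast
  have "(hs_norm A)\<^sup>2 \<le> M\<^sup>2 * (hs_norm B)\<^sup>2"
    by (rule has_sum_mono[OF hs_norm_has_sum[OF A F] sB le2])
  then have "(hs_norm A)\<^sup>2 \<le> (M * hs_norm B)\<^sup>2"
    by (simp add: power_mult_distrib)
  then show "hs_norm A \<le> M * hs_norm B"
    by (rule power2_le_imp_le) (simp add: M)
qed

lemma norm_le_coordinates:
  assumes E: "is_onb E" and M: "0 \<le> M" and le: "\<And>e. e \<in> E \<Longrightarrow> cmod (cinner e x) \<le> M * cmod (cinner e y)"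
  shows "norm x \<le> M * norm y"
proof -
  have le2: "(cmod (cinner e x))\<^sup>2 \<le> M\<^sup>2 * (cmod (cinner e y))\<^sup>2" if "e \<in> E" for e
    using power_mono[OF le[OF that], of 2] by (simp add: power_mult_distrib)
  have "(norm x)\<^sup>2 \<le> M\<^sup>2 * (norm y)\<^sup>2"
    by (rule has_sum_mono[OF parseval[OF E] has_sum_cmult_right[OF parseval[OF E]] le2])
  then have "(norm x)\<^sup>2 \<le> (M * norm y)\<^sup>2"
    by (simp add: power_mult_distrib)
  then show ?thesis
    by (rule power2_le_imp_le) (simp add: M)
qed

text \<open>The rows and columns may refer to different bases. This permits an eigenbasis of one
  operator on the left and of another on the right, and turns scalar inequalities into operator
  inequalities.\<close>

lemma hs_norm_le_entries:
  assumes "is_onb E" "is_onb F" "hilbert_schmidt B" "0 \<le> M"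
    and "\<And>e f. e \<in> E \<Longrightarrow> f \<in> F \<Longrightarrow> cmod (cinner e (bop_apply A f)) \<le> M * cmod (cinner e (bop_apply B f))"
  shows "hilbert_schmidt A" "hs_norm A \<le> M * hs_norm B"
  using hs_norm_le_columns[OF assms(2-4)] norm_le_coordinates[OF assms(1,4)] assms(5) by blast+

lemma hilbert_schmidt_mult_left: "hilbert_schmidt A \<Longrightarrow> hilbert_schmidt (B * A)"
  and hs_norm_mult_left: "hilbert_schmidt A \<Longrightarrow> hs_norm (B * A) \<le> norm B * hs_norm A"
  using hs_norm_le_columns[of _ A "norm B" "B * A"] ex_onb norm_bop_apply by (metis bop_apply_simps(3) norm_ge_zero)+

lemma hilbert_schmidt_mult_right: "hilbert_schmidt A \<Longrightarrow> hilbert_schmidt (A * B)"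
  and hs_norm_mult_right: "hilbert_schmidt A \<Longrightarrow> hs_norm (A * B) \<le> hs_norm A * norm B"
proof -
  assume A: "hilbert_schmidt A"
  have "adj (adj B * adj A) = A * B"
    by simp
  then show "hilbert_schmidt (A * B)" "hs_norm (A * B) \<le> hs_norm A * norm B"
    using hilbert_schmidt_adj hilbert_schmidt_mult_left A hs_norm_adj
      hs_norm_mult_left[OF hilbert_schmidt_adj[OF A], of "adj B"] by (metis, metis norm_adj mult.commute)
qed

lemma norm_le_hs_norm:
  assumes "hilbert_schmidt A"
  shows "norm A \<le> hs_norm A"
proof (rule norm_bop_le)
  fix x
  obtain E :: "'a set" where E: "is_onb E"
    using ex_onb by blast
  have le: "(cmod (cinner e (bop_apply A x)))\<^sup>2 \<le> (norm (bop_apply (adj A) e))\<^sup>2 * (norm x)\<^sup>2" for e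
  proof -
    have "cmod (cinner e (bop_apply A x)) \<le> norm (bop_apply (adj A) e) * norm x"
      using cinner_Cauchy_Schwarz by (metis cinner_adj_left)
    then show ?thesis
      by (metis norm_ge_zero power_mono power_mult_distrib)
  qed
  have "(norm (bop_apply A x))\<^sup>2 \<le> (hs_norm (adj A))\<^sup>2 * (norm x)\<^sup>2"
    by (rule has_sum_mono[OF parseval[OF E]
          has_sum_cmult_left[OF hs_norm_has_sum[OF hilbert_schmidt_adj[OF assms] E]] le])
  then have "(norm (bop_apply A x))\<^sup>2 \<le> (hs_norm A * norm x)\<^sup>2"
    by (simp add: power_mult_distrib hs_norm_adj assms)
  then show "norm (bop_apply A x) \<le> hs_norm A * norm x"
    by (rule power2_le_imp_le) simp
qed simp

lemma hs_norm_eq_0: "hilbert_schmidt A \<Longrightarrow> hs_norm A = 0 \<Longrightarrow> A = 0"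
  using norm_le_hs_norm by fastforce

lemma hilbert_schmidt_0 [simp]: "hilbert_schmidt (0 :: 'a::infdim_separable_hilbert bop)"
  and hs_norm_0 [simp]: "hs_norm (0 :: 'a bop) = 0"
proof -
  obtain E :: "'a set" where "is_onb E"
    using ex_onb by blast
  moreover from this have "((\<lambda>e. (norm (bop_apply (0 :: 'a bop) e))\<^sup>2) has_sum 0) E"
    by (intro has_sum_0) auto
  ultimately show "hilbert_schmidt (0 :: 'a bop)" "hs_norm (0 :: 'a bop) = 0"
    using hs_norm_eqI by fastforce+
qed

lemma hilbert_schmidt_scaleR: "hilbert_schmidt A \<Longrightarrow> hilbert_schmidt (r *\<^sub>R A)"
  and hs_norm_scaleR: "hilbert_schmidt A \<Longrightarrow> hs_norm (r *\<^sub>R A) = \<bar>r\<bar> * hs_norm A"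
proof -
  assume A: "hilbert_schmidt A"
  obtain E :: "'a set" where E: "is_onb E"
    using ex_onb by blast
  have "((\<lambda>e. (norm (bop_apply (r *\<^sub>R A) e))\<^sup>2) has_sum r\<^sup>2 * (hs_norm A)\<^sup>2) E"
    using has_sum_cmult_right[OF hs_norm_has_sum[OF A E], of "r\<^sup>2"] by (simp add: power_mult_distrib)
  then have "hilbert_schmidt (r *\<^sub>R A) \<and> (hs_norm (r *\<^sub>R A))\<^sup>2 = (\<bar>r\<bar> * hs_norm A)\<^sup>2"
    using hs_norm_eqI[OF E] by (simp add: power_mult_distrib)
  then show "hilbert_schmidt (r *\<^sub>R A)" "hs_norm (r *\<^sub>R A) = \<bar>r\<bar> * hs_norm A"
    by (auto simp: power2_eq_iff_nonneg)
qed

lemma hilbert_schmidt_minus: "hilbert_schmidt A \<Longrightarrow> hilbert_schmidt (- A)"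
  using hilbert_schmidt_scaleR[of A "-1"] by simp

lemma hilbert_schmidt_add:
  assumes "hilbert_schmidt A" "hilbert_schmidt B"
  shows "hilbert_schmidt (A + B)"
proof -
  obtain E :: "'a set" where E: "is_onb E"
    using ex_onb by blast
  have "((\<lambda>e. 2 * (norm (bop_apply A e))\<^sup>2 + 2 * (norm (bop_apply B e))\<^sup>2) has_sum
      2 * (hs_norm A)\<^sup>2 + 2 * (hs_norm B)\<^sup>2) E"
    by (intro has_sum_add has_sum_cmult_right hs_norm_has_sum assms E)
  then have "(\<lambda>e. (norm (bop_apply (A + B) e))\<^sup>2) summable_on E"
  proof (rule summable_on_comparison_test[OF has_sum_imp_summable])
    fix e
    show "(norm (bop_apply (A + B) e))\<^sup>2 \<le> 2 * (norm (bop_apply A e))\<^sup>2 + 2 * (norm (bop_apply B e))\<^sup>2"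
      using norm_add_sq[of "bop_apply A e" "bop_apply B e"] norm_diff_sq[of "bop_apply A e" "bop_apply B e"]
        zero_le_power2[of "norm (bop_apply A e - bop_apply B e)"] by (simp del: zero_le_power2)
  qed simp
  with E show ?thesis
    using hilbert_schmidt_def by blast
qed

lemma hilbert_schmidt_diff: "hilbert_schmidt A \<Longrightarrow> hilbert_schmidt B \<Longrightarrow> hilbert_schmidt (A - B)"
  using hilbert_schmidt_add[of A "- B"] hilbert_schmidt_minus by fastforce

lemmas hilbert_schmidt_intros = hilbert_schmidt_add hilbert_schmidt_diff hilbert_schmidt_minus
  hilbert_schmidt_scaleR hilbert_schmidt_mult_left hilbert_schmidt_mult_right hilbert_schmidt_adj
  hilbert_schmidt_0

text \<open>Polarization makes symmetry and the expansion of the squared norm immediate; on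
  Hilbert-Schmidt operators it is the real part of the usual inner product, see
  \<open>hs_inner_has_sum\<close>.\<close>

definition hs_inner :: "'h::infdim_separable_hilbert bop \<Rightarrow> 'h bop \<Rightarrow> real" where
  "hs_inner A B = ((hs_norm (A + B))\<^sup>2 - (hs_norm A)\<^sup>2 - (hs_norm B)\<^sup>2) / 2"

lemma hs_inner_has_sum:
  assumes "hilbert_schmidt A" "hilbert_schmidt B" "is_onb E"
  shows "((\<lambda>e. Re (cinner (bop_apply A e) (bop_apply B e))) has_sum hs_inner A B) E"
proof -
  have "((\<lambda>e. 1/2 * ((norm (bop_apply (A + B) e))\<^sup>2 + -1 * (norm (bop_apply A e))\<^sup>2 + -1 * (norm (bop_apply B e))\<^sup>2))
      has_sum (1/2 * ((hs_norm (A + B))\<^sup>2 + -1 * (hs_norm A)\<^sup>2 + -1 * (hs_norm B)\<^sup>2))) E"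
    by (intro has_sum_add has_sum_cmult_right hs_norm_has_sum hilbert_schmidt_add assms)
  then show ?thesis
    by (simp add: hs_inner_def norm_add_sq)
qed

lemma hs_inner_self: "hilbert_schmidt A \<Longrightarrow> hs_inner A A = (hs_norm A)\<^sup>2"
  using hs_norm_scaleR[of A 2] by (simp add: hs_inner_def scaleR_2 power_mult_distrib)

lemma hs_inner_commute: "hs_inner A B = hs_inner B A"
  by (simp add: hs_inner_def add.commute)

lemma hs_inner_add_left:
  assumes "hilbert_schmidt A" "hilbert_schmidt B" "hilbert_schmidt C"
  shows "hs_inner (A + B) C = hs_inner A C + hs_inner B C"
proof -
  obtain E :: "'a set" where E: "is_onb E"
    using ex_onb by blast
  show ?thesis
    using has_sum_unique[OF hs_inner_has_sum[OF hilbert_schmidt_add[OF assms(1,2)] assms(3) E]]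
      has_sum_add[OF hs_inner_has_sum[OF assms(1,3) E] hs_inner_has_sum[OF assms(2,3) E]]
    by (simp add: cinner_simps)
qed

lemma hs_inner_scaleR_left:
  assumes "hilbert_schmidt A" "hilbert_schmidt C"
  shows "hs_inner (r *\<^sub>R A) C = r * hs_inner A C"
proof -
  obtain E :: "'a set" where E: "is_onb E"
    using ex_onb by blast
  show ?thesis
    using has_sum_unique[OF hs_inner_has_sum[OF hilbert_schmidt_scaleR[OF assms(1)] assms(2) E]]
      has_sum_cmult_right[OF hs_inner_has_sum[OF assms E]]
    by (simp add: cinner_simps)
qed

lemma quadratic_discriminant_le:
  fixes a b c :: real
  assumes quad: "\<And>t. 0 \<le> a + 2 * t * b + t\<^sup>2 * c" and "0 \<le> c"
  shows "b\<^sup>2 \<le> a * c"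
proof (cases "c = 0")
  case True
  have "b = 0"
  proof (rule ccontr)
    assume "b \<noteq> 0"
    \<comment> \<open>Chosen so that the polynomial, which is linear when \<open>c = 0\<close>,
      takes the value -1.\<close>
    define t where "t = - (a + 1) / (2 * b)"
    have "2 * t * b = - (a + 1)"
      using \<open>b \<noteq> 0\<close> by (simp add: t_def)
    then show False
      using quad[of t] True by simp
  qed
  with True show ?thesis
    by simp
next
  case False
  have "a + 2 * (- b / c) * b + (- b / c)\<^sup>2 * c = a - b\<^sup>2 / c"
    using False by (simp add: power2_eq_square)
  then have "b\<^sup>2 / c \<le> a"
    using quad[of "- b / c"] by linarith
  then show ?thesis
    using False \<open>0 \<le> c\<close> by (simp add: pos_divide_le_eq)
qed

lemma hs_norm_add_sq:
  "(hs_norm (A + B))\<^sup>2 = (hs_norm A)\<^sup>2 + (hs_norm B)\<^sup>2 + 2 * hs_inner A B"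
  by (simp add: hs_inner_def diff_divide_distrib)

lemma hs_Cauchy_Schwarz:
  assumes "hilbert_schmidt A" "hilbert_schmidt B"
  shows "\<bar>hs_inner A B\<bar> \<le> hs_norm A * hs_norm B"
proof -
  have "0 \<le> (hs_norm A)\<^sup>2 + 2 * t * hs_inner A B + t\<^sup>2 * (hs_norm B)\<^sup>2" for t
    using hs_norm_add_sq[of A "t *\<^sub>R B"] zero_le_power2[of "hs_norm (A + t *\<^sub>R B)"] assms
    by (simp add: hs_norm_scaleR hs_inner_commute[of A] hs_inner_scaleR_left power_mult_distrib
        algebra_simps del: zero_le_power2)
  then have "(hs_inner A B)\<^sup>2 \<le> (hs_norm A * hs_norm B)\<^sup>2"
    unfolding power_mult_distrib by (rule quadratic_discriminant_le) simp
  then show ?thesis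
    using abs_le_square_iff[of "hs_inner A B" "hs_norm A * hs_norm B"] by simp
qed

lemma hs_norm_triangle:
  assumes "hilbert_schmidt A" "hilbert_schmidt B"
  shows "hs_norm (A + B) \<le> hs_norm A + hs_norm B"
proof (rule power2_le_imp_le)
  show "(hs_norm (A + B))\<^sup>2 \<le> (hs_norm A + hs_norm B)\<^sup>2"
    using hs_Cauchy_Schwarz[OF assms] unfolding hs_norm_add_sq power2_sum by linarith
qed simp

lemma hs_norm_minus: "hilbert_schmidt A \<Longrightarrow> hs_norm (- A) = hs_norm A"
  using hs_norm_scaleR[of A "-1"] by simp

lemma hs_norm_diff_commute: "hilbert_schmidt (A - B) \<Longrightarrow> hs_norm (A - B) = hs_norm (B - A)"
  using hs_norm_minus[of "A - B"] by simp

lemma hilbert_schmidt_sum: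
  "(\<And>i. i \<in> I \<Longrightarrow> hilbert_schmidt (A i)) \<Longrightarrow> hilbert_schmidt (sum A I)"
  by (induction I rule: infinite_finite_induct) (auto intro: hilbert_schmidt_add)

lemma hs_norm_sum:
  "(\<And>i. i \<in> I \<Longrightarrow> hilbert_schmidt (A i)) \<Longrightarrow> hs_norm (sum A I) \<le> (\<Sum>i\<in>I. hs_norm (A i))"
proof (induction I rule: infinite_finite_induct)
  case (insert i I)
  have "hs_norm (A i + sum A I) \<le> hs_norm (A i) + hs_norm (sum A I)"
    by (intro hs_norm_triangle hilbert_schmidt_sum) (use insert in auto)
  moreover have "hs_norm (sum A I) \<le> (\<Sum>i\<in>I. hs_norm (A i))"
    using insert by auto
  ultimately show ?case
    unfolding sum.insert[OF insert(1,2)] by linarith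
qed auto

text \<open>Lower semicontinuity under operator-norm limits: each finite partial sum over a basis
  passes to the limit.\<close>

lemma hs_norm_limit_le:
  assumes lim: "X \<longlonglongrightarrow> A" and X: "\<And>n. hilbert_schmidt (X n)" "\<forall>\<^sub>F n in sequentially. hs_norm (X n) \<le> C"
  shows "hilbert_schmidt A" "hs_norm A \<le> C"
proof -
  obtain E :: "'a set" where E: "is_onb E"
    using ex_onb by blast
  have C: "0 \<le> C"
    using X(2) hs_norm_nonneg by (meson eventually_False_sequentially eventually_mono order_trans)
  have le: "(\<Sum>e\<in>F. (norm (bop_apply A e))\<^sup>2) \<le> C\<^sup>2" if "finite F" "F \<subseteq> E" for F
  proof (rule tendsto_upperbound)
    show "(\<lambda>n. \<Sum>e\<in>F. (norm (bop_apply (X n) e))\<^sup>2) \<longlonglongrightarrow> (\<Sum>e\<in>F. (norm (bop_apply A e))\<^sup>2)"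
      by (intro tendsto_intros tendsto_bop_apply lim)
    show "\<forall>\<^sub>F n in sequentially. (\<Sum>e\<in>F. (norm (bop_apply (X n) e))\<^sup>2) \<le> C\<^sup>2"
      using X(2)
    proof eventually_elim
      case (elim n)
      have "(\<Sum>e\<in>F. (norm (bop_apply (X n) e))\<^sup>2) \<le> (hs_norm (X n))\<^sup>2"
        by (rule finite_sum_le_has_sum[OF hs_norm_has_sum[OF X(1) E] that]) simp
      also have "\<dots> \<le> C\<^sup>2"
        by (rule power_mono[OF elim]) simp
      finally show ?case .
    qed
  qed simp
  have summable: "(\<lambda>e. (norm (bop_apply A e))\<^sup>2) summable_on E"
    by (rule nonneg_bdd_above_summable_on) (use le in \<open>auto intro!: bdd_aboveI[where M = "C\<^sup>2"]\<close>)
  then show A: "hilbert_schmidt A"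
    using E hilbert_schmidt_def by blast
  have "(hs_norm A)\<^sup>2 \<le> C\<^sup>2"
    using has_sum_le_finite_sums[OF hs_norm_has_sum[OF A E] le] .
  then show "hs_norm A \<le> C"
    using C by (rule power2_le_imp_le)
qed

text \<open>The limit is found in operator norm; fixing one index and letting the other tend to
  infinity in the Cauchy estimate upgrades the convergence by
  \<open>hs_norm_limit_le\<close>.\<close>

lemma hs_complete:
  assumes X: "\<And>n. hilbert_schmidt (X n)"
    and Cauchy: "\<And>d. d > 0 \<Longrightarrow> \<exists>N. \<forall>j\<ge>N. \<forall>k\<ge>N. hs_norm (X j - X k) < d"
  obtains A where "hilbert_schmidt A" "(\<lambda>n. hs_norm (X n - A)) \<longlonglongrightarrow> 0" "X \<longlonglongrightarrow> A"
proof -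
  have le: "norm (X j - X k) \<le> hs_norm (X j - X k)" for j k
    by (intro norm_le_hs_norm hilbert_schmidt_diff X)
  have "Cauchy X"
    unfolding Cauchy_def dist_norm using Cauchy le by (meson le_less_trans)
  then obtain A where A: "X \<longlonglongrightarrow> A"
    using Cauchy_convergent convergent_def by blast
  have *: "\<exists>N. \<forall>j\<ge>N. hilbert_schmidt (X j - A) \<and> hs_norm (X j - A) \<le> d" if "d > 0" for d
  proof -
    obtain N where N: "\<And>j k. j \<ge> N \<Longrightarrow> k \<ge> N \<Longrightarrow> hs_norm (X j - X k) < d"
      using Cauchy[OF \<open>d > 0\<close>] by blast
    have "hilbert_schmidt (X j - A) \<and> hs_norm (X j - A) \<le> d" if "j \<ge> N" for j
    proof -
      have "(\<lambda>k. X j - X k) \<longlonglongrightarrow> X j - A"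
        by (intro tendsto_intros A)
      moreover have "\<forall>\<^sub>F k in sequentially. hs_norm (X j - X k) \<le> d"
        using N[OF that] by (auto simp: eventually_sequentially intro: less_imp_le)
      ultimately show ?thesis
        using hs_norm_limit_le[of "\<lambda>k. X j - X k"] X hilbert_schmidt_diff by blast
    qed
    then show ?thesis
      by blast
  qed
  obtain j where "hilbert_schmidt (X j - A)"
    using *[of 1] by auto
  from hilbert_schmidt_diff[OF X[of j] this] have "hilbert_schmidt A"
    by simp
  moreover have "(\<lambda>n. hs_norm (X n - A)) \<longlonglongrightarrow> 0"
    unfolding LIMSEQ_def dist_real_def
  proof (intro allI impI)
    fix d :: real
    assume "d > 0"
    then show "\<exists>N. \<forall>n\<ge>N. \<bar>hs_norm (X n - A) - 0\<bar> < d"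
      using *[of "d / 2"] by fastforce
  qed
  ultimately show thesis
    using A that by blast
qed

lemma hs_norm_sums_le:
  assumes A: "A sums S" and hs: "\<And>n. hilbert_schmidt (A n)"
    and le: "\<And>n. hs_norm (A n) \<le> b n" and b: "b sums B"
  shows "hilbert_schmidt S" "hs_norm S \<le> B"
proof -
  have "0 \<le> b n" for n
    using le[of n] hs_norm_nonneg[of "A n"] by linarith
  then have "hs_norm (\<Sum>i<n. A i) \<le> B" for n
    using hs_norm_sum[of "{..<n}" A] hs sum_mono[of "{..<n}" "\<lambda>i. hs_norm (A i)" b] le
      sum_le_suminf[of b "{..<n}"] b by (simp add: sums_iff)
  moreover have "hilbert_schmidt (\<Sum>i<n. A i)" for n
    by (intro hilbert_schmidt_sum hs)
  ultimately show "hilbert_schmidt S" "hs_norm S \<le> B"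
    using hs_norm_limit_le[of "\<lambda>n. \<Sum>i<n. A i" S B] A unfolding sums_def by simp_all
qed

section \<open>Spectral theorem for self-adjoint Hilbert--Schmidt operators\<close>

definition sa_hs :: "'h::infdim_separable_hilbert bop set" where
  "sa_hs = {A. hilbert_schmidt A \<and> adj A = A}"

lemma sa_hsD: "A \<in> sa_hs \<Longrightarrow> hilbert_schmidt A" "A \<in> sa_hs \<Longrightarrow> adj A = A"
  by (auto simp: sa_hs_def)

lemma hs_inner_mult_left:
  assumes "hilbert_schmidt X" "hilbert_schmidt Y"
  shows "hs_inner (C * X) Y = hs_inner X (adj C * Y)"
proof -
  obtain E :: "'a set" where E: "is_onb E"
    using ex_onb by blast
  show ?thesis
    using has_sum_unique[OF hs_inner_has_sum[OF hilbert_schmidt_mult_left[OF assms(1), of C] assms(2) E]]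
      hs_inner_has_sum[OF assms(1) hilbert_schmidt_mult_left[OF assms(2), of "adj C"] E]
    by (simp add: cinner_adj_right)
qed

lemma norm_adj_mult_self: "norm (adj A * A) = (norm A)\<^sup>2"
proof (rule antisym)
  show "norm (adj A * A) \<le> (norm A)\<^sup>2"
    using norm_mult_ineq[of "adj A" A] by (simp add: power2_eq_square)
  have "norm A \<le> sqrt (norm (adj A * A))"
  proof (rule norm_bop_le)
    fix x
    have "(norm (bop_apply A x))\<^sup>2 = Re (cinner x (bop_apply (adj A * A) x))"
      by (simp add: norm_sq_cinner cinner_adj_right)
    also have "\<dots> \<le> norm x * norm (bop_apply (adj A * A) x)"
      using complex_Re_le_cmod cinner_Cauchy_Schwarz order_trans by blast
    also have "\<dots> \<le> norm x * (norm (adj A * A) * norm x)"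
      by (intro mult_left_mono norm_bop_apply) auto
    finally have "(norm (bop_apply A x))\<^sup>2 \<le> (sqrt (norm (adj A * A)) * norm x)\<^sup>2"
      by (simp add: power_mult_distrib power2_eq_square[of "norm x"] mult_ac)
    then show "norm (bop_apply A x) \<le> sqrt (norm (adj A * A)) * norm x"
      by (rule power2_le_imp_le) simp
  qed simp
  then have "(norm A)\<^sup>2 \<le> (sqrt (norm (adj A * A)))\<^sup>2"
    by (rule power_mono) simp
  then show "(norm A)\<^sup>2 \<le> norm (adj A * A)"
    by simp
qed

text \<open>The identity \<open>norm_adj_mult_self\<close> settles exponents that are powers of 2;
  any other power is a factor of one of these, and all powers have norm at most 1.\<close>

lemma norm_power_selfadjoint:
  assumes "adj C = C" "norm C = 1"
  shows "norm (C ^ k) = 1"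
proof (rule antisym)
  show "norm (C ^ k) \<le> 1"
    using norm_power_ineq[of C k] assms by simp
  have pow2: "norm (C ^ (2 ^ j)) = 1" for j
  proof (induction j)
    case (Suc j)
    have "C ^ (2 ^ Suc j) = adj (C ^ (2 ^ j)) * C ^ (2 ^ j)"
      by (simp add: assms mult_2 power_add)
    then show ?case
      using Suc by (simp add: norm_adj_mult_self del: adj_power)
  qed (use assms in simp)
  have "C ^ (2 ^ k) = C ^ k * C ^ (2 ^ k - k)"
    by (simp flip: power_add add: less_imp_le)
  then have "1 \<le> norm (C ^ k) * norm (C ^ (2 ^ k - k))"
    using norm_mult_ineq[of "C ^ k" "C ^ (2 ^ k - k)"] pow2[of k] by simp
  also have "\<dots> \<le> norm (C ^ k) * 1"
    using norm_power_ineq[of C "2 ^ k - k"] assms by (intro mult_left_mono) auto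
  finally show "1 \<le> norm (C ^ k)"
    by simp
qed

text \<open>
  Power iteration: for a self-adjoint contraction \<open>C\<close> of norm 1 the even powers form a Cauchy
  sequence in Hilbert--Schmidt norm, since \<open>\<langle>C\<^sup>a, C\<^sup>b\<rangle>\<close> only depends on \<open>a + b\<close>; the range of the limit
  consists of fixed points of \<open>C\<^sup>2\<close>.
\<close>

lemma ex_fixed_point_square:
  assumes C: "C \<in> sa_hs" and norm1: "norm C = 1"
  shows "\<exists>z. z \<noteq> 0 \<and> bop_apply C (bop_apply C z) = z"
proof -
  note hs = sa_hsD(1)[OF C] and adj = sa_hsD(2)[OF C]
  have hsp: "hilbert_schmidt (C ^ Suc k)" for k
    by (simp add: hilbert_schmidt_mult_right hs)
  have shift: "hs_inner (C ^ (Suc n + i)) (C ^ Suc m) = hs_inner (C ^ Suc n) (C ^ (Suc m + i))" for n m i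
  proof (induction i arbitrary: m)
    case (Suc i)
    have "hs_inner (C ^ (Suc n + Suc i)) (C ^ Suc m) = hs_inner (C * C ^ (Suc (n + i))) (C ^ Suc m)"
      by simp
    also have "\<dots> = hs_inner (C ^ Suc (n + i)) (adj C * C ^ Suc m)"
      by (rule hs_inner_mult_left[OF hsp hsp])
    also have "\<dots> = hs_inner (C ^ (Suc n + i)) (C ^ Suc (Suc m))"
      by (simp add: adj)
    also have "\<dots> = hs_inner (C ^ Suc n) (C ^ (Suc m + Suc i))"
      by (subst Suc) simp
    finally show ?case .
  qed simp
  define q where "q k = (hs_norm (C ^ Suc k))\<^sup>2" for k
  have "decseq q"
  proof (rule decseq_SucI)
    fix k
    have "hs_norm (C * C ^ Suc k) \<le> norm C * hs_norm (C ^ Suc k)"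
      by (rule hs_norm_mult_left[OF hsp])
    then show "q (Suc k) \<le> q k"
      by (simp add: q_def norm1 power_mono)
  qed
  moreover have "bdd_below (range q)"
    by (intro bdd_belowI[where m = 0]) (auto simp: q_def)
  ultimately obtain L where L: "q \<longlonglongrightarrow> L"
    using decseq_convergent[of q 0] by (auto simp: q_def)
  \<comment> \<open>\<open>X n\<close> is the power \<open>2 * n + 2\<close>, and \<open>q k\<close>
    belongs to the power \<open>k + 1\<close>; hence the inner product of \<open>X n\<close> and
    \<open>X m\<close> is \<open>q (n + m + 1)\<close>.\<close>
  define X where "X n = C ^ Suc (2 * n + 1)" for n
  have inner_le: "hs_inner (X n) (X m) = q (n + m + 1)" if "n \<le> m" for n m
  proof -
    have "Suc (2 * m + 1) = Suc (n + m + 1) + (m - n)" "Suc (2 * n + 1) + (m - n) = Suc (n + m + 1)"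
      using that by auto
    then have "hs_inner (X n) (X m) = hs_inner (C ^ Suc (n + m + 1)) (C ^ Suc (n + m + 1))"
      unfolding X_def by (metis shift)
    then show ?thesis
      by (simp add: q_def hs_inner_self[OF hsp] del: power_Suc)
  qed
  have inner: "hs_inner (X n) (X m) = q (n + m + 1)" for n m
    using inner_le[of n m] inner_le[of m n] by (cases "n \<le> m") (auto simp: hs_inner_commute add.commute)
  have hsX: "hilbert_schmidt (X n)" for n
    unfolding X_def by (rule hsp)
  have dist: "(hs_norm (X n - X m))\<^sup>2 = q (n + n + 1) + q (m + m + 1) - 2 * q (n + m + 1)" for n m
  proof -
    have nX: "(hs_norm (X k))\<^sup>2 = q (k + k + 1)" for k
      using inner[of k k] hs_inner_self[OF hsX] by simp
    have "hs_inner (X n) (- X m) = - q (n + m + 1)"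
      using hs_inner_scaleR_left[OF hsX hsX, of "-1" m n] inner[of m n] hs_inner_commute[of "X n" "- X m"]
      by (simp add: add.commute)
    then show ?thesis
      using hs_norm_add_sq[of "X n" "- X m"] by (simp add: hs_norm_minus[OF hsX] nX)
  qed
  obtain P where P: "hilbert_schmidt P" "X \<longlonglongrightarrow> P"
  proof (rule hs_complete[of X])
    fix d :: real
    assume "d > 0"
    then have "0 < d\<^sup>2 / 4"
      by simp
    then obtain N where N: "\<And>k. k \<ge> N \<Longrightarrow> \<bar>q k - L\<bar> < d\<^sup>2 / 4"
      using L unfolding LIMSEQ_def dist_real_def by blast
    have "hs_norm (X j - X k) < d" if "j \<ge> N" "k \<ge> N" for j k
    proof -
      have "\<bar>q (j + j + 1) - L\<bar> < d\<^sup>2 / 4" "\<bar>q (k + k + 1) - L\<bar> < d\<^sup>2 / 4" "\<bar>q (j + k + 1) - L\<bar> < d\<^sup>2 / 4"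
        by (rule N; use that in linarith)+
      then have "(hs_norm (X j - X k))\<^sup>2 < d\<^sup>2"
        unfolding dist by linarith
      then show ?thesis
        using \<open>d > 0\<close> by (simp add: power2_less_imp_less)
    qed
    then show "\<exists>N. \<forall>j\<ge>N. \<forall>k\<ge>N. hs_norm (X j - X k) < d"
      by blast
  qed (use hsX in auto)
  \<comment> \<open>Operator norms pass to the limit, so \<open>P\<close> has norm 1. This is what
    prevents the iteration from collapsing to 0.\<close>
  have "(\<lambda>n. norm (X n)) \<longlonglongrightarrow> norm P"
    by (intro tendsto_intros P)
  then have "norm P = 1"
    unfolding X_def norm_power_selfadjoint[OF adj norm1] by (simp add: LIMSEQ_const_iff)
  then obtain y where "bop_apply P y \<noteq> 0"
    by (metis bop_apply_simps(6) bop_eqI norm_zero zero_neq_one)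
  have "(\<lambda>n. C * (C * X n)) \<longlonglongrightarrow> C * (C * P)"
    by (intro tendsto_intros P)
  moreover have "(\<lambda>n. C * (C * X n)) = (\<lambda>n. X (Suc n))"
    by (rule ext) (simp add: X_def)
  ultimately have "(\<lambda>n. X (Suc n)) \<longlonglongrightarrow> C * (C * P)"
    by (simp only:)
  then have "C * (C * P) = P"
    using LIMSEQ_Suc[OF P(2)] by (rule LIMSEQ_unique)
  then have "bop_apply (C * (C * P)) y = bop_apply P y"
    by simp
  then have "bop_apply C (bop_apply C (bop_apply P y)) = bop_apply P y"
    by simp
  with \<open>bop_apply P y \<noteq> 0\<close> show ?thesis
    by blast
qed

lemma ex_nonzero_eigenvalue:
  assumes A: "A \<in> sa_hs" and "A \<noteq> 0"
  shows "\<exists>x r. norm x = 1 \<and> r \<noteq> 0 \<and> bop_apply A x = r *\<^sub>R x"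
proof -
  define s where "s = norm A"
  have s: "s > 0"
    using \<open>A \<noteq> 0\<close> by (simp add: s_def)
  define C where "C = A /\<^sub>R s"
  have "C \<in> sa_hs"
    using A by (auto simp: sa_hs_def C_def intro: hilbert_schmidt_intros)
  moreover have "norm C = 1"
    using s by (simp add: C_def s_def)
  ultimately obtain z where z: "z \<noteq> 0" "bop_apply C (bop_apply C z) = z"
    using ex_fixed_point_square by blast
  have "\<exists>w t. w \<noteq> 0 \<and> t \<noteq> (0::real) \<and> bop_apply C w = t *\<^sub>R w"
  \<comment> \<open>Since \<open>C\<close> squared fixes \<open>z\<close>, it also fixes
    \<open>z + C z\<close> under one application of \<open>C\<close>; if that vector vanishes,
    \<open>z\<close> itself has eigenvalue -1.\<close>
  proof (cases "z + bop_apply C z = 0")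
    case True
    then have "bop_apply C z = (-1) *\<^sub>R z"
      by (simp add: add_eq_0_iff)
    then show ?thesis
      using z by (intro exI[of _ z] exI[of _ "-1"]) auto
  next
    case False
    then show ?thesis
      using z by (intro exI[of _ "z + bop_apply C z"] exI[of _ 1]) auto
  qed
  then obtain w t where w: "w \<noteq> 0" "t \<noteq> (0::real)" "bop_apply C w = t *\<^sub>R w"
    by blast
  have "A = s *\<^sub>R C"
    using s by (simp add: C_def)
  then have "bop_apply A (w /\<^sub>R norm w) = (s * t) *\<^sub>R (w /\<^sub>R norm w)"
    using w by simp
  moreover have "norm (w /\<^sub>R norm w) = 1" "s * t \<noteq> 0"
    using w s by auto
  ultimately show ?thesis
    by blast
qed

lemma ex_projection_bop:
  fixes V :: "'h::infdim_separable_hilbert set"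
  assumes V: "closed V" "cvs.subspace V"
  shows "\<exists>Q. adj Q = Q \<and> (\<forall>x. bop_apply Q x \<in> V) \<and> (\<forall>x\<in>V. bop_apply Q x = x)"
proof -
  have "\<exists>p. p \<in> V \<and> (\<forall>v\<in>V. cinner v (x - p) = 0)" for x
    using hilbert_projection[OF V] by metis
  then obtain g where g: "\<And>x. g x \<in> V" "\<And>x v. v \<in> V \<Longrightarrow> cinner v (x - g x) = 0"
    by metis
  have unique: "g x = p" if "p \<in> V" "\<And>v. v \<in> V \<Longrightarrow> cinner v (x - p) = 0" for x p
  proof -
    have "p - g x \<in> V"
      using that g V(2) by (simp add: cvs.subspace_diff)
    then have "cinner (p - g x) (x - g x) - cinner (p - g x) (x - p) = 0"
      using that g by simp
    then have "cinner (p - g x) (p - g x) = 0"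
      by (simp flip: cinner_diff_right)
    then show ?thesis
      by simp
  qed
  have "\<exists>B. \<forall>x. bop_apply B x = g x"
  proof (rule ex_bop)
    show "g (x + y) = g x + g y" for x y
    proof (rule unique)
      show "cinner v (x + y - (g x + g y)) = 0" if "v \<in> V" for v
        using g(2)[OF that, of x] g(2)[OF that, of y] by (simp add: cinner_simps)
    qed (use g V(2) cvs.subspace_add in blast)
    show "g (c *\<^sub>C x) = c *\<^sub>C g x" for c x
    proof (rule unique)
      show "cinner v (c *\<^sub>C x - c *\<^sub>C g x) = 0" if "v \<in> V" for v
        using g(2)[OF that, of x] by (simp add: cinner_simps)
    qed (use g V(2) cvs.subspace_scale in blast)
    show "norm (g x) \<le> 1 * norm x" for x
    proof -
      have "(norm x)\<^sup>2 = (norm (g x))\<^sup>2 + (norm (x - g x))\<^sup>2"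
        using norm_add_sq[of "g x" "x - g x"] g by simp
      then have "(norm (g x))\<^sup>2 \<le> (norm x)\<^sup>2"
        by simp
      then show ?thesis
        by (simp add: abs_le_square_iff[symmetric])
    qed
  qed
  then obtain Q where Q: "\<And>x. bop_apply Q x = g x"
    by blast
  have "adj Q = Q"
  proof (rule adj_eqI)
    fix x y
    have "cinner (g x) y = cinner (g x) (g y)"
      using g(2)[OF g(1)[of x], of y] by (simp add: cinner_simps)
    moreover have "cinner x (g y) = cinner (g x) (g y)"
      using g(2)[OF g(1)[of y], of x] cinner_commute[of "g y" "x - g x"] by (simp add: cinner_simps)
    ultimately show "cinner (bop_apply Q x) y = cinner x (bop_apply Q y)"
      by (simp add: Q)
  qed
  moreover have "g x = x" if "x \<in> V" for x
    by (rule unique) (use that in auto)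
  ultimately show ?thesis
    using Q g(1) by metis
qed

text \<open>The operator need not be Hilbert-Schmidt, so that exponentials and elements of
  \<open>HR\<close> are covered too.\<close>

definition eigenbasis :: "'h::infdim_separable_hilbert bop \<Rightarrow> 'h set \<Rightarrow> ('h \<Rightarrow> real) \<Rightarrow> bool" where
  "eigenbasis A E l \<longleftrightarrow> is_onb E \<and> (\<forall>e\<in>E. bop_apply A e = l e *\<^sub>R e)"

text \<open>Let \<open>V\<close> be the orthogonal complement of a maximal orthonormal family of
  eigenvectors. The compression of \<open>A\<close> to \<open>V\<close> is again self-adjoint and
  Hilbert-Schmidt; were it nonzero, it would have an eigenvector in \<open>V\<close>. So
  \<open>A\<close> vanishes on \<open>V\<close>, and every unit vector of \<open>V\<close> would be
  an eigenvector for 0.\<close>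

lemma spectral_theorem:
  assumes A: "A \<in> sa_hs"
  obtains E l where "eigenbasis A E l"
proof -
  obtain E where E: "orthonormal E" "\<And>e. e \<in> E \<Longrightarrow> \<exists>r. bop_apply A e = r *\<^sub>R e"
      "\<And>x r. bop_apply A x = r *\<^sub>R x \<Longrightarrow> norm x = 1 \<Longrightarrow> \<exists>e\<in>E. cinner e x \<noteq> 0"
    using ex_maximal_orthonormal[of "\<lambda>x. \<exists>r. bop_apply A x = r *\<^sub>R x"] by blast
  define V where "V = {x. \<forall>e\<in>E. cinner e x = 0}"
  have "closed V"
  proof -
    have "V = (\<Inter>e\<in>E. {x. cinner e x = 0})"
      by (auto simp: V_def)
    moreover have "closed {x. cinner e x = 0}" for e :: 'a
      by (intro closed_Collect_eq continuous_on_const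
          linear_continuous_on bounded_bilinear.bounded_linear_right[OF bounded_bilinear_cinner])
    ultimately show ?thesis
      by auto
  qed
  moreover have "cvs.subspace V"
    by (rule cvs.subspaceI) (auto simp: V_def cinner_simps)
  ultimately obtain Q where Q: "adj Q = Q" "\<And>x. bop_apply Q x \<in> V" "\<And>x. x \<in> V \<Longrightarrow> bop_apply Q x = x"
    using ex_projection_bop by metis
  have invariant: "bop_apply A x \<in> V" if "x \<in> V" for x
  proof -
    have "cinner e (bop_apply A x) = 0" if "e \<in> E" for e
    proof -
      obtain r where "bop_apply A e = r *\<^sub>R e"
        using E(2) \<open>e \<in> E\<close> by blast
      moreover have "cinner e (bop_apply A x) = cinner (bop_apply A e) x"
        using cinner_adj_left[of A e x] sa_hsD(2)[OF A] by simp
      ultimately show ?thesis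
        using \<open>x \<in> V\<close> \<open>e \<in> E\<close> by (simp add: V_def cinner_simps)
    qed
    then show ?thesis
      by (simp add: V_def)
  qed
  have not_in_V: "norm x \<noteq> 1" if "x \<in> V" "bop_apply A x = r *\<^sub>R x" for x r
    using E(3)[OF that(2)] that(1) by (auto simp: V_def)
  have T: "Q * A * Q \<in> sa_hs"
    using A Q(1) by (auto simp: sa_hs_def mult.assoc intro: hilbert_schmidt_intros)
  have zero: "Q * A * Q = 0"
  proof (rule ccontr)
    assume "Q * A * Q \<noteq> 0"
    then obtain y r where y: "norm y = 1" "r \<noteq> 0" "bop_apply (Q * A * Q) y = r *\<^sub>R y"
      using ex_nonzero_eigenvalue[OF T] by blast
    have "y = bop_apply Q (bop_apply A (bop_apply Q (y /\<^sub>R r)))"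
      using y by simp
    then have "y \<in> V"
      using Q(2) by metis
    then have "bop_apply A y = r *\<^sub>R y"
      using y(3) Q(3) invariant by simp
    then show False
      using not_in_V \<open>y \<in> V\<close> y(1) by blast
  qed
  have "is_onb E"
  proof (rule is_onbI[OF E(1)], rule ccontr)
    fix x
    assume "\<And>e. e \<in> E \<Longrightarrow> cinner e x = 0" "x \<noteq> 0"
    then have "x \<in> V"
      by (simp add: V_def)
    then have "bop_apply A x = bop_apply (Q * A * Q) x"
      using Q(3) invariant by simp
    then have "bop_apply A (x /\<^sub>R norm x) = 0 *\<^sub>R (x /\<^sub>R norm x)"
      using zero by simp
    moreover have "x /\<^sub>R norm x \<in> V"
      using \<open>x \<in> V\<close> by (simp add: V_def cinner_simps)
    ultimately show False
      using not_in_V \<open>x \<noteq> 0\<close> by fastforce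
  qed
  moreover obtain l where "\<And>e. e \<in> E \<Longrightarrow> bop_apply A e = l e *\<^sub>R e"
    using E(2) by metis
  ultimately show thesis
    using that by (auto simp: eigenbasis_def)
qed

section \<open>Functional calculus in an eigenbasis\<close>

lemma eigenbasis_onb: "eigenbasis A E l \<Longrightarrow> is_onb E"
  by (simp add: eigenbasis_def)

lemma eigenbasis_apply: "eigenbasis A E l \<Longrightarrow> e \<in> E \<Longrightarrow> bop_apply A e = l e *\<^sub>R e"
  by (simp add: eigenbasis_def)

lemma eigenbasis_norm: "eigenbasis A E l \<Longrightarrow> e \<in> E \<Longrightarrow> norm e = 1"
  using eigenbasis_onb is_onb_orthonormal orthonormal_norm by blast

lemma eigenbasis_selfadjoint:
  assumes "eigenbasis A E l"
  shows "adj A = A"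
proof (rule bop_eqI_onb_entries)
  fix e f
  assume "e \<in> E" "f \<in> E"
  moreover have "orthonormal E"
    using assms eigenbasis_onb is_onb_orthonormal by blast
  ultimately have "l e * cinner e f = l f * cinner e f"
    by (auto simp: orthonormal_def)
  then show "cinner e (bop_apply (adj A) f) = cinner e (bop_apply A f)"
    using \<open>e \<in> E\<close> \<open>f \<in> E\<close> assms by (simp add: cinner_adj_right eigenbasis_apply cinner_simps)
qed (use assms eigenbasis_onb in auto)

lemma eigenbasis_cinner_left:
  assumes "eigenbasis A E l" "e \<in> E"
  shows "cinner e (bop_apply A x) = l e * cinner e x"
  using cinner_adj_left[of A e x] eigenbasis_selfadjoint[OF assms(1)] eigenbasis_apply[OF assms]
  by (simp add: cinner_simps)

lemma eigenvalue_le_norm: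
  assumes "eigenbasis A E l" "e \<in> E"
  shows "\<bar>l e\<bar> \<le> norm A"
  using norm_bop_apply[of A e] eigenbasis_apply[OF assms] eigenbasis_norm[OF assms] by simp

lemma norm_le_eigenvalues:
  assumes "eigenbasis A E l" "0 \<le> M" "\<And>e. e \<in> E \<Longrightarrow> \<bar>l e\<bar> \<le> M"
  shows "norm A \<le> M"
proof (rule norm_bop_le[OF assms(2)])
  fix x
  show "norm (bop_apply A x) \<le> M * norm x"
    by (rule norm_le_coordinates[OF eigenbasis_onb[OF assms(1)] assms(2)])
      (use assms in \<open>auto simp: eigenbasis_cinner_left norm_mult intro: mult_right_mono\<close>)
qed

lemma power_eigenvector:
  "bop_apply A e = r *\<^sub>R e \<Longrightarrow> bop_apply (A ^ n) e = r ^ n *\<^sub>R e"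
  by (induction n) (auto simp: mult.commute)

lemma exp_eigenvector:
  assumes "bop_apply A e = r *\<^sub>R e"
  shows "bop_apply (exp A) e = exp r *\<^sub>R e"
proof -
  have "(\<lambda>n. bop_apply (A ^ n /\<^sub>R fact n) e) sums bop_apply (exp A) e"
    by (intro bounded_linear.sums[OF bounded_linear_bop_apply] exp_converges)
  moreover have "bop_apply (A ^ n /\<^sub>R fact n) e = (r ^ n /\<^sub>R fact n) *\<^sub>R e" for n
    by (simp add: power_eigenvector[OF assms])
  ultimately have "(\<lambda>n. (r ^ n /\<^sub>R fact n) *\<^sub>R e) sums bop_apply (exp A) e"
    by simp
  moreover have "(\<lambda>n. (r ^ n /\<^sub>R fact n) *\<^sub>R e) sums (exp r *\<^sub>R e)"
    by (intro bounded_linear.sums[OF bounded_linear_scaleR_left] exp_converges)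
  ultimately show ?thesis
    by (rule sums_unique2)
qed

lemma eigenbasis_exp: "eigenbasis A E l \<Longrightarrow> eigenbasis (exp A) E (\<lambda>e. exp (l e))"
  by (simp add: eigenbasis_def exp_eigenvector)

lemma eigenbasis_scaleR: "eigenbasis A E l \<Longrightarrow> eigenbasis (r *\<^sub>R A) E (\<lambda>e. r * l e)"
  by (simp add: eigenbasis_def)

lemma eigenbasis_add: "eigenbasis A E l \<Longrightarrow> eigenbasis B E k \<Longrightarrow> eigenbasis (A + B) E (\<lambda>e. l e + k e)"
  by (simp add: eigenbasis_def scaleR_add_left)

lemma eigenbasis_diff: "eigenbasis A E l \<Longrightarrow> eigenbasis B E k \<Longrightarrow> eigenbasis (A - B) E (\<lambda>e. l e - k e)"
  by (simp add: eigenbasis_def scaleR_diff_left)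

lemma eigenbasis_of_real: "is_onb E \<Longrightarrow> eigenbasis (of_real r) E (\<lambda>_. r)"
  by (simp add: eigenbasis_def)

lemma weierstrass_sequence:
  assumes "continuous_on {a..b} f"
  obtains p :: "nat \<Rightarrow> real \<Rightarrow> real" where "\<And>n. real_polynomial_function (p n)"
    "\<And>n x. x \<in> {a..b} \<Longrightarrow> \<bar>f x - p n x\<bar> < 1 / Suc n"
proof -
  have "\<exists>p. real_polynomial_function p \<and> (\<forall>x\<in>{a..b}. \<bar>f x - p x\<bar> < 1 / Suc n)" for n
    by (rule Stone_Weierstrass_real_polynomial_function[OF compact_Icc assms, of "1 / Suc n"]) auto
  then have "\<exists>p. \<forall>n. real_polynomial_function (p n) \<and> (\<forall>x\<in>{a..b}. \<bar>f x - p n x\<bar> < 1 / Suc n)"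
    by (rule choice[OF allI])
  then show thesis
    using that by blast
qed

lemma ex_polynomial_bop:
  fixes A :: "'h::infdim_separable_hilbert bop"
  assumes "real_polynomial_function p"
  shows "\<exists>X. \<forall>e r. bop_apply A e = r *\<^sub>R e \<longrightarrow> bop_apply X e = p r *\<^sub>R e"
proof -
  obtain c n where p: "p = (\<lambda>x. \<Sum>i\<le>n. c i * x ^ i)"
    using assms real_polynomial_function_iff_sum by blast
  have "bop_apply (\<Sum>i\<le>k. c i *\<^sub>R A ^ i) e = (\<Sum>i\<le>k. c i * r ^ i) *\<^sub>R e"
    if "bop_apply A e = r *\<^sub>R e" for e r k
    by (induction k) (auto simp: power_eigenvector[OF that] scaleR_add_left simp del: power_Suc)
  then show ?thesis
    unfolding p by blast
qed

text \<open>Polynomials in \<open>A\<close> that converge uniformly on the eigenvalues are Cauchy in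
  operator norm, since a diagonal operator is bounded by its largest eigenvalue. The application is
  the logarithm.\<close>

lemma functional_calculus:
  assumes A: "eigenbasis A E l" and f: "continuous_on {a..b} f" and l: "\<And>e. e \<in> E \<Longrightarrow> l e \<in> {a..b}"
  obtains B where "eigenbasis B E (\<lambda>e. f (l e))"
proof -
  obtain p where p: "\<And>n. real_polynomial_function (p n)"
      "\<And>n x. x \<in> {a..b} \<Longrightarrow> \<bar>f x - p n x\<bar> < 1 / Suc n"
    by (rule weierstrass_sequence[OF f], rule that)
  have "\<forall>n. \<exists>X. \<forall>e r. bop_apply A e = r *\<^sub>R e \<longrightarrow> bop_apply X e = p n r *\<^sub>R e"
    using ex_polynomial_bop[OF p(1)] by blast
  from choice[OF this] obtain X where "\<forall>n e r. bop_apply A e = r *\<^sub>R e \<longrightarrow> bop_apply (X n) e = p n r *\<^sub>R e"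
    by blast
  then have X: "eigenbasis (X n) E (\<lambda>e. p n (l e))" for n
    using A by (simp add: eigenbasis_def)
  have dist: "norm (X j - X k) \<le> 1 / Suc j + 1 / Suc k" for j k
  proof (rule norm_le_eigenvalues[OF eigenbasis_diff[OF X X]])
    show "\<bar>p j (l e) - p k (l e)\<bar> \<le> 1 / Suc j + 1 / Suc k" if "e \<in> E" for e
      using p(2)[OF l[OF that], of j] p(2)[OF l[OF that], of k] by linarith
  qed simp
  have "Cauchy X"
  proof (rule CauchyI)
    fix d :: real
    assume "d > 0"
    then obtain N :: nat where N: "N > 0" "1 / N < d / 2"
      by (metis half_gt_zero inverse_eq_divide reals_Archimedean zero_less_Suc)
    have "norm (X j - X k) < d" if "j \<ge> N" "k \<ge> N" for j k
    proof -
      have "1 / Suc j + 1 / Suc k \<le> 1 / N + 1 / N"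
        using that N(1) by (intro add_mono divide_left_mono) auto
      then show ?thesis
        using dist[of j k] N(2) by linarith
    qed
    then show "\<exists>N. \<forall>j\<ge>N. \<forall>k\<ge>N. norm (X j - X k) < d"
      by blast
  qed
  then obtain B where B: "X \<longlonglongrightarrow> B"
    using Cauchy_convergent convergent_def by blast
  have "bop_apply B e = f (l e) *\<^sub>R e" if "e \<in> E" for e
  proof (rule LIMSEQ_unique)
    show "(\<lambda>n. bop_apply (X n) e) \<longlonglongrightarrow> bop_apply B e"
      by (intro tendsto_bop_apply B tendsto_const)
    have "(\<lambda>n. p n (l e)) \<longlonglongrightarrow> f (l e)"
    proof (rule metric_tendsto_imp_tendsto[OF LIMSEQ_inverse_real_of_nat])
      show "\<forall>\<^sub>F n in sequentially. dist (p n (l e)) (f (l e)) \<le> dist (inverse (real (Suc n))) 0"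
        using p(2)[OF l[OF that]] by (intro always_eventually)
          (auto simp: dist_real_def abs_minus_commute inverse_eq_divide intro: less_imp_le)
    qed
    then show "(\<lambda>n. bop_apply (X n) e) \<longlonglongrightarrow> f (l e) *\<^sub>R e"
      using eigenbasis_apply[OF X that] by (simp add: tendsto_scaleR)
  qed
  then have "eigenbasis B E (\<lambda>e. f (l e))"
    using A by (simp add: eigenbasis_def)
  then show thesis
    by (rule that)
qed

section \<open>Exponentials of self-adjoint Hilbert--Schmidt operators\<close>

lemma abs_exp_diff_le:
  fixes a b R :: real
  assumes "a \<le> R" "b \<le> R"
  shows "\<bar>exp a - exp b\<bar> \<le> exp R * \<bar>a - b\<bar>"
proof -
  have *: "exp a - exp b \<le> exp R * (a - b)" if "b \<le> a" "a \<le> R" for a b :: real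
  proof -
    have "exp a - exp b = exp a * (1 - exp (b - a))"
      by (simp add: exp_diff right_diff_distrib)
    also have "\<dots> \<le> exp a * (a - b)"
    proof (rule mult_left_mono)
      show "1 - exp (b - a) \<le> a - b"
        using exp_ge_add_one_self[of "b - a"] by linarith
    qed simp
    also have "\<dots> \<le> exp R * (a - b)"
      using that by (intro mult_right_mono) auto
    finally show ?thesis .
  qed
  show ?thesis
    using *[of b a] *[of a b] assms by (cases "b \<le> a") auto
qed

lemma abs_le_2_sinh: "\<bar>t\<bar> \<le> \<bar>exp (t / 2) - exp (- t / 2)\<bar>" for t :: real
proof -
  have *: "2 * s \<le> exp s - exp (- s)" if "0 \<le> s" for s :: real
  proof -
    \<comment> \<open>For this Taylor polynomial, u^2 - 2su - 1 = s^4/4 is nonnegative, that is, u -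
      1/u is at least 2s. Replacing \<open>u\<close> by the larger \<open>exp s\<close> only
      increases u - 1/u.\<close>
    define u where "u = 1 + s + s\<^sup>2 / 2"
    have u: "1 \<le> u" "u \<le> exp s"
      using that exp_lower_Taylor_quadratic[OF that] by (auto simp: u_def)
    have "u\<^sup>2 - 2 * s * u - 1 = (s\<^sup>2)\<^sup>2 / 4"
      by (simp add: u_def power2_eq_square field_simps)
    then have "1 \<le> u * (u - 2 * s)"
      using zero_le_power2[of "s\<^sup>2"] by (simp add: power2_eq_square algebra_simps del: zero_le_power2)
    then have "1 / u \<le> u - 2 * s"
      using u(1) by (simp add: divide_le_eq mult.commute)
    moreover have "exp (- s) \<le> 1 / u"
      using u by (simp add: exp_minus inverse_eq_divide frac_le)
    ultimately show ?thesis
      using u(2) by linarith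
  qed
  show ?thesis
    using *[of "t / 2"] *[of "- t / 2"] by (cases "0 \<le> t") auto
qed

lemma abs_le_2_exp_minus_1:
  fixes t :: real
  assumes "\<bar>exp t - 1\<bar> \<le> 1 / 2"
  shows "\<bar>t\<bar> \<le> 2 * \<bar>exp t - 1\<bar>"
proof (cases "0 \<le> t")
  case True
  moreover have "t \<le> exp t - 1"
    using exp_ge_add_one_self[of t] by linarith
  ultimately show ?thesis
    by (simp add: abs_of_nonneg)
next
  case False
  have half: "1 / 2 \<le> exp t"
    using assms by linarith
  have "exp t * (1 - t) \<le> exp t * exp (- t)"
    using exp_ge_add_one_self[of "- t"] by (intro mult_left_mono) auto
  then have "exp t * (- t) \<le> 1 - exp t"
    by (simp add: exp_minus_inverse algebra_simps)
  moreover have "(1 / 2) * (- t) \<le> exp t * (- t)"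
    using half False by (intro mult_right_mono) auto
  ultimately have "(1 / 2) * (- t) \<le> 1 - exp t"
    by (rule order_trans[rotated])
  with False show ?thesis
    by simp
qed

lemma exp_minus_mult: "exp (- x) * exp x = (1 :: 'a::{real_normed_algebra_1, banach})"
  using exp_minus_inverse[of "- x"] by simp

text \<open>The equations with \<open>y\<close> match inside right-associated products; together
  with \<open>mult.assoc\<close> they let simplification cancel exponentials anywhere in a
  product.\<close>

lemma exp_cancel [simp]:
  fixes x y :: "'a::{real_normed_algebra_1, banach}"
  shows "exp x * exp (- x) = 1" "exp (- x) * exp x = 1"
    "exp x * (exp (- x) * y) = y" "exp (- x) * (exp x * y) = y"
  by (simp_all add: exp_minus_inverse exp_minus_mult flip: mult.assoc)

text \<open>Both spellings of the half occur because simplification rewrites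
  \<open>x /\<^sub>R 2\<close>.\<close>

lemma exp_half:
  fixes x y :: "'a::{real_normed_algebra_1, banach}"
  shows "exp (x /\<^sub>R 2) * exp (x /\<^sub>R 2) = exp x" "exp (x /\<^sub>R 2) * (exp (x /\<^sub>R 2) * y) = exp x * y"
    "exp ((1 / 2) *\<^sub>R x) * exp ((1 / 2) *\<^sub>R x) = exp x"
    "exp ((1 / 2) *\<^sub>R x) * (exp ((1 / 2) *\<^sub>R x) * y) = exp x * y"
proof -
  have "x /\<^sub>R 2 + x /\<^sub>R 2 = x"
    by (simp flip: scaleR_add_left)
  then have *: "exp (x /\<^sub>R 2) * exp (x /\<^sub>R 2) = exp x"
    by (metis exp_add_commuting)
  then show "exp (x /\<^sub>R 2) * exp (x /\<^sub>R 2) = exp x" "exp ((1 / 2) *\<^sub>R x) * exp ((1 / 2) *\<^sub>R x) = exp x"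
    by simp_all
  then show "exp (x /\<^sub>R 2) * (exp (x /\<^sub>R 2) * y) = exp x * y"
    "exp ((1 / 2) *\<^sub>R x) * (exp ((1 / 2) *\<^sub>R x) * y) = exp x * y"
    by (metis mult.assoc)+
qed

lemma sa_hs_0 [simp]: "0 \<in> sa_hs"
  by (simp add: sa_hs_def)

lemma sa_hs_scaleR: "A \<in> sa_hs \<Longrightarrow> r *\<^sub>R A \<in> sa_hs"
  and sa_hs_minus: "A \<in> sa_hs \<Longrightarrow> - A \<in> sa_hs"
  and sa_hs_add: "A \<in> sa_hs \<Longrightarrow> B \<in> sa_hs \<Longrightarrow> A + B \<in> sa_hs"
  and sa_hs_diff: "A \<in> sa_hs \<Longrightarrow> B \<in> sa_hs \<Longrightarrow> A - B \<in> sa_hs"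
  by (auto simp: sa_hs_def intro: hilbert_schmidt_intros)

lemmas sa_hs_intros = sa_hs_scaleR sa_hs_minus sa_hs_add sa_hs_diff sa_hs_0

lemma adj_exp_sa_hs: "A \<in> sa_hs \<Longrightarrow> adj (exp A) = exp A"
  by (simp add: sa_hsD)

lemma eigenvalue_le_exponent:
  assumes "eigenbasis A E l" "e \<in> E" "norm A \<le> R"
  shows "l e \<le> R"
  using eigenvalue_le_norm[OF assms(1,2)] assms(3) by linarith

text \<open>Between an eigenvector of \<open>g\<close> and one of \<open>h\<close>, the entries of
  both differences are multiples of \<open>cinner e f\<close>, with factors exp(l) - exp(k) and l -
  k. The scalar Lipschitz bound thus carries over without commutativity.\<close>

lemma hs_exp_diff:
  assumes "g \<in> sa_hs" "h \<in> sa_hs" "norm g \<le> R" "norm h \<le> R"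
  shows "hilbert_schmidt (exp g - exp h)" "hs_norm (exp g - exp h) \<le> exp R * hs_norm (g - h)"
proof -
  obtain E l F k where gE: "eigenbasis g E l" and hF: "eigenbasis h F k"
    using spectral_theorem assms by metis
  have gh: "hilbert_schmidt (g - h)"
    using assms by (intro hilbert_schmidt_diff sa_hsD)
  have "cmod (cinner e (bop_apply (exp g - exp h) f)) \<le> exp R * cmod (cinner e (bop_apply (g - h) f))"
    if "e \<in> E" "f \<in> F" for e f
  proof -
    have "cinner e (bop_apply (exp g - exp h) f) = of_real (exp (l e) - exp (k f)) * cinner e f"
      using that gE hF eigenbasis_exp[OF gE] eigenbasis_exp[OF hF]
      by (simp add: cinner_simps eigenbasis_cinner_left eigenbasis_apply left_diff_distrib)
    moreover have "cinner e (bop_apply (g - h) f) = of_real (l e - k f) * cinner e f"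
      using that gE hF by (simp add: cinner_simps eigenbasis_cinner_left eigenbasis_apply left_diff_distrib)
    moreover have "\<bar>exp (l e) - exp (k f)\<bar> \<le> exp R * \<bar>l e - k f\<bar>"
      by (intro abs_exp_diff_le eigenvalue_le_exponent[OF gE] eigenvalue_le_exponent[OF hF] that assms)
    ultimately show ?thesis
      by (simp add: norm_mult mult_right_mono flip: mult.assoc of_real_diff)
  qed
  from hs_norm_le_entries[OF eigenbasis_onb[OF gE] eigenbasis_onb[OF hF] gh _ this]
  show "hilbert_schmidt (exp g - exp h)" "hs_norm (exp g - exp h) \<le> exp R * hs_norm (g - h)"
    by simp_all
qed

lemma hilbert_schmidt_exp_minus_1:
  assumes "g \<in> sa_hs"
  shows "hilbert_schmidt (exp g - 1)"
  using hs_exp_diff(1)[OF assms sa_hs_0, of "norm g"] by simp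

lemma norm_unitary_le:
  fixes U :: "'h::infdim_separable_hilbert bop"
  assumes "adj U * U = 1"
  shows "norm U \<le> 1"
proof -
  have "(norm U)\<^sup>2 = 1"
    using norm_adj_mult_self[of U] assms by simp
  then show ?thesis
    by (simp add: power2_eq_1_iff) linarith
qed

text \<open>
  Since \<open>\<bar>t\<bar> \<le> \<bar>2 sinh (t/2)\<bar>\<close>, the matrix of \<open>g - h\<close> with respect to eigenbases of \<open>g\<close> and of \<open>h\<close> is
  dominated entrywise by that of \<open>e\<^bsup>g/2\<^esup> e\<^bsup>-h/2\<^esup> - e\<^bsup>-g/2\<^esup> e\<^bsup>h/2\<^esup>\<close>, which by polar decomposition is a
  unitary multiple of \<open>2 sinh (w/2)\<close>.
\<close>

lemma hs_norm_diff_le_local: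
  assumes g: "g \<in> sa_hs" and h: "h \<in> sa_hs" and w: "w \<in> sa_hs"
    and eq: "exp g = exp (h /\<^sub>R 2) * exp w * exp (h /\<^sub>R 2)"
  shows "hs_norm (g - h) \<le> exp (norm w) * hs_norm w"
proof -
  let ?g = "g /\<^sub>R 2" and ?h = "h /\<^sub>R 2" and ?w = "w /\<^sub>R 2"
  define M where "M = exp ?g * exp (- ?h) - exp (- ?g) * exp ?h"
  \<comment> \<open>The unitary factor of e^(g/2) e^(-h/2), whose absolute value is e^(w/2) by the
    hypothesis \<open>eq\<close>.\<close>
  define U where "U = exp ?g * exp (- ?h) * exp (- ?w)"
  have w_half: "exp (- ?w) * exp (- ?w) = exp (- w)"
    using exp_half(1)[of "- w"] by simp
  have adj_halves: "adj (exp ?g) = exp ?g" "adj (exp (- ?h)) = exp (- ?h)" "adj (exp (- ?w)) = exp (- ?w)"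
    by (intro adj_exp_sa_hs sa_hs_intros g h w)+
  have w_eq: "exp (- ?h) * (exp ?g * (exp ?g * exp (- ?h))) = exp w"
    by (simp add: exp_half eq mult.assoc)
  have "adj U * U = exp (- ?w) * (exp (- ?h) * (exp ?g * (exp ?g * exp (- ?h)))) * exp (- ?w)"
    unfolding U_def adj_simps adj_halves by (simp only: mult.assoc)
  also have "\<dots> = exp (- ?w) * (exp w * exp (- ?w))"
    unfolding w_eq by (simp only: mult.assoc)
  also have "\<dots> = 1"
    by (simp flip: exp_half(1)[of w] add: mult.assoc)
  finally have U: "norm U \<le> 1"
    by (rule norm_unitary_le)
  have "U * exp ?w = exp ?g * exp (- ?h)"
    by (simp add: U_def mult.assoc)
  \<comment> \<open>The inverse of the adjoint has the same unitary factor and the inverse absolute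
    value.\<close>
  moreover have "U * exp (- ?w) = exp (- ?g) * exp ?h"
  proof -
    have "U * exp (- ?w) = exp ?g * exp (- ?h) * exp (- w)"
      by (simp only: U_def mult.assoc w_half)
    also have "\<dots> = exp (- ?g) * (exp ?g * exp ?g) * exp (- ?h) * exp (- w)"
      by (simp add: mult.assoc)
    also have "\<dots> = exp (- ?g) * exp ?h"
      unfolding exp_half eq by (simp add: mult.assoc)
    finally show ?thesis .
  qed
  ultimately have M: "M = U * (exp ?w - exp (- ?w))"
    by (simp add: M_def right_diff_distrib)
  have diff: "?w - - ?w = w"
    by (simp flip: scaleR_add_left)
  have hw: "?w \<in> sa_hs" "- ?w \<in> sa_hs" "norm ?w \<le> norm w" "norm (- ?w) \<le> norm w"
    using w by (auto intro: sa_hs_intros)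
  note hs_w = hs_exp_diff[OF hw, unfolded diff]
  have hsM: "hilbert_schmidt M"
    unfolding M by (rule hilbert_schmidt_mult_left[OF hs_w(1)])
  obtain E l F k where gE: "eigenbasis g E l" and hF: "eigenbasis h F k"
    using spectral_theorem g h by metis
  have eb: "eigenbasis (exp ?g) E (\<lambda>e. exp (l e / 2))" "eigenbasis (exp (- ?g)) E (\<lambda>e. exp (- l e / 2))"
     "eigenbasis (exp ?h) F (\<lambda>e. exp (k e / 2))" "eigenbasis (exp (- ?h)) F (\<lambda>e. exp (- k e / 2))"
    using eigenbasis_exp[OF eigenbasis_scaleR[OF gE, of "1/2"]] eigenbasis_exp[OF eigenbasis_scaleR[OF gE, of "-1/2"]]
      eigenbasis_exp[OF eigenbasis_scaleR[OF hF, of "1/2"]] eigenbasis_exp[OF eigenbasis_scaleR[OF hF, of "-1/2"]]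
    by (simp_all add: inverse_eq_divide)
  have "hs_norm (g - h) \<le> 1 * hs_norm M"
  proof (rule hs_norm_le_entries(2)[OF eigenbasis_onb[OF gE] eigenbasis_onb[OF hF] hsM])
    fix e f
    assume ef: "e \<in> E" "f \<in> F"
    have "cinner e (bop_apply M f) = of_real (exp (l e / 2) * exp (- k f / 2) - exp (- l e / 2) * exp (k f / 2)) * cinner e f"
      using ef eb by (simp add: M_def cinner_simps eigenbasis_cinner_left eigenbasis_apply algebra_simps)
    also have "exp (l e / 2) * exp (- k f / 2) - exp (- l e / 2) * exp (k f / 2) = exp ((l e - k f) / 2) - exp (- (l e - k f) / 2)"
      by (simp add: diff_divide_distrib flip: exp_add)
    finally have "cmod (cinner e (bop_apply M f)) = \<bar>exp ((l e - k f) / 2) - exp (- (l e - k f) / 2)\<bar> * cmod (cinner e f)"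
      by (simp only: norm_mult norm_of_real)
    moreover have "cinner e (bop_apply (g - h) f) = of_real (l e - k f) * cinner e f"
      using ef gE hF by (simp add: cinner_simps eigenbasis_cinner_left eigenbasis_apply left_diff_distrib)
    then have "cmod (cinner e (bop_apply (g - h) f)) = \<bar>l e - k f\<bar> * cmod (cinner e f)"
      by (simp only: norm_mult norm_of_real)
    ultimately show "cmod (cinner e (bop_apply (g - h) f)) \<le> 1 * cmod (cinner e (bop_apply M f))"
      using abs_le_2_sinh[of "l e - k f"] by (simp only: mult_1 mult_right_mono norm_ge_zero)
  qed simp
  also have "hs_norm M \<le> norm U * hs_norm (exp ?w - exp (- ?w))"
    unfolding M by (rule hs_norm_mult_left[OF hs_w(1)])
  \<comment> \<open>The exponential factor is only the crude Lipschitz constant of exp on the ball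
    of radius \<open>norm w\<close>; subdividing a geodesic removes it later.\<close>
  also have "\<dots> \<le> 1 * (exp (norm w) * hs_norm w)"
    by (rule mult_mono[OF U hs_w(2)]) auto
  finally show ?thesis
    by simp
qed

text \<open>The local estimate with \<open>w = 0\<close>.\<close>

lemma exp_inj_sa_hs:
  assumes "g \<in> sa_hs" "h \<in> sa_hs" "exp g = exp h"
  shows "g = h"
proof -
  have "hs_norm (g - h) \<le> exp (norm (0 :: 'a bop)) * hs_norm (0 :: 'a bop)"
    by (rule hs_norm_diff_le_local) (use assms in \<open>auto simp: exp_half\<close>)
  then have "hs_norm (g - h) = 0"
    using hs_norm_nonneg[of "g - h"] by simp
  then have "g - h = 0"
    using assms by (intro hs_norm_eq_0 hilbert_schmidt_diff sa_hsD)
  then show ?thesis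
    by simp
qed

text \<open>The left inverse \<open>T\<close> keeps the eigenvalues of \<open>p\<close> away from 0,
  so ln is continuous on an interval containing them. The logarithm is Hilbert-Schmidt because there
  ln t is bounded by a multiple of t - 1.\<close>

lemma ex_log_sa_hs:
  assumes p: "p = adj S * S" and inv: "T * S = 1" and hs: "hilbert_schmidt (p - 1)"
  shows "\<exists>w\<in>sa_hs. exp w = p"
proof -
  have adj_p: "adj p = p"
    by (simp add: p)
  have "p - 1 \<in> sa_hs"
    using hs adj_p by (simp add: sa_hs_def)
  then obtain E k where "eigenbasis (p - 1) E k"
    using spectral_theorem by blast
  from eigenbasis_add[OF this eigenbasis_of_real[OF eigenbasis_onb[OF this], of 1]]
  have E: "eigenbasis p E (\<lambda>e. k e + 1)"
    by simp
  define l where "l e = k e + 1" for e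
  have E: "eigenbasis p E l"
    using E by (simp add: l_def[abs_def])
  have "T \<noteq> 0"
    using inv by auto
  \<comment> \<open>For a unit eigenvector e the eigenvalue is the squared norm of S e, and 1 = |T S
    e| is at most |T| |S e|.\<close>
  define c where "c = 1 / (norm T)\<^sup>2"
  have c: "c > 0"
    using \<open>T \<noteq> 0\<close> by (simp add: c_def)
  have lower: "c \<le> l e" if "e \<in> E" for e
  proof -
    have "e = bop_apply T (bop_apply S e)"
      using inv by (metis bop_apply_simps(3,7))
    then have "1 \<le> norm T * norm (bop_apply S e)"
      using norm_bop_apply[of T "bop_apply S e"] eigenbasis_norm[OF E that] by simp
    then have "1\<^sup>2 \<le> (norm T * norm (bop_apply S e))\<^sup>2"
      by (rule power_mono) simp
    then have "c \<le> (norm (bop_apply S e))\<^sup>2"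
      using \<open>T \<noteq> 0\<close> by (simp add: c_def field_simps power_mult_distrib)
    also have "\<dots> = Re (cinner e (bop_apply p e))"
      by (simp add: p norm_sq_cinner cinner_adj_right)
    also have "\<dots> = l e"
      using eigenbasis_norm[OF E that] by (simp add: eigenbasis_apply[OF E that] cinner_simps cinner_self)
    finally show ?thesis .
  qed
  have "continuous_on {c..norm p} ln"
    using c by (intro continuous_on_ln continuous_on_id) auto
  moreover have "l e \<in> {c..norm p}" if "e \<in> E" for e
    using lower[OF that] eigenvalue_le_norm[OF E that] by auto
  ultimately obtain w where w: "eigenbasis w E (\<lambda>e. ln (l e))"
    using functional_calculus[OF E] by blast
  have "hilbert_schmidt w"
  proof (rule hs_norm_le_columns(1)[OF eigenbasis_onb[OF E] hs])
    fix e
    assume e: "e \<in> E"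
    define t where "t = l e"
    have t: "0 < t" "c \<le> t"
      using lower[OF e] c by (auto simp: t_def)
    have "ln t \<le> t - 1" "- ln t \<le> 1 / t - 1"
      using ln_le_minus_one[of t] ln_le_minus_one[of "1 / t"] t by (auto simp: ln_div)
    \<comment> \<open>The factor 1 suffices for t at least 1 and 1/c below; their sum covers both
      cases.\<close>
    have "\<bar>ln t\<bar> \<le> (1 + 1 / c) * \<bar>t - 1\<bar>"
    proof (cases "1 \<le> t")
      case True
      then have "\<bar>ln t\<bar> \<le> 1 * \<bar>t - 1\<bar>"
        using \<open>ln t \<le> t - 1\<close> by simp
      also have "\<dots> \<le> (1 + 1 / c) * \<bar>t - 1\<bar>"
        using c by (intro mult_right_mono) auto
      finally show ?thesis .
    next
      case False
      then have "\<bar>ln t\<bar> \<le> 1 / t - 1"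
        using \<open>- ln t \<le> 1 / t - 1\<close> t by simp
      also have "\<dots> = (1 / t) * \<bar>t - 1\<bar>"
        using False t by (simp add: field_simps)
      also have "\<dots> \<le> (1 / c) * \<bar>t - 1\<bar>"
        using c t by (intro mult_right_mono divide_left_mono) auto
      also have "\<dots> \<le> (1 + 1 / c) * \<bar>t - 1\<bar>"
        by (intro mult_right_mono) auto
      finally show ?thesis .
    qed
    moreover have "bop_apply (p - 1) e = (t - 1) *\<^sub>R e"
      using eigenbasis_apply[OF E e] by (simp add: t_def scaleR_diff_left)
    ultimately show "norm (bop_apply w e) \<le> (1 + 1 / c) * norm (bop_apply (p - 1) e)"
      using eigenbasis_apply[OF w e] eigenbasis_norm[OF E e] by (simp add: t_def)
  qed (use c in auto)
  then have "w \<in> sa_hs"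
    using eigenbasis_selfadjoint[OF w] by (simp add: sa_hs_def)
  moreover have "exp w = p"
  proof (rule bop_eqI_onb[OF eigenbasis_onb[OF E]])
    fix e assume "e \<in> E"
    then show "bop_apply (exp w) e = bop_apply p e"
      using eigenbasis_exp[OF w] E lower[of e] c by (simp add: eigenbasis_apply)
  qed
  ultimately show ?thesis
    by blast
qed

text \<open>The Hilbert-Schmidt norm dominates every eigenvalue of \<open>exp w - 1\<close>, so the
  smallness assumption puts each of them in the range of
  \<open>abs_le_2_exp_minus_1\<close>.\<close>

lemma hs_norm_log_le:
  assumes w: "w \<in> sa_hs" and small: "hs_norm (exp w - 1) \<le> 1 / 2"
  shows "hs_norm w \<le> 2 * hs_norm (exp w - 1)"
proof -
  obtain E l where E: "eigenbasis w E l"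
    using spectral_theorem[OF w] by blast
  note hs = hilbert_schmidt_exp_minus_1[OF w]
  have E1: "eigenbasis (exp w - 1) E (\<lambda>e. exp (l e) - 1)"
    using eigenbasis_diff[OF eigenbasis_exp[OF E] eigenbasis_of_real[OF eigenbasis_onb[OF E], of 1]] by simp
  show ?thesis
  proof (rule hs_norm_le_columns(2)[OF eigenbasis_onb[OF E] hs])
    fix e assume e: "e \<in> E"
    have "\<bar>exp (l e) - 1\<bar> \<le> 1 / 2"
      using eigenvalue_le_norm[OF E1 e] norm_le_hs_norm[OF hs] small by linarith
    then show "norm (bop_apply w e) \<le> 2 * norm (bop_apply (exp w - 1) e)"
      using abs_le_2_exp_minus_1 eigenbasis_apply[OF E e] eigenbasis_apply[OF E1 e] eigenbasis_norm[OF E e]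
      by simp
  qed simp
qed

section \<open>The Hilbert space \<open>HR\<close> and its distance function\<close>

text \<open>Here infinite dimension enters: each vector of an infinite orthonormal basis contributes
  r^2. This makes \<open>scalar_part\<close> well defined on \<open>HR\<close>.\<close>

lemma not_hilbert_schmidt_of_real:
  assumes "r \<noteq> 0"
  shows "\<not> hilbert_schmidt (of_real r :: 'h::infdim_separable_hilbert bop)"
proof
  assume hs: "hilbert_schmidt (of_real r :: 'h bop)"
  obtain E :: "'h set" where E: "is_onb E"
    using ex_onb by blast
  let ?S = "(hs_norm (of_real r :: 'h bop))\<^sup>2"
  have sum: "((\<lambda>e. (norm (bop_apply (of_real r :: 'h bop) e))\<^sup>2) has_sum ?S) E"
    by (rule hs_norm_has_sum[OF hs E])
  obtain n :: nat where n: "?S / r\<^sup>2 < n"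
    using reals_Archimedean2 by blast
  obtain F where F: "F \<subseteq> E" "finite F" "card F = n"
    using infinite_arbitrarily_large[OF infinite_onb[OF E]] by metis
  have "norm e = 1" if "e \<in> F" for e
    using that F(1) orthonormal_norm[OF is_onb_orthonormal[OF E]] by blast
  then have "(\<Sum>e\<in>F. (norm (bop_apply (of_real r :: 'h bop) e))\<^sup>2) = n * r\<^sup>2"
    using F(3) by (simp add: power_mult_distrib)
  then have "n * r\<^sup>2 \<le> ?S"
    using finite_sum_le_has_sum[OF sum F(2,1)] by simp
  then show False
    using n assms by (simp add: divide_less_eq)
qed

lemma scalar_part_eq:
  assumes "hilbert_schmidt a"
  shows "scalar_part (a + of_real r) = r"
  unfolding scalar_part_def
proof (rule the_equality)
  show "hilbert_schmidt (a + of_real r - of_real r)"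
    using assms by simp
  fix s
  assume "hilbert_schmidt (a + of_real r - of_real s)"
  then have "hilbert_schmidt (a + of_real r - of_real s - a)"
    using assms by (rule hilbert_schmidt_diff)
  then have "hilbert_schmidt (of_real (r - s) :: 'a bop)"
    by simp
  then show "s = r"
    using not_hilbert_schmidt_of_real[of "r - s"] by (cases "r - s = 0") auto
qed

lemma hs_part_eq: "hilbert_schmidt a \<Longrightarrow> hs_part (a + of_real r) = a"
  by (simp add: hs_part_def scalar_part_eq)

lemma HR_I: "a \<in> sa_hs \<Longrightarrow> a + of_real r \<in> HR"
  by (auto simp: HR_def sa_hs_def)

lemma HR_E:
  assumes "z \<in> HR"
  obtains a r where "a \<in> sa_hs" "z = a + of_real r"
  using assms by (auto simp: HR_def sa_hs_def)

lemma HR_decompose: "z \<in> HR \<Longrightarrow> z = hs_part z + of_real (scalar_part z)"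
  by (simp add: hs_part_def)

lemma hs_part_sa_hs: "z \<in> HR \<Longrightarrow> hs_part z \<in> sa_hs"
  by (elim HR_E) (simp add: hs_part_eq sa_hsD)

lemma parts_of_HR:
  assumes "a \<in> sa_hs"
  shows "hs_part (a + of_real r) = a" "scalar_part (a + of_real r) = r"
  using assms by (simp_all add: hs_part_eq scalar_part_eq sa_hsD)

section \<open>Linear structure and inner product of \<open>HR\<close>\<close>

lemma adj_HR: "z \<in> HR \<Longrightarrow> adj z = z"
  by (elim HR_E) (simp add: sa_hsD)

lemma sa_hs_subset_HR: "a \<in> sa_hs \<Longrightarrow> a \<in> HR"
  using HR_I[of a 0] by simp

lemma HR_add: "x \<in> HR \<Longrightarrow> y \<in> HR \<Longrightarrow> x + y \<in> HR"
  and parts_add: "x \<in> HR \<Longrightarrow> y \<in> HR \<Longrightarrow> hs_part (x + y) = hs_part x + hs_part y \<and> scalar_part (x + y) = scalar_part x + scalar_part y"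
proof -
  assume "x \<in> HR" "y \<in> HR"
  then obtain a r b s where ab: "a \<in> sa_hs" "b \<in> sa_hs" and xy: "x = a + of_real r" "y = b + of_real s"
    by (metis HR_E)
  have eq: "x + y = (a + b) + of_real (r + s)"
    by (simp add: xy)
  show "x + y \<in> HR"
    unfolding eq by (intro HR_I sa_hs_add ab)
  show "hs_part (x + y) = hs_part x + hs_part y \<and> scalar_part (x + y) = scalar_part x + scalar_part y"
    unfolding eq parts_of_HR[OF sa_hs_add[OF ab]] by (simp add: xy parts_of_HR ab)
qed

lemma HR_scaleR: "x \<in> HR \<Longrightarrow> t *\<^sub>R x \<in> HR"
  and parts_scaleR: "x \<in> HR \<Longrightarrow> hs_part (t *\<^sub>R x) = t *\<^sub>R hs_part x \<and> scalar_part (t *\<^sub>R x) = t * scalar_part x"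
proof -
  assume "x \<in> HR"
  then obtain a r where a: "a \<in> sa_hs" and x: "x = a + of_real r"
    by (metis HR_E)
  have eq: "t *\<^sub>R x = t *\<^sub>R a + of_real (t * r)"
    by (simp add: x scaleR_add_right) (simp add: of_real_def)
  show "t *\<^sub>R x \<in> HR"
    unfolding eq by (intro HR_I sa_hs_scaleR a)
  show "hs_part (t *\<^sub>R x) = t *\<^sub>R hs_part x \<and> scalar_part (t *\<^sub>R x) = t * scalar_part x"
    unfolding eq parts_of_HR[OF sa_hs_scaleR[OF a]] by (simp add: x parts_of_HR a)
qed

lemma HR_minus: "x \<in> HR \<Longrightarrow> - x \<in> HR"
  using HR_scaleR[of x "-1"] by simp

lemma HR_diff: "x \<in> HR \<Longrightarrow> y \<in> HR \<Longrightarrow> x - y \<in> HR"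
  using HR_add[of x "- y"] HR_minus[of y] by simp

lemma HR_0 [simp]: "0 \<in> HR"
  by (simp add: sa_hs_subset_HR)

lemmas HR_intros = HR_add HR_diff HR_minus HR_scaleR HR_0

lemma parts_minus: "x \<in> HR \<Longrightarrow> hs_part (- x) = - hs_part x \<and> scalar_part (- x) = - scalar_part x"
  using parts_scaleR[of x "-1"] by simp

lemma parts_diff:
  "x \<in> HR \<Longrightarrow> y \<in> HR \<Longrightarrow> hs_part (x - y) = hs_part x - hs_part y \<and> scalar_part (x - y) = scalar_part x - scalar_part y"
  using parts_add[of x "- y"] HR_minus[of y] parts_minus[of y] by simp

lemma trace_op_mult:
  assumes a: "a \<in> sa_hs" and b: "b \<in> sa_hs"
  shows "Re (trace_op (a * b)) = hs_inner a b"
proof -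
  define E where "E = (SOME E :: 'a set. is_onb E)"
  have E: "is_onb E"
    unfolding E_def using ex_onb by (rule someI_ex)
  note hs = sa_hsD(1)[OF a] sa_hsD(1)[OF b]
  have inner: "cinner e (bop_apply (a * b) e) = cinner (bop_apply a e) (bop_apply b e)" for e
    using cinner_adj_left[of a e "bop_apply b e"] sa_hsD(2)[OF a] by simp
  \<comment> \<open>Only for a summable family does the real part commute with the infinite sum;
    otherwise that sum is a default value.\<close>
  have "(\<lambda>e. cinner (bop_apply a e) (bop_apply b e)) summable_on E"
  proof (rule abs_summable_summable, rule summable_on_comparison_test)
    show "(\<lambda>e. (norm (bop_apply a e))\<^sup>2 + (norm (bop_apply b e))\<^sup>2) summable_on E"
      by (intro summable_on_add has_sum_imp_summable[OF hs_norm_has_sum[OF _ E]] hs)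
    fix e
    have "cmod (cinner (bop_apply a e) (bop_apply b e)) \<le> norm (bop_apply a e) * norm (bop_apply b e)"
      by (rule cinner_Cauchy_Schwarz)
    also have "\<dots> \<le> (norm (bop_apply a e))\<^sup>2 + (norm (bop_apply b e))\<^sup>2"
      using sum_squares_bound[of "norm (bop_apply a e)" "norm (bop_apply b e)"]
        mult_nonneg_nonneg[OF norm_ge_zero[of "bop_apply a e"] norm_ge_zero[of "bop_apply b e"]] by linarith
    finally show "cmod (cinner (bop_apply a e) (bop_apply b e)) \<le> (norm (bop_apply a e))\<^sup>2 + (norm (bop_apply b e))\<^sup>2" .
  qed simp
  then have "Re (trace_op (a * b)) = (\<Sum>\<^sub>\<infinity>e\<in>E. Re (cinner (bop_apply a e) (bop_apply b e)))"
    unfolding trace_op_def Let_def E_def[symmetric] inner by (rule infsum_Re[symmetric])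
  then show ?thesis
    using infsumI[OF hs_inner_has_sum[OF hs E]] by simp
qed

lemma inner2_eq:
  assumes "x \<in> HR" "y \<in> HR"
  shows "inner2 x y = 4 * hs_inner (hs_part x) (hs_part y) + scalar_part x * scalar_part y"
  using trace_op_mult[OF hs_part_sa_hs[OF assms(1)] hs_part_sa_hs[OF assms(2)]]
    sa_hsD(2)[OF hs_part_sa_hs[OF assms(2)]]
  by (simp add: inner2_def)

lemma inner2_commute: "x \<in> HR \<Longrightarrow> y \<in> HR \<Longrightarrow> inner2 x y = inner2 y x"
  by (simp add: inner2_eq hs_inner_commute)

lemma inner2_add_left:
  assumes "x \<in> HR" "y \<in> HR" "z \<in> HR"
  shows "inner2 (x + y) z = inner2 x z + inner2 y z"
  using assms
  by (simp add: inner2_eq parts_add HR_intros hs_inner_add_left sa_hsD hs_part_sa_hs algebra_simps)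

lemma inner2_scaleR_left:
  assumes "x \<in> HR" "z \<in> HR"
  shows "inner2 (t *\<^sub>R x) z = t * inner2 x z"
  using assms
  by (simp add: inner2_eq parts_scaleR HR_intros hs_inner_scaleR_left sa_hsD hs_part_sa_hs algebra_simps)

lemma inner2_add_right:
  assumes "x \<in> HR" "y \<in> HR" "z \<in> HR"
  shows "inner2 z (x + y) = inner2 z x + inner2 z y"
  using inner2_add_left[OF assms] inner2_commute[OF assms(3)] assms by (metis HR_add)

lemma inner2_scaleR_right:
  assumes "x \<in> HR" "z \<in> HR"
  shows "inner2 z (t *\<^sub>R x) = t * inner2 z x"
  using inner2_scaleR_left[OF assms] inner2_commute[OF assms(2)] assms by (metis HR_scaleR)

lemma inner2_self: "x \<in> HR \<Longrightarrow> inner2 x x = 4 * (hs_norm (hs_part x))\<^sup>2 + (scalar_part x)\<^sup>2"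
  by (simp add: inner2_eq hs_inner_self sa_hsD hs_part_sa_hs power2_eq_square)

lemma norm2_sq: "x \<in> HR \<Longrightarrow> (norm2 x)\<^sup>2 = inner2 x x"
  by (simp add: norm2_def inner2_self)

lemma norm2_nonneg: "x \<in> HR \<Longrightarrow> 0 \<le> norm2 x"
  by (simp add: norm2_def inner2_self)

lemma norm2_0 [simp]: "norm2 (0 :: 'h::infdim_separable_hilbert bop) = 0"
  using inner2_self[of "0 :: 'h bop"] parts_of_HR[of "0 :: 'h bop" 0] by (simp add: norm2_def)

lemma norm2_scaleR: "x \<in> HR \<Longrightarrow> norm2 (t *\<^sub>R x) = \<bar>t\<bar> * norm2 x"
proof -
  assume x: "x \<in> HR"
  have "inner2 (t *\<^sub>R x) (t *\<^sub>R x) = t\<^sup>2 * inner2 x x"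
    using x by (simp add: inner2_scaleR_left inner2_scaleR_right HR_scaleR power2_eq_square)
  then show ?thesis
    by (simp add: norm2_def real_sqrt_mult)
qed

lemma norm2_minus: "x \<in> HR \<Longrightarrow> norm2 (- x) = norm2 x"
  using norm2_scaleR[of x "-1"] by simp

lemma norm2_add_sq:
  assumes "x \<in> HR" "y \<in> HR"
  shows "(norm2 (x + y))\<^sup>2 = (norm2 x)\<^sup>2 + (norm2 y)\<^sup>2 + 2 * inner2 x y"
  using assms inner2_commute[OF assms] by (simp add: norm2_sq HR_add inner2_add_left inner2_add_right)

lemma norm2_diff_sq:
  assumes "x \<in> HR" "y \<in> HR"
  shows "(norm2 (x - y))\<^sup>2 = (norm2 x)\<^sup>2 + (norm2 y)\<^sup>2 - 2 * inner2 x y"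
  using norm2_add_sq[OF assms(1) HR_minus[OF assms(2)]] inner2_scaleR_right[OF assms(2,1), of "-1"] assms
  by (simp add: norm2_minus)

lemma norm2_triangle:
  assumes x: "x \<in> HR" and y: "y \<in> HR"
  shows "norm2 (x + y) \<le> norm2 x + norm2 y"
proof -
  have "0 \<le> (norm2 x)\<^sup>2 + 2 * t * inner2 x y + t\<^sup>2 * (norm2 y)\<^sup>2" for t
    using norm2_add_sq[OF x HR_scaleR[OF y], of t] zero_le_power2[of "norm2 (x + t *\<^sub>R y)"] x y
    by (simp add: norm2_scaleR inner2_scaleR_right power_mult_distrib algebra_simps del: zero_le_power2)
  then have "(inner2 x y)\<^sup>2 \<le> (norm2 x * norm2 y)\<^sup>2"
    unfolding power_mult_distrib by (rule quadratic_discriminant_le) simp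
  then have "inner2 x y \<le> norm2 x * norm2 y"
    using abs_le_square_iff[of "inner2 x y" "norm2 x * norm2 y"] norm2_nonneg[OF x] norm2_nonneg[OF y] by simp
  then have "(norm2 (x + y))\<^sup>2 \<le> (norm2 x + norm2 y)\<^sup>2"
    unfolding norm2_add_sq[OF x y] by (simp add: power2_sum)
  then show ?thesis
    by (rule power2_le_imp_le) (simp add: norm2_nonneg x y)
qed

lemma norm2_diff_triangle:
  assumes "x \<in> HR" "y \<in> HR" "z \<in> HR"
  shows "norm2 (x - z) \<le> norm2 (x - y) + norm2 (y - z)"
  using norm2_triangle[of "x - y" "y - z"] assms by (simp add: HR_intros)

lemma hs_norm_le_norm2: "x \<in> HR \<Longrightarrow> 2 * hs_norm (hs_part x) \<le> norm2 x"
proof -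
  assume x: "x \<in> HR"
  have "(2 * hs_norm (hs_part x))\<^sup>2 \<le> (norm2 x)\<^sup>2"
    by (simp add: norm2_sq[OF x] inner2_self[OF x] power_mult_distrib)
  then show ?thesis
    by (rule power2_le_imp_le) (rule norm2_nonneg[OF x])
qed

lemma scalar_part_le_norm2: "x \<in> HR \<Longrightarrow> \<bar>scalar_part x\<bar> \<le> norm2 x"
proof -
  assume x: "x \<in> HR"
  have "(\<bar>scalar_part x\<bar>)\<^sup>2 \<le> (norm2 x)\<^sup>2"
    by (simp add: norm2_sq[OF x] inner2_self[OF x])
  then show ?thesis
    by (rule power2_le_imp_le) (rule norm2_nonneg[OF x])
qed

lemma norm2_le: "x \<in> HR \<Longrightarrow> norm2 x \<le> 2 * hs_norm (hs_part x) + \<bar>scalar_part x\<bar>"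
proof -
  assume x: "x \<in> HR"
  have "(norm2 x)\<^sup>2 \<le> (2 * hs_norm (hs_part x) + \<bar>scalar_part x\<bar>)\<^sup>2"
    by (simp add: norm2_sq[OF x] inner2_self[OF x] power2_sum power_mult_distrib)
  then show ?thesis
    by (rule power2_le_imp_le) simp
qed

lemma norm2_eq_0: "x \<in> HR \<Longrightarrow> norm2 x = 0 \<Longrightarrow> x = 0"
proof -
  assume x: "x \<in> HR" "norm2 x = 0"
  then have "hs_norm (hs_part x) = 0" "scalar_part x = 0"
    using hs_norm_le_norm2[OF x(1)] scalar_part_le_norm2[OF x(1)] hs_norm_nonneg[of "hs_part x"] by auto
  then show "x = 0"
    using HR_decompose[OF x(1)] hs_norm_eq_0 sa_hsD(1)[OF hs_part_sa_hs[OF x(1)]] by simp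
qed

section \<open>Exponential and logarithm on \<open>HR\<close>\<close>

lemma exp_HR:
  fixes a :: "'h::infdim_separable_hilbert bop"
  shows "exp (a + of_real r) = exp r *\<^sub>R exp a"
proof -
  have "exp (a + of_real r) = exp a * exp (of_real r)"
    by (rule exp_add_commuting) (simp add: of_real_def)
  then show ?thesis
    by (simp add: exp_of_real) (simp add: of_real_def)
qed

lemma exp_HR_parts: "z \<in> HR \<Longrightarrow> exp z = exp (scalar_part z) *\<^sub>R exp (hs_part z)"
  using exp_HR[of "hs_part z" "scalar_part z"] HR_decompose[of z] by simp

lemma exp_inj_HR: "inj_on exp (HR :: 'h::infdim_separable_hilbert bop set)"
proof (rule inj_onI)
  fix x y :: "'h bop"
  assume "x \<in> HR" "y \<in> HR" and eq: "exp x = exp y"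
  then obtain a r b s where ab: "a \<in> sa_hs" "b \<in> sa_hs" and xy: "x = a + of_real r" "y = b + of_real s"
    by (metis HR_E)
  have e: "exp r *\<^sub>R exp a = exp s *\<^sub>R exp b"
    using eq by (simp add: xy exp_HR)
  \<comment> \<open>Equality of the exponentials exhibits this scalar as a Hilbert-Schmidt operator,
    hence as 0.\<close>
  have "of_real (exp r - exp s) = exp s *\<^sub>R (exp b - 1) - exp r *\<^sub>R (exp a - 1 :: 'h bop)"
    by (simp add: scaleR_diff_right e) (simp add: of_real_def scaleR_diff_left)
  moreover have "hilbert_schmidt (exp s *\<^sub>R (exp b - 1) - exp r *\<^sub>R (exp a - 1))"
    by (intro hilbert_schmidt_intros hilbert_schmidt_exp_minus_1 ab)
  ultimately have "exp r - exp s = 0"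
    using not_hilbert_schmidt_of_real by metis
  then have "r = s" "exp a = exp b"
    using e by auto
  then show "x = y"
    using exp_inj_sa_hs[OF ab] by (simp add: xy)
qed

lemma ln_op_exp: "z \<in> HR \<Longrightarrow> ln_op (exp z) = z"
  unfolding ln_op_def by (rule the_inv_into_f_f[OF exp_inj_HR])

text \<open>The isometry p -> e^x p e^x of the positive operators in logarithmic coordinates; as
  \<open>x\<close> varies these maps act transitively.\<close>

definition conj_log :: "'h::infdim_separable_hilbert bop \<Rightarrow> 'h bop \<Rightarrow> 'h bop" where
  "conj_log x y = ln_op (exp x * exp y * exp x)"

lemma ex_conj_log_sa_hs:
  assumes x: "x \<in> sa_hs" and y: "y \<in> sa_hs"
  shows "\<exists>w\<in>sa_hs. exp w = exp x * exp y * exp x"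
proof -
  let ?y = "y /\<^sub>R 2"
  have adj: "adj (exp x) = exp x" "adj (exp ?y) = exp ?y"
    by (intro adj_exp_sa_hs sa_hs_intros x y)+
  \<comment> \<open>With S = e^(y/2) e^x the product has the form required by
    \<open>ex_log_sa_hs\<close>.\<close>
  have p: "exp x * exp y * exp x = adj (exp ?y * exp x) * (exp ?y * exp x)"
    unfolding adj_simps adj mult.assoc exp_half ..
  have inv: "exp (- x) * exp (- ?y) * (exp ?y * exp x) = 1"
    by (simp add: mult.assoc)
  \<comment> \<open>A telescoping sum in which every summand has a Hilbert-Schmidt factor of the
    form exp - 1.\<close>
  have "exp x * exp y * exp x - 1 = (exp x - 1) * exp y * exp x + (exp y - 1) * exp x + (exp x - 1)"
    by (simp add: algebra_simps)
  moreover have "hilbert_schmidt ((exp x - 1) * exp y * exp x + (exp y - 1) * exp x + (exp x - 1))"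
    by (intro hilbert_schmidt_add hilbert_schmidt_mult_right hilbert_schmidt_exp_minus_1 x y)
  ultimately have "hilbert_schmidt (exp x * exp y * exp x - 1)"
    by (simp only:)
  then show ?thesis
    by (rule ex_log_sa_hs[OF p inv])
qed

lemma conj_log:
  assumes x: "x \<in> HR" and y: "y \<in> HR"
  shows conj_log_HR: "conj_log x y \<in> HR"
    and exp_conj_log: "exp (conj_log x y) = exp x * exp y * exp x"
    and scalar_part_conj_log: "scalar_part (conj_log x y) = 2 * scalar_part x + scalar_part y"
    and exp_hs_part_conj_log: "exp (hs_part (conj_log x y)) = exp (hs_part x) * exp (hs_part y) * exp (hs_part x)"
proof -
  obtain w where w: "w \<in> sa_hs" "exp w = exp (hs_part x) * exp (hs_part y) * exp (hs_part x)"
    using ex_conj_log_sa_hs[OF hs_part_sa_hs[OF x] hs_part_sa_hs[OF y]] by blast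
  \<comment> \<open>Scalars commute with everything: their contributions add, and a logarithm is
    required only for the Hilbert-Schmidt parts.\<close>
  define z where "z = w + of_real (2 * scalar_part x + scalar_part y)"
  have z: "z \<in> HR"
    unfolding z_def by (rule HR_I[OF w(1)])
  have "exp (2 * scalar_part x + scalar_part y) = exp (scalar_part x) * exp (scalar_part y) * exp (scalar_part x)"
    by (simp flip: exp_add)
  then have "exp z = exp x * exp y * exp x"
    unfolding z_def exp_HR exp_HR_parts[OF x] exp_HR_parts[OF y] w(2)
    by (simp add: mult_ac)
  then have "conj_log x y = z"
    unfolding conj_log_def using ln_op_exp[OF z] by simp
  moreover have "hs_part z = w" "scalar_part z = 2 * scalar_part x + scalar_part y"
    unfolding z_def by (rule parts_of_HR[OF w(1)])+
  ultimately show "conj_log x y \<in> HR" "exp (conj_log x y) = exp x * exp y * exp x"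
    "scalar_part (conj_log x y) = 2 * scalar_part x + scalar_part y"
    "exp (hs_part (conj_log x y)) = exp (hs_part x) * exp (hs_part y) * exp (hs_part x)"
    using z \<open>exp z = _\<close> w(2) by simp_all
qed

section \<open>Invariance and symmetry of \<open>dist_fun\<close>\<close>

lemma dist_fun_eq: "dist_fun a y = norm2 (conj_log (a /\<^sub>R 2) (- y))"
  by (simp add: dist_fun_def conj_log_def)

lemma dist_fun_nonneg: "a \<in> HR \<Longrightarrow> y \<in> HR \<Longrightarrow> 0 \<le> dist_fun a y"
  unfolding dist_fun_eq by (intro norm2_nonneg conj_log_HR HR_intros)

lemma conj_log_eqI: "w \<in> HR \<Longrightarrow> exp w = exp x * exp y * exp x \<Longrightarrow> conj_log x y = w"
  unfolding conj_log_def using ln_op_exp by metis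

lemma conj_log_cancel:
  assumes "x \<in> HR" "y \<in> HR"
  shows "conj_log (- x) (conj_log x y) = y" "conj_log x (conj_log (- x) y) = y"
  using assms by (auto intro!: conj_log_eqI simp: exp_conj_log HR_intros mult.assoc)

lemma exp_minus_eqI:
  fixes x :: "'a::{real_normed_algebra_1, banach}"
  assumes "exp x * y = 1"
  shows "exp (- x) = y"
  by (metis assms exp_cancel(4) mult.right_neutral)

lemma conj_log_minus:
  assumes "x \<in> HR" "y \<in> HR"
  shows "conj_log (- x) (- y) = - conj_log x y"
proof (rule conj_log_eqI)
  show "exp (- conj_log x y) = exp (- x) * exp (- y) * exp (- x)"
    by (rule exp_minus_eqI) (simp add: exp_conj_log assms mult.assoc)
qed (intro HR_minus conj_log_HR assms)

lemma exp_conj: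
  fixes U V w :: "'h::infdim_separable_hilbert bop"
  assumes "V * U = 1" "U * V = 1"
  shows "exp (U * w * V) = U * exp w * V"
proof -
  have pow: "(U * w * V) ^ n = U * w ^ n * V" for n
  proof (induction n)
    case (Suc n)
    have "(U * w * V) ^ Suc n = U * w * (V * U) * w ^ n * V"
      using Suc by (simp add: mult.assoc)
    then show ?case
      by (simp add: assms mult.assoc)
  qed (simp add: assms)
  have "bounded_linear (\<lambda>A. U * A * V)"
    by (intro bounded_linear_mult_left[THEN bounded_linear_compose] bounded_linear_mult_right)
  then have "(\<lambda>n. U * (w ^ n /\<^sub>R fact n) * V) sums (U * exp w * V)"
    by (intro bounded_linear.sums[of "\<lambda>A. U * A * V"] exp_converges)
  then have "(\<lambda>n. (U * w * V) ^ n /\<^sub>R fact n) sums (U * exp w * V)"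
    by (simp add: pow)
  then show ?thesis
    using exp_converges sums_unique2 by blast
qed


lemma unitary_conj:
  assumes w: "w \<in> HR" and U: "adj U * U = 1" "U * adj U = 1"
  shows HR_unitary_conj: "U * w * adj U \<in> HR" and norm2_unitary_conj: "norm2 (U * w * adj U) = norm2 w"
proof -
  \<comment> \<open>An inequality is enough: applying it to the inverse conjugation, by
    \<open>adj U\<close>, gives the reverse one.\<close>
  have *: "V * z * adj V \<in> HR \<and> norm2 (V * z * adj V) \<le> norm2 z"
    if z: "z \<in> HR" and V: "adj V * V = 1" "V * adj V = 1" for z V :: "'a bop"
  proof -
    define b where "b = V * hs_part z * adj V"
    note hz = hs_part_sa_hs[OF z]
    have b: "b \<in> sa_hs"
      using sa_hsD[OF hz] by (auto simp: b_def sa_hs_def mult.assoc intro: hilbert_schmidt_intros)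
    have "hs_norm b \<le> hs_norm (V * hs_part z) * norm (adj V)"
      unfolding b_def by (intro hs_norm_mult_right hilbert_schmidt_intros sa_hsD(1)[OF hz])
    also have "\<dots> \<le> hs_norm (hs_part z) * 1"
    proof (rule mult_mono)
      show "hs_norm (V * hs_part z) \<le> hs_norm (hs_part z)"
        using hs_norm_mult_left[OF sa_hsD(1)[OF hz], of V]
          mult_right_mono[OF norm_unitary_le[OF V(1)] hs_norm_nonneg[of "hs_part z"]]
        by linarith
    qed (use norm_unitary_le[OF V(1)] in auto)
    finally have le: "(hs_norm b)\<^sup>2 \<le> (hs_norm (hs_part z))\<^sup>2"
      by (simp add: power_mono)
    have eq: "V * z * adj V = b + of_real (scalar_part z)"
      by (subst HR_decompose[OF z]) (simp add: b_def distrib_left distrib_right of_real_def V)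
    have "inner2 (V * z * adj V) (V * z * adj V) \<le> inner2 z z"
      unfolding eq inner2_self[OF HR_I[OF b]] inner2_self[OF z] parts_of_HR[OF b] using le by simp
    then show ?thesis
      using eq HR_I[OF b] by (simp add: norm2_def)
  qed
  show HR: "U * w * adj U \<in> HR"
    using *[OF w U] by simp
  have "adj U * (U * w * adj U) * adj (adj U) = (adj U * U) * w * (adj U * U)"
    by (simp only: adj_adj mult.assoc)
  then have "adj U * (U * w * adj U) * adj (adj U) = w"
    by (simp add: U)
  then have "norm2 w \<le> norm2 (U * w * adj U)"
    using *[OF HR, of "adj U"] U by simp
  then show "norm2 (U * w * adj U) = norm2 w"
    using *[OF w U] by simp
qed

text \<open>Let e^b = e^x e^a e^x. Then U = e^(b/2) e^(-x) e^(-a/2) is unitary, and conjugation by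
  it carries e^(a/2) e^(-y) e^(a/2) to the corresponding operator for the two moved points. The norm
  of the logarithm is unitarily invariant.\<close>

lemma dist_fun_conj_log:
  assumes x: "x \<in> HR" and a: "a \<in> HR" and y: "y \<in> HR"
  shows "dist_fun (conj_log x a) (conj_log x y) = dist_fun a y"
proof -
  let ?b = "conj_log x a"
  have b: "?b \<in> HR"
    by (rule conj_log_HR[OF x a])
  define w where "w = conj_log (a /\<^sub>R 2) (- y)"
  have w: "w \<in> HR" "exp w = exp (a /\<^sub>R 2) * exp (- y) * exp (a /\<^sub>R 2)"
    unfolding w_def by (intro conj_log_HR exp_conj_log HR_intros a y)+
  define U where "U = exp (?b /\<^sub>R 2) * exp (- x) * exp (- (a /\<^sub>R 2))"
  have adjs: "adj (exp (?b /\<^sub>R 2)) = exp (?b /\<^sub>R 2)" "adj (exp (- x)) = exp (- x)"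
      "adj (exp (- (a /\<^sub>R 2))) = exp (- (a /\<^sub>R 2))"
    unfolding adj_exp by (simp_all only: adj_HR HR_intros x a b)
  have adjU: "adj U = exp (- (a /\<^sub>R 2)) * exp (- x) * exp (?b /\<^sub>R 2)"
    unfolding U_def adj_simps adjs by (simp only: mult.assoc)
  have a_half: "exp (- (a /\<^sub>R 2)) * exp (- (a /\<^sub>R 2)) = exp (- a)"
    using exp_half(1)[of "- a"] by simp
  have "adj U * U = exp (- (a /\<^sub>R 2)) * exp (- x) * (exp (?b /\<^sub>R 2) * exp (?b /\<^sub>R 2)) * exp (- x) * exp (- (a /\<^sub>R 2))"
    unfolding adjU unfolding U_def by (simp only: mult.assoc)
  also have "\<dots> = exp (- (a /\<^sub>R 2)) * exp a * exp (- (a /\<^sub>R 2))"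
    unfolding exp_half exp_conj_log[OF x a] by (simp add: mult.assoc)
  also have "\<dots> = 1"
    unfolding exp_half(1)[of a, symmetric] by (simp add: mult.assoc)
  finally have U1: "adj U * U = 1" .
  have "U * adj U = exp (?b /\<^sub>R 2) * exp (- x) * (exp (- (a /\<^sub>R 2)) * exp (- (a /\<^sub>R 2))) * exp (- x) * exp (?b /\<^sub>R 2)"
    unfolding adjU unfolding U_def by (simp only: mult.assoc)
  also have "\<dots> = exp (?b /\<^sub>R 2) * exp (- ?b) * exp (?b /\<^sub>R 2)"
  proof -
    have "exp (- ?b) = exp (- x) * exp (- a) * exp (- x)"
      by (rule exp_minus_eqI) (simp add: exp_conj_log[OF x a] mult.assoc)
    then show ?thesis
      by (simp only: a_half mult.assoc)
  qed
  also have "\<dots> = exp (?b /\<^sub>R 2) * (exp (- (?b /\<^sub>R 2)) * exp (- (?b /\<^sub>R 2))) * exp (?b /\<^sub>R 2)"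
    using exp_half(1)[of "- ?b"] by simp
  also have "\<dots> = 1"
    by (simp add: mult.assoc)
  finally have U2: "U * adj U = 1" .
  have "exp (U * w * adj U) = U * exp w * adj U"
    by (rule exp_conj[OF U1 U2])
  also have "\<dots> = exp (?b /\<^sub>R 2) * (exp (- x) * exp (- y) * exp (- x)) * exp (?b /\<^sub>R 2)"
    unfolding w(2) adjU unfolding U_def by (simp add: mult.assoc)
  also have "exp (- x) * exp (- y) * exp (- x) = exp (- conj_log x y)"
    by (rule sym, rule exp_minus_eqI) (simp add: exp_conj_log[OF x y] mult.assoc)
  finally have "conj_log (?b /\<^sub>R 2) (- conj_log x y) = U * w * adj U"
    by (intro conj_log_eqI HR_unitary_conj[OF w(1) U1 U2])
  then show ?thesis
    unfolding dist_fun_eq using norm2_unitary_conj[OF w(1) U1 U2] by (simp add: w_def)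
qed

lemma dist_fun_0_right: "a \<in> HR \<Longrightarrow> dist_fun a 0 = norm2 a"
proof -
  assume a: "a \<in> HR"
  have "conj_log (a /\<^sub>R 2) (- 0) = a"
    by (rule conj_log_eqI[OF a]) (simp add: exp_half)
  then show "dist_fun a 0 = norm2 a"
    by (simp only: dist_fun_eq)
qed

lemma conj_log_half_minus: "y \<in> HR \<Longrightarrow> conj_log (- (y /\<^sub>R 2)) y = 0"
proof (rule conj_log_eqI[OF HR_0])
  have "exp (- (y /\<^sub>R 2)) * exp y * exp (- (y /\<^sub>R 2)) = exp (- (y /\<^sub>R 2)) * (exp (y /\<^sub>R 2) * exp (y /\<^sub>R 2)) * exp (- (y /\<^sub>R 2))"
    by (simp only: exp_half)
  then show "exp 0 = exp (- (y /\<^sub>R 2)) * exp y * exp (- (y /\<^sub>R 2))"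
    by (simp add: mult.assoc)
qed

text \<open>The definition is centred at \<open>a\<close>; this form is centred at \<open>y\<close>,
  which an isometry moves to 0.\<close>

lemma dist_fun_alt:
  assumes "a \<in> HR" "y \<in> HR"
  shows "dist_fun a y = norm2 (conj_log (- (y /\<^sub>R 2)) a)"
proof -
  have hy: "- (y /\<^sub>R 2) \<in> HR"
    by (intro HR_intros assms)
  have "dist_fun a y = dist_fun (conj_log (- (y /\<^sub>R 2)) a) (conj_log (- (y /\<^sub>R 2)) y)"
    by (rule dist_fun_conj_log[OF hy assms, symmetric])
  then show ?thesis
    by (simp only: conj_log_half_minus[OF assms(2)] dist_fun_0_right[OF conj_log_HR[OF hy assms(1)]])
qed

lemma dist_fun_commute:
  assumes "a \<in> HR" "y \<in> HR"
  shows "dist_fun a y = dist_fun y a"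
proof -
  have hy: "- (y /\<^sub>R 2) \<in> HR"
    by (intro HR_intros assms)
  have "conj_log (y /\<^sub>R 2) (- a) = - conj_log (- (y /\<^sub>R 2)) a"
    using conj_log_minus[OF hy assms(1)] by simp
  then show ?thesis
    using norm2_minus[OF conj_log_HR[OF hy assms(1)]] by (simp only: dist_fun_alt[OF assms] dist_fun_eq[of y])
qed

lemma exp_scaleR_mult:
  fixes z :: "'a::{real_normed_algebra_1, banach}"
  shows "exp (s *\<^sub>R z) * exp (t *\<^sub>R z) = exp ((s + t) *\<^sub>R z)"
  by (simp add: scaleR_add_left exp_add_commuting)

lemma dist_fun_line:
  assumes "z \<in> HR"
  shows "dist_fun (s *\<^sub>R z) (t *\<^sub>R z) = \<bar>s - t\<bar> * norm2 z"
proof -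
  have "conj_log ((s *\<^sub>R z) /\<^sub>R 2) (- (t *\<^sub>R z)) = (s - t) *\<^sub>R z"
  proof (rule conj_log_eqI)
    have "exp ((s / 2) *\<^sub>R z) * exp ((- t) *\<^sub>R z) * exp ((s / 2) *\<^sub>R z) = exp ((s - t) *\<^sub>R z)"
      by (simp only: exp_scaleR_mult) simp
    moreover have "(s *\<^sub>R z) /\<^sub>R 2 = (s / 2) *\<^sub>R z" "- (t *\<^sub>R z) = (- t) *\<^sub>R z"
      by simp_all
    ultimately show "exp ((s - t) *\<^sub>R z) = exp ((s *\<^sub>R z) /\<^sub>R 2) * exp (- (t *\<^sub>R z)) * exp ((s *\<^sub>R z) /\<^sub>R 2)"
      by (simp only:)
  qed (intro HR_intros assms)
  then show ?thesis
    by (simp add: dist_fun_eq norm2_scaleR assms)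
qed

section \<open>The exponential metric increasing property\<close>

text \<open>For the Hilbert-Schmidt parts this is \<open>hs_norm_diff_le_local\<close>. The scalar
  part of \<open>a - y\<close> equals that of \<open>w\<close>, so the same factor bounds both
  summands of the squared norm.\<close>

lemma norm2_diff_le_local:
  assumes a: "a \<in> HR" and y: "y \<in> HR"
  shows "norm2 (a - y) \<le> exp (dist_fun a y) * dist_fun a y"
proof -
  have hy: "- (y /\<^sub>R 2) \<in> HR"
    by (intro HR_intros y)
  define w where "w = conj_log (- (y /\<^sub>R 2)) a"
  have w: "w \<in> HR"
    unfolding w_def by (rule conj_log_HR[OF hy a])
  have dist: "dist_fun a y = norm2 w"
    unfolding w_def by (rule dist_fun_alt[OF a y])
  have parts: "hs_part (- (y /\<^sub>R 2)) = - (hs_part y /\<^sub>R 2)" "scalar_part (- (y /\<^sub>R 2)) = - (scalar_part y / 2)"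
    using parts_minus[OF HR_scaleR[OF y]] parts_scaleR[OF y] by simp_all
  have sw: "scalar_part (a - y) = scalar_part w"
    unfolding w_def scalar_part_conj_log[OF hy a] parts using parts_diff[OF a y] by simp
  have "exp (hs_part w) = exp (- (hs_part y /\<^sub>R 2)) * exp (hs_part a) * exp (- (hs_part y /\<^sub>R 2))"
    unfolding w_def exp_hs_part_conj_log[OF hy a] parts ..
  then have "exp (hs_part a) = exp (hs_part y /\<^sub>R 2) * exp (hs_part w) * exp (hs_part y /\<^sub>R 2)"
    by (simp add: mult.assoc)
  note local = hs_norm_diff_le_local[OF hs_part_sa_hs[OF a] hs_part_sa_hs[OF y] hs_part_sa_hs[OF w] this]
  have "norm (hs_part w) \<le> norm2 w"
    using norm_le_hs_norm[OF sa_hsD(1)[OF hs_part_sa_hs[OF w]]] hs_norm_le_norm2[OF w]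
      hs_norm_nonneg[of "hs_part w"] by linarith
  then have "exp (norm (hs_part w)) * hs_norm (hs_part w) \<le> exp (norm2 w) * hs_norm (hs_part w)"
    by (intro mult_right_mono) auto
  with local have "(hs_norm (hs_part a - hs_part y))\<^sup>2 \<le> (exp (norm2 w) * hs_norm (hs_part w))\<^sup>2"
    by (intro power_mono) auto
  then have 1: "(hs_norm (hs_part (a - y)))\<^sup>2 \<le> (exp (norm2 w))\<^sup>2 * (hs_norm (hs_part w))\<^sup>2"
    using parts_diff[OF a y] by (simp add: power_mult_distrib)
  have "1 \<le> (exp (norm2 w))\<^sup>2"
    using norm2_nonneg[OF w] by simp
  then have 2: "(scalar_part w)\<^sup>2 \<le> (exp (norm2 w))\<^sup>2 * (scalar_part w)\<^sup>2"
    using mult_right_mono[of 1 "(exp (norm2 w))\<^sup>2" "(scalar_part w)\<^sup>2"] by simp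
  have "(norm2 (a - y))\<^sup>2 \<le> (exp (norm2 w) * norm2 w)\<^sup>2"
    unfolding power_mult_distrib norm2_sq[OF HR_diff[OF a y]] norm2_sq[OF w]
      inner2_self[OF HR_diff[OF a y]] inner2_self[OF w] sw
    using 1 2 by (simp add: distrib_left mult.left_commute)
  then show ?thesis
    unfolding dist by (rule power2_le_imp_le) (simp add: norm2_nonneg[OF w])
qed

lemma norm2_telescope:
  assumes "\<And>i. g i \<in> HR" "\<And>i. norm2 (g (Suc i) - g i) \<le> C"
  shows "norm2 (g k - g 0) \<le> real k * C"
proof (induction k)
  case (Suc k)
  have "norm2 (g (Suc k) - g 0) \<le> norm2 (g (Suc k) - g k) + norm2 (g k - g 0)"
    by (intro norm2_diff_triangle assms)
  then show ?case
    using Suc assms(2)[of k] by (simp add: distrib_right)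
qed simp

text \<open>
  Subdividing the geodesic \<open>t \<mapsto> e\<^bsup>y/2\<^esup> e\<^bsup>tz\<^esup> e\<^bsup>y/2\<^esup>\<close> makes the factor \<open>exp\<close> of the local estimate arbitrarily
  close to 1.
\<close>

lemma norm2_diff_le_dist_fun:
  assumes a: "a \<in> HR" and y: "y \<in> HR"
  shows "norm2 (a - y) \<le> dist_fun a y"
proof -
  have hy: "y /\<^sub>R 2 \<in> HR" "- (y /\<^sub>R 2) \<in> HR"
    by (intro HR_intros y)+
  define z where "z = conj_log (- (y /\<^sub>R 2)) a"
  have z: "z \<in> HR"
    unfolding z_def by (rule conj_log_HR[OF hy(2) a])
  define D where "D = norm2 z"
  have D: "dist_fun a y = D"
    unfolding D_def z_def by (rule dist_fun_alt[OF a y])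
  define \<gamma> where "\<gamma> t = conj_log (y /\<^sub>R 2) (t *\<^sub>R z)" for t :: real
  have \<gamma>: "\<gamma> t \<in> HR" for t
    unfolding \<gamma>_def by (intro conj_log_HR hy HR_scaleR z)
  have "\<gamma> 0 = y"
    unfolding \<gamma>_def by (rule conj_log_eqI[OF y]) (simp add: exp_half)
  have "\<gamma> 1 = a"
    unfolding \<gamma>_def z_def using conj_log_cancel(2)[OF hy(1) a] by simp
  have dist: "dist_fun (\<gamma> s) (\<gamma> t) = \<bar>s - t\<bar> * D" for s t
    unfolding \<gamma>_def D_def using dist_fun_conj_log[OF hy(1) HR_scaleR[OF z] HR_scaleR[OF z]] dist_fun_line[OF z] by simp
  have bound: "norm2 (a - y) \<le> exp (D / real (Suc n)) * D" for n
  proof -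
    define g where "g i = \<gamma> (real i / real (Suc n))" for i
    have "norm2 (g (Suc i) - g i) \<le> exp (D / Suc n) * (D / Suc n)" for i
    proof -
      have "dist_fun (g (Suc i)) (g i) = D / Suc n"
        unfolding g_def dist by (simp flip: diff_divide_distrib)
      then show ?thesis
        using norm2_diff_le_local[of "g (Suc i)" "g i"] \<gamma> by (simp add: g_def)
    qed
    then have "norm2 (g (Suc n) - g 0) \<le> real (Suc n) * (exp (D / Suc n) * (D / Suc n))"
      by (intro norm2_telescope) (simp_all add: g_def \<gamma>)
    then show ?thesis
      by (simp add: g_def \<open>\<gamma> 0 = y\<close> \<open>\<gamma> 1 = a\<close>)
  qed
  have "(\<lambda>n. exp (D / real (Suc n)) * D) \<longlonglongrightarrow> exp 0 * D"
    by (intro tendsto_intros LIMSEQ_Suc[OF lim_const_over_n])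
  then show ?thesis
    unfolding D using LIMSEQ_le_const[of _ "exp 0 * D" "norm2 (a - y)"] bound by auto
qed

text \<open>Moving \<open>c\<close> to 0 turns the distances to \<open>c\<close> into
  \<open>norm2\<close>; the remaining distance dominates the difference of the vectors.\<close>

lemma dist_fun_triangle:
  assumes a: "a \<in> HR" and b: "b \<in> HR" and c: "c \<in> HR"
  shows "dist_fun a c \<le> dist_fun a b + dist_fun b c"
proof -
  have hc: "- (c /\<^sub>R 2) \<in> HR"
    by (intro HR_intros c)
  let ?T = "conj_log (- (c /\<^sub>R 2))"
  have T: "?T a \<in> HR" "?T b \<in> HR"
    by (intro conj_log_HR hc a b)+
  have "norm2 (?T a) \<le> norm2 (?T a - ?T b) + norm2 (?T b)"
    using norm2_triangle[OF HR_diff[OF T] T(2)] by simp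
  also have "norm2 (?T a - ?T b) \<le> dist_fun a b"
    using norm2_diff_le_dist_fun[OF T] dist_fun_conj_log[OF hc a b] by simp
  finally show ?thesis
    by (simp only: dist_fun_alt[OF a c] dist_fun_alt[OF b c])
qed

text \<open>Here \<open>\<mu>\<close> is the midpoint of \<open>y\<close> and \<open>y'\<close>.
  Moving it to 0 makes the images of \<open>y\<close> and \<open>y'\<close> opposite vectors, so
  their mutual distance is exact, as is the distance of \<open>a\<close> to the midpoint. The
  distances from \<open>a\<close> to the ends dominate norms of differences, and the parallelogram
  law of \<open>HR\<close> concludes.\<close>

lemma semi_parallelogram:
  assumes a: "a \<in> HR" and y: "y \<in> HR" and y': "y' \<in> HR"
  defines "\<mu> \<equiv> conj_log (y /\<^sub>R 2) (conj_log (- (y /\<^sub>R 2)) y' /\<^sub>R 2)"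
  shows "(dist_fun y y')\<^sup>2 \<le> 2 * (dist_fun a y)\<^sup>2 + 2 * (dist_fun a y')\<^sup>2 - 4 * (dist_fun a \<mu>)\<^sup>2"
proof -
  have hy: "y /\<^sub>R 2 \<in> HR" "- (y /\<^sub>R 2) \<in> HR"
    by (intro HR_intros y)+
  define b where "b = conj_log (- (y /\<^sub>R 2)) y'"
  have b: "b \<in> HR" "b /\<^sub>R 2 \<in> HR"
    unfolding b_def by (intro conj_log_HR HR_scaleR hy y')+
  have \<mu>: "\<mu> \<in> HR"
    unfolding \<mu>_def by (fold b_def, rule conj_log_HR[OF hy(1) b(2)])
  have exp_\<mu>: "exp \<mu> = exp (y /\<^sub>R 2) * exp (b /\<^sub>R 2) * exp (y /\<^sub>R 2)"
    unfolding \<mu>_def by (fold b_def, rule exp_conj_log[OF hy(1) b(2)])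
  have "y' = conj_log (y /\<^sub>R 2) b"
    unfolding b_def using conj_log_cancel(2)[OF hy(1) y'] by simp
  then have exp_y': "exp y' = exp (y /\<^sub>R 2) * exp b * exp (y /\<^sub>R 2)"
    using exp_conj_log[OF hy(1) b(1)] by simp
  have exp_my: "exp (- y) = exp (- (y /\<^sub>R 2)) * exp (- (y /\<^sub>R 2))"
    using exp_half(1)[of "- y"] by simp
  \<comment> \<open>The geodesic symmetry at e^mu, sending p to e^mu times the inverse of p times
    e^mu, takes e^y to e^y'.\<close>
  have refl: "exp \<mu> * exp (- y) * exp \<mu> = exp y'"
    unfolding exp_\<mu> exp_y' exp_my by (simp add: mult.assoc exp_half)
  have h\<mu>: "\<mu> /\<^sub>R 2 \<in> HR" "- (\<mu> /\<^sub>R 2) \<in> HR"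
    by (intro HR_intros \<mu>)+
  define T where "T = conj_log (- (\<mu> /\<^sub>R 2))"
  have T: "T z \<in> HR" if "z \<in> HR" for z
    unfolding T_def by (rule conj_log_HR[OF h\<mu>(2) that])
  have iso: "dist_fun (T u) (T z) = dist_fun u z" if "u \<in> HR" "z \<in> HR" for u z
    unfolding T_def by (rule dist_fun_conj_log[OF h\<mu>(2) that])
  have "T y' = - T y"
    unfolding T_def
  proof (rule conj_log_eqI)
    show "- conj_log (- (\<mu> /\<^sub>R 2)) y \<in> HR"
      using T[OF y] by (simp add: T_def HR_minus)
    have "exp (- conj_log (- (\<mu> /\<^sub>R 2)) y) = exp (\<mu> /\<^sub>R 2) * exp (- y) * exp (\<mu> /\<^sub>R 2)"
      using conj_log_minus[OF h\<mu>(2) y] exp_conj_log[OF h\<mu>(1) HR_minus[OF y]] by simp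
    also have "\<dots> = exp (- (\<mu> /\<^sub>R 2)) * (exp (\<mu> /\<^sub>R 2) * exp (\<mu> /\<^sub>R 2)) * exp (- y) * (exp (\<mu> /\<^sub>R 2) * exp (\<mu> /\<^sub>R 2)) * exp (- (\<mu> /\<^sub>R 2))"
      by (simp add: mult.assoc)
    also have "\<dots> = exp (- (\<mu> /\<^sub>R 2)) * exp y' * exp (- (\<mu> /\<^sub>R 2))"
      unfolding refl[symmetric] exp_half(1)[of \<mu>] by (simp only: mult.assoc)
    finally show "exp (- conj_log (- (\<mu> /\<^sub>R 2)) y) = exp (- (\<mu> /\<^sub>R 2)) * exp y' * exp (- (\<mu> /\<^sub>R 2))" .
  qed
  have T0: "T \<mu> = 0"
    unfolding T_def by (rule conj_log_half_minus[OF \<mu>])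
  have d_\<mu>: "dist_fun a \<mu> = norm2 (T a)"
    using iso[OF a \<mu>] dist_fun_0_right[OF T[OF a]] by (simp add: T0)
  have d_yy': "dist_fun y y' = 2 * norm2 (T y)"
    using iso[OF y y'] dist_fun_line[OF T[OF y], of 1 "-1"] by (simp add: \<open>T y' = - T y\<close>)
  have "norm2 (T a - T y) \<le> dist_fun a y"
    using norm2_diff_le_dist_fun[OF T[OF a] T[OF y]] iso[OF a y] by simp
  then have 1: "(norm2 (T a - T y))\<^sup>2 \<le> (dist_fun a y)\<^sup>2"
    by (rule power_mono) (simp add: norm2_nonneg HR_diff T a y)
  have "norm2 (T a + T y) \<le> dist_fun a y'"
    using norm2_diff_le_dist_fun[OF T[OF a] T[OF y']] iso[OF a y'] by (simp add: \<open>T y' = - T y\<close>)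
  then have 2: "(norm2 (T a + T y))\<^sup>2 \<le> (dist_fun a y')\<^sup>2"
    by (rule power_mono) (simp add: norm2_nonneg HR_add T a y)
  show ?thesis
    unfolding d_\<mu> d_yy' using 1 2 norm2_add_sq[OF T[OF a] T[OF y]] norm2_diff_sq[OF T[OF a] T[OF y]]
    by (simp add: power_mult_distrib)
qed

section \<open>Comparison of \<open>dist_fun\<close> with the Hilbert space metric\<close>

text \<open>After moving \<open>y\<close> to 0, e^w - 1 is the difference of exponentials multiplied
  on both sides by e^(-y/2). The constant 4 combines the 2 of \<open>hs_norm_log_le\<close> with the
  2 in \<open>norm2_le\<close>.\<close>

lemma dist_fun_le_exp_diff:
  assumes a: "a \<in> HR" and y: "y \<in> HR"
    and small: "exp (norm (hs_part y)) * hs_norm (exp (hs_part a) - exp (hs_part y)) \<le> 1 / 2"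
  shows "dist_fun a y \<le> 4 * exp (norm (hs_part y)) * hs_norm (exp (hs_part a) - exp (hs_part y))
    + \<bar>scalar_part a - scalar_part y\<bar>"
proof -
  let ?a = "hs_part a" and ?y = "hs_part y"
  note ha = hs_part_sa_hs[OF a] and hhy = hs_part_sa_hs[OF y]
  have hy: "- (y /\<^sub>R 2) \<in> HR"
    by (intro HR_intros y)
  define w where "w = conj_log (- (y /\<^sub>R 2)) a"
  have w: "w \<in> HR"
    unfolding w_def by (rule conj_log_HR[OF hy a])
  have dist: "dist_fun a y = norm2 w"
    unfolding w_def by (rule dist_fun_alt[OF a y])
  have parts: "hs_part (- (y /\<^sub>R 2)) = - (?y /\<^sub>R 2)" "scalar_part (- (y /\<^sub>R 2)) = - (scalar_part y / 2)"
    using parts_minus[OF HR_scaleR[OF y]] parts_scaleR[OF y] by simp_all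
  have sw: "scalar_part w = scalar_part a - scalar_part y"
    unfolding w_def scalar_part_conj_log[OF hy a] parts by simp
  have "exp (hs_part w) = exp (- (?y /\<^sub>R 2)) * exp ?a * exp (- (?y /\<^sub>R 2))"
    unfolding w_def exp_hs_part_conj_log[OF hy a] parts ..
  moreover have "exp (- (?y /\<^sub>R 2)) * exp ?y * exp (- (?y /\<^sub>R 2)) = 1"
    unfolding exp_half(1)[of ?y, symmetric] by (simp add: mult.assoc)
  ultimately have ew: "exp (hs_part w) - 1 = exp (- (?y /\<^sub>R 2)) * (exp ?a - exp ?y) * exp (- (?y /\<^sub>R 2))"
    by (simp add: left_diff_distrib right_diff_distrib)
  have hs: "hilbert_schmidt (exp ?a - exp ?y)"
    by (rule hs_exp_diff(1)[OF ha hhy, of "max (norm ?a) (norm ?y)"]) auto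
  have ne: "norm (exp (- (?y /\<^sub>R 2))) \<le> exp (norm ?y / 2)"
    using norm_exp[of "- (?y /\<^sub>R 2)"] by simp
  have "hs_norm (exp (hs_part w) - 1) \<le> hs_norm (exp (- (?y /\<^sub>R 2)) * (exp ?a - exp ?y)) * norm (exp (- (?y /\<^sub>R 2)))"
    unfolding ew by (intro hs_norm_mult_right hilbert_schmidt_mult_left hs)
  also have "\<dots> \<le> (exp (norm ?y / 2) * hs_norm (exp ?a - exp ?y)) * exp (norm ?y / 2)"
  proof (rule mult_mono)
    show "hs_norm (exp (- (?y /\<^sub>R 2)) * (exp ?a - exp ?y)) \<le> exp (norm ?y / 2) * hs_norm (exp ?a - exp ?y)"
      using hs_norm_mult_left[OF hs] mult_right_mono[OF ne hs_norm_nonneg] by (rule order_trans)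
  qed (use ne in auto)
  also have "\<dots> = exp (norm ?y) * hs_norm (exp ?a - exp ?y)"
  proof -
    have "exp (norm ?y) = exp (norm ?y / 2) * exp (norm ?y / 2)"
      by (simp flip: exp_add)
    then show ?thesis
      by (simp add: mult_ac)
  qed
  finally have le: "hs_norm (exp (hs_part w) - 1) \<le> exp (norm ?y) * hs_norm (exp ?a - exp ?y)" .
  then have "hs_norm (hs_part w) \<le> 2 * hs_norm (exp (hs_part w) - 1)"
    using small by (intro hs_norm_log_le hs_part_sa_hs w) linarith
  then show ?thesis
    unfolding dist using norm2_le[OF w] le by (simp add: sw)
qed

lemma dist_fun_le_norm2:
  assumes y: "y \<in> HR"
  obtains C where "0 < C" "\<And>a. a \<in> HR \<Longrightarrow> C * norm2 (a - y) \<le> 1 \<Longrightarrow> dist_fun a y \<le> C * norm2 (a - y)"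
proof -
  let ?y = "hs_part y"
  define R where "R = norm ?y + 1"
  \<comment> \<open>Large enough that \<open>C * norm2 (a - y) \<le> 1\<close> keeps
    \<open>a\<close> in the ball of radius \<open>R\<close> and meets the smallness condition of
    \<open>dist_fun_le_exp_diff\<close>; the summand 1 pays for the scalar parts.\<close>
  define C where "C = 4 * exp R * exp R + 1"
  have R: "0 \<le> R"
    by (simp add: R_def)
  have e1: "1 \<le> exp R * exp R"
    using R by (simp flip: exp_add)
  show thesis
  proof (rule that)
    show "0 < C"
      using e1 by (simp add: C_def)
    fix a :: "'a bop"
    assume a: "a \<in> HR" and small: "C * norm2 (a - y) \<le> 1"
    let ?a = "hs_part a" and ?n = "norm2 (a - y)"
    note ha = hs_part_sa_hs[OF a] and hhy = hs_part_sa_hs[OF y]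
    have n0: "0 \<le> ?n"
      by (rule norm2_nonneg[OF HR_diff[OF a y]])
    have C_n: "C * ?n = 4 * (exp R * exp R * ?n) + ?n" "?n \<le> exp R * exp R * ?n"
      using mult_right_mono[OF e1 n0] by (simp_all add: C_def algebra_simps)
    have hs_le: "hs_norm (?a - ?y) \<le> ?n / 2"
      using hs_norm_le_norm2[OF HR_diff[OF a y]] parts_diff[OF a y] by simp
    have "norm (?a - ?y) \<le> hs_norm (?a - ?y)"
      by (intro norm_le_hs_norm hilbert_schmidt_diff sa_hsD(1) ha hhy)
    then have "norm ?a \<le> R"
      using norm_triangle_ineq2[of ?a ?y] hs_le C_n small n0 unfolding R_def by linarith
    then have "hs_norm (exp ?a - exp ?y) \<le> exp R * hs_norm (?a - ?y)"
      by (intro hs_exp_diff(2) ha hhy) (auto simp: R_def)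
    also have "\<dots> \<le> exp R * (?n / 2)"
      by (rule mult_left_mono[OF hs_le]) simp
    finally have "exp (norm ?y) * hs_norm (exp ?a - exp ?y) \<le> exp R * (exp R * (?n / 2))"
      by (intro mult_mono) (auto simp: R_def)
    then have le: "exp (norm ?y) * hs_norm (exp ?a - exp ?y) \<le> exp R * exp R * ?n / 2"
      by simp
    moreover have "exp R * exp R * ?n / 2 \<le> 1 / 2"
      using C_n small n0 by linarith
    ultimately have "dist_fun a y \<le> 4 * exp (norm ?y) * hs_norm (exp ?a - exp ?y) + \<bar>scalar_part a - scalar_part y\<bar>"
      by (intro dist_fun_le_exp_diff a y) linarith
    moreover have "\<bar>scalar_part a - scalar_part y\<bar> \<le> ?n"
      using scalar_part_le_norm2[OF HR_diff[OF a y]] parts_diff[OF a y] by simp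
    ultimately show "dist_fun a y \<le> C * ?n"
      using le C_n n0 by linarith
  qed
qed

lemma dist_fun_tendsto_0:
  assumes X: "\<And>n. X n \<in> HR" and y: "y \<in> HR" and lim: "(\<lambda>n. norm2 (X n - y)) \<longlonglongrightarrow> 0"
  shows "(\<lambda>n. dist_fun (X n) y) \<longlonglongrightarrow> 0"
proof -
  obtain C where C: "0 < C" "\<And>a. a \<in> HR \<Longrightarrow> C * norm2 (a - y) \<le> 1 \<Longrightarrow> dist_fun a y \<le> C * norm2 (a - y)"
    using dist_fun_le_norm2[OF y] by blast
  have lim': "(\<lambda>n. C * norm2 (X n - y)) \<longlonglongrightarrow> 0"
    using tendsto_mult_left[OF lim, of C] by simp
  then have "\<forall>\<^sub>F n in sequentially. C * norm2 (X n - y) < 1"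
    by (rule order_tendstoD) simp
  then have "\<forall>\<^sub>F n in sequentially. dist_fun (X n) y \<le> C * norm2 (X n - y)"
    by eventually_elim (use C X in \<open>simp add: less_imp_le\<close>)
  then show ?thesis
    using dist_fun_nonneg[OF X y] by (intro tendsto_sandwich[OF _ _ tendsto_const lim']) auto
qed

lemma HR_complete:
  assumes X: "\<And>n. X n \<in> HR"
    and Cauchy: "\<And>d. d > 0 \<Longrightarrow> \<exists>N. \<forall>j\<ge>N. \<forall>k\<ge>N. norm2 (X j - X k) < d"
  obtains z where "z \<in> HR" "(\<lambda>n. norm2 (X n - z)) \<longlonglongrightarrow> 0" "X \<longlonglongrightarrow> z"
proof -
  note hX = hs_part_sa_hs[OF X]
  have le: "2 * hs_norm (hs_part (X j) - hs_part (X k)) \<le> norm2 (X j - X k)"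
      "\<bar>scalar_part (X j) - scalar_part (X k)\<bar> \<le> norm2 (X j - X k)" for j k
    using hs_norm_le_norm2[OF HR_diff[OF X X], of j k] scalar_part_le_norm2[OF HR_diff[OF X X], of j k]
      parts_diff[OF X X, of j k] by simp_all
  obtain A where A: "hilbert_schmidt A" "(\<lambda>n. hs_norm (hs_part (X n) - A)) \<longlonglongrightarrow> 0" "(\<lambda>n. hs_part (X n)) \<longlonglongrightarrow> A"
  proof (rule hs_complete[of "\<lambda>n. hs_part (X n)"])
    fix d :: real
    assume "d > 0"
    then obtain N where N: "\<And>j k. j \<ge> N \<Longrightarrow> k \<ge> N \<Longrightarrow> norm2 (X j - X k) < d"
      using Cauchy by blast
    have "hs_norm (hs_part (X j) - hs_part (X k)) < d" if "j \<ge> N" "k \<ge> N" for j k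
      using le(1)[of j k] N[OF that] hs_norm_nonneg[of "hs_part (X j) - hs_part (X k)"] by linarith
    then show "\<exists>N. \<forall>j\<ge>N. \<forall>k\<ge>N. hs_norm (hs_part (X j) - hs_part (X k)) < d"
      by blast
  qed (use hX sa_hsD(1) in auto)
  have "(\<lambda>n. adj (hs_part (X n))) \<longlonglongrightarrow> adj A"
    by (rule bounded_linear.tendsto[OF bounded_linear_adj A(3)])
  then have "adj A = A"
    using A(3) by (simp add: sa_hsD(2)[OF hX] LIMSEQ_unique)
  with A(1) have A_sa: "A \<in> sa_hs"
    by (simp add: sa_hs_def)
  have "Cauchy (\<lambda>n. scalar_part (X n))"
    unfolding Cauchy_def dist_real_def using Cauchy le(2) by (meson le_less_trans)
  then obtain r where r: "(\<lambda>n. scalar_part (X n)) \<longlonglongrightarrow> r"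
    using Cauchy_convergent convergent_def by blast
  define z where "z = A + of_real r"
  have z: "z \<in> HR"
    unfolding z_def by (rule HR_I[OF A_sa])
  have bound: "norm2 (X n - z) \<le> 2 * hs_norm (hs_part (X n) - A) + \<bar>scalar_part (X n) - r\<bar>" for n
    using norm2_le[OF HR_diff[OF X z], of n] parts_diff[OF X z, of n] parts_of_HR[OF A_sa, of r] by (simp add: z_def)
  have "(\<lambda>n. 2 * hs_norm (hs_part (X n) - A) + \<bar>scalar_part (X n) - r\<bar>) \<longlonglongrightarrow> 2 * 0 + \<bar>r - r\<bar>"
    by (intro tendsto_intros A r)
  then have up: "(\<lambda>n. 2 * hs_norm (hs_part (X n) - A) + \<bar>scalar_part (X n) - r\<bar>) \<longlonglongrightarrow> 0"
    by simp
  have "(\<lambda>n. norm2 (X n - z)) \<longlonglongrightarrow> 0"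
    by (rule tendsto_sandwich[OF _ _ tendsto_const up]) (auto simp: bound norm2_nonneg HR_diff X z)
  moreover have "(\<lambda>n. hs_part (X n) + of_real (scalar_part (X n))) \<longlonglongrightarrow> A + of_real r"
    by (intro tendsto_intros A r)
  then have "X \<longlonglongrightarrow> z"
    by (simp add: z_def flip: HR_decompose[OF X])
  ultimately show thesis
    using z that by blast
qed

section \<open>The topology of \<open>HR\<close>\<close>

text \<open>
  \<^locale>\<open>Metric_space\<close> asks for symmetry and nonnegativity outside of the carrier, too, hence the junk values
  of \<^const>\<open>norm2\<close> outside of \<^const>\<open>HR\<close> have to be determined.
\<close>

lemma trace_op_mult_adj:
  "trace_op (A * adj A) = of_real (if hilbert_schmidt A then (hs_norm A)\<^sup>2 else 0)"
proof -
  define E where "E = (SOME E :: 'a set. is_onb E)"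
  have E: "is_onb E"
    unfolding E_def using ex_onb by (rule someI_ex)
  have "cinner e (bop_apply (A * adj A) e) = of_real ((norm (bop_apply (adj A) e))\<^sup>2)" for e
    using cinner_adj_left[of A e "bop_apply (adj A) e"] by (simp add: cinner_self)
  then have trace: "trace_op (A * adj A) = (\<Sum>\<^sub>\<infinity>e\<in>E. of_real ((norm (bop_apply (adj A) e))\<^sup>2))"
    by (simp only: trace_op_def Let_def flip: E_def)
  show ?thesis
  proof (cases "hilbert_schmidt A")
    case True
    have "((\<lambda>e. complex_of_real ((norm (bop_apply (adj A) e))\<^sup>2)) has_sum of_real ((hs_norm (adj A))\<^sup>2)) E"
      by (rule has_sum_of_real[OF hs_norm_has_sum[OF hilbert_schmidt_adj[OF True] E]])
    from infsumI[OF this] show ?thesis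
      unfolding trace hs_norm_adj[OF True] using True by (simp only: if_True)
  next
    case False
    have "\<not> (\<lambda>e. of_real ((norm (bop_apply (adj A) e))\<^sup>2) :: complex) summable_on E"
    proof
      assume "(\<lambda>e. of_real ((norm (bop_apply (adj A) e))\<^sup>2) :: complex) summable_on E"
      then have "(\<lambda>e. Re (of_real ((norm (bop_apply (adj A) e))\<^sup>2))) summable_on E"
        by (rule summable_on_bounded_linear[OF bounded_linear_Re])
      then have "(\<lambda>e. (norm (bop_apply (adj A) e))\<^sup>2) summable_on E"
        by (simp only: Re_complex_of_real)
      then have "hilbert_schmidt (adj A)"
        using E hilbert_schmidt_def by blast
      then show False
        using False hilbert_schmidt_adj[of "adj A"] by simp
    qed
    with False show ?thesis
      unfolding trace by (simp add: infsum_not_exists)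
  qed
qed

lemma inner2_self_any:
  "inner2 x x = 4 * (if hilbert_schmidt (hs_part x) then (hs_norm (hs_part x))\<^sup>2 else 0) + (scalar_part x)\<^sup>2"
  unfolding inner2_def trace_op_mult_adj by (simp add: power2_eq_square)

lemma norm2_minus_any: "norm2 (- x) = norm2 x"
proof (cases "\<exists>r. hilbert_schmidt (x - of_real r)")
  case True
  then obtain r where r: "hilbert_schmidt (x - of_real r)"
    by blast
  define a where "a = x - of_real r"
  have "x = a + of_real r" "- x = - a + of_real (- r)"
    by (simp_all add: a_def)
  moreover have "hilbert_schmidt a"
    using r by (simp add: a_def)
  moreover from this have "hilbert_schmidt (- a)"
    by (rule hilbert_schmidt_minus)
  ultimately have "scalar_part x = r" "scalar_part (- x) = - r" "hs_part x = a" "hs_part (- x) = - a"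
    using scalar_part_eq hs_part_eq by metis+
  then show ?thesis
    using \<open>hilbert_schmidt a\<close> \<open>hilbert_schmidt (- a)\<close> by (simp add: norm2_def inner2_self_any hs_norm_minus)
next
  case False
  have False': "\<not> hilbert_schmidt (- x - of_real r)" for r
  proof
    assume "hilbert_schmidt (- x - of_real r)"
    from hilbert_schmidt_minus[OF this] have "hilbert_schmidt (x - of_real (- r))"
      by (simp add: add.commute)
    with False show False
      by blast
  qed
  \<comment> \<open>Both descriptions range over an everywhere false predicate, so they denote the
    same default value.\<close>
  have "scalar_part x = scalar_part (- x)"
    unfolding scalar_part_def using False False' by simp
  moreover have "\<not> hilbert_schmidt (hs_part x)" "\<not> hilbert_schmidt (hs_part (- x))"
    using False False' by (auto simp: hs_part_def)
  ultimately show ?thesis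
    by (simp add: norm2_def inner2_self_any)
qed

lemma Metric_space_HR: "Metric_space (HR :: 'h::infdim_separable_hilbert bop set) (\<lambda>x y. norm2 (x - y))"
proof
  fix x y z :: "'h bop"
  show "0 \<le> norm2 (x - y)"
    by (simp add: norm2_def inner2_self_any)
  show "norm2 (x - y) = norm2 (y - x)"
    using norm2_minus_any[of "x - y"] by simp
  show "x \<in> HR \<Longrightarrow> y \<in> HR \<Longrightarrow> (norm2 (x - y) = 0) = (x = y)"
    using norm2_eq_0[of "x - y"] HR_diff[of x y] by auto
  show "x \<in> HR \<Longrightarrow> y \<in> HR \<Longrightarrow> z \<in> HR \<Longrightarrow> norm2 (x - z) \<le> norm2 (x - y) + norm2 (y - z)"
    by (rule norm2_diff_triangle)
qed

lemma closedin_topology2_limit: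
  assumes "closedin topology2 m" "\<And>n. X n \<in> m" "z \<in> HR" "(\<lambda>n. norm2 (X n - z)) \<longlonglongrightarrow> 0"
  shows "z \<in> m"
proof -
  interpret HR: Metric_space "HR :: 'a bop set" "\<lambda>x y. norm2 (x - y)"
    by (rule Metric_space_HR)
  have m: "m \<subseteq> HR" "\<And>\<sigma> l. range \<sigma> \<subseteq> m \<Longrightarrow> limitin HR.mtopology \<sigma> l sequentially \<Longrightarrow> l \<in> m"
    using assms(1) unfolding topology2_def HR.metric_closedin_iff_sequentially_closed by blast+
  have "limitin HR.mtopology X z sequentially"
    unfolding HR.limitin_metric_dist_null using assms m(1) by (auto intro!: always_eventually)
  then show ?thesis
    using m(2) assms(2) by blast
qed

section \<open>Second-order Taylor estimate for the exponential\<close>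

text \<open>Summed over \<open>i < n\<close>, these terms are the derivative of the n-th power at
  \<open>w\<close> in the direction \<open>K\<close>.\<close>

definition power_deriv :: "'a::ring_1 \<Rightarrow> 'a \<Rightarrow> nat \<Rightarrow> nat \<Rightarrow> 'a" where
  "power_deriv w K n i = w ^ i * K * w ^ (n - Suc i)"

lemma sum_power_deriv_Suc:
  fixes w K :: "'a::ring_1"
  shows "sum (power_deriv w K (Suc n)) {..<Suc n} = sum (power_deriv w K n) {..<n} * w + w ^ n * K"
proof -
  have "power_deriv w K (Suc n) i = power_deriv w K n i * w" if "i < n" for i
  proof -
    have "Suc n - Suc i = Suc (n - Suc i)"
      using that by simp
    then show ?thesis
      by (simp only: power_deriv_def power_Suc2 mult.assoc)
  qed
  then have "sum (power_deriv w K (Suc n)) {..<n} = sum (power_deriv w K n) {..<n} * w"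
    by (simp add: sum_distrib_right)
  then show ?thesis
    by (simp add: power_deriv_def)
qed

context
  fixes w K :: "'h::infdim_separable_hilbert bop" and r :: real
  assumes r: "1 \<le> r" "norm w + norm K \<le> r"
begin

lemma norm_power_le: "norm (w ^ n) \<le> r ^ n"
proof -
  have "norm (w ^ n) \<le> norm w ^ n"
    by (rule norm_power_ineq)
  also have "\<dots> \<le> r ^ n"
    using r norm_ge_zero[of K] by (intro power_mono norm_ge_zero) linarith
  finally show ?thesis .
qed

text \<open>The spare factor \<open>r\<close> gives both summands of the recursions in
  \<open>n\<close> the common power r^(n+1).\<close>

lemma norm_power_le': "norm (w ^ n) \<le> r ^ n * r"
proof -
  have "r ^ n * 1 \<le> r ^ n * r"
    using r(1) by (intro mult_left_mono) auto
  then show ?thesis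
    using norm_power_le[of n] by linarith
qed

lemma norm_add_power_diff_le: "norm ((w + K) ^ n - w ^ n) \<le> real n * r ^ n * norm K"
proof (induction n)
  case (Suc n)
  have "(w + K) ^ Suc n - w ^ Suc n = ((w + K) ^ n - w ^ n) * (w + K) + w ^ n * K"
    by (simp add: power_Suc2 algebra_simps del: power_Suc)
  also have "norm \<dots> \<le> norm ((w + K) ^ n - w ^ n) * norm (w + K) + norm (w ^ n) * norm K"
    by (meson add_mono norm_mult_ineq norm_triangle_le)
  also have "\<dots> \<le> (real n * r ^ n * norm K) * r + (r ^ n * r) * norm K"
  proof (intro add_mono mult_mono Suc)
    show "norm (w + K) \<le> r"
      using norm_triangle_ineq[of w K] r(2) by linarith
    show "norm (w ^ n) \<le> r ^ n * r"
      by (rule norm_power_le')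
  qed (use r in auto)
  finally show ?case
    by (simp add: algebra_simps)
qed simp

lemma power_deriv_sums:
  obtains Y where "(\<lambda>n. sum (power_deriv w K n) {..<n} /\<^sub>R fact n) sums Y"
proof -
  have bound: "norm (sum (power_deriv w K n) {..<n}) \<le> real n * r ^ n * norm K" for n
  proof (induction n)
    case (Suc n)
    have "norm (sum (power_deriv w K (Suc n)) {..<Suc n}) \<le> norm (sum (power_deriv w K n) {..<n}) * norm w + norm (w ^ n) * norm K"
      unfolding sum_power_deriv_Suc by (meson add_mono norm_mult_ineq norm_triangle_le)
    also have "\<dots> \<le> (real n * r ^ n * norm K) * r + (r ^ n * r) * norm K"
    proof (intro add_mono mult_mono Suc)
      show "norm w \<le> r"
        using norm_ge_zero[of K] r(2) by linarith
      show "norm (w ^ n) \<le> r ^ n * r"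
      by (rule norm_power_le')
    qed (use r in auto)
    finally show ?case
      by (simp add: algebra_simps)
  qed simp
  have "summable (\<lambda>n. norm K * ((2 * r) ^ n /\<^sub>R fact n))"
    by (intro summable_mult summable_exp_generic)
  then have "summable (\<lambda>n. sum (power_deriv w K n) {..<n} /\<^sub>R fact n)"
  proof (rule summable_comparison_test[rotated], intro exI allI impI)
    fix n
    \<comment> \<open>Bounding n by 2^n turns the majorant into the exponential series at
      2r.\<close>
    have "real n * r ^ n \<le> 2 ^ n * r ^ n"
      using r(1) by (intro mult_right_mono) (auto intro: less_imp_le of_nat_less_two_power)
    then have "real n * r ^ n * norm K \<le> (2 * r) ^ n * norm K"
      by (simp add: power_mult_distrib mult_right_mono)
    with bound[of n] have "norm (sum (power_deriv w K n) {..<n}) \<le> (2 * r) ^ n * norm K"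
      by linarith
    then show "norm (sum (power_deriv w K n) {..<n} /\<^sub>R fact n) \<le> norm K * ((2 * r) ^ n /\<^sub>R fact n)"
      by (simp add: divide_right_mono mult.commute flip: divide_inverse_commute)
  qed
  then show thesis
    using that summable_sums by blast
qed

text \<open>The remainders satisfy R(n+1) = R(n) w + ((w + K)^n - w^n) K. The last product is
  quadratic in \<open>K\<close>: its first factor is small in operator norm, its second in
  Hilbert-Schmidt norm.\<close>

lemma hs_power_remainder:
  assumes K: "hilbert_schmidt K"
  shows "hilbert_schmidt ((w + K) ^ n - w ^ n - sum (power_deriv w K n) {..<n})
    \<and> hs_norm ((w + K) ^ n - w ^ n - sum (power_deriv w K n) {..<n}) \<le> (real n)\<^sup>2 * r ^ n * (norm K * hs_norm K)"
proof (induction n)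
  case (Suc n)
  define R where "R = (w + K) ^ n - w ^ n - sum (power_deriv w K n) {..<n}"
  define P where "P = (w + K) ^ n - w ^ n"
  have R: "hilbert_schmidt R" "hs_norm R \<le> (real n)\<^sup>2 * r ^ n * (norm K * hs_norm K)"
    using Suc by (simp_all add: R_def)
  have eq: "(w + K) ^ Suc n - w ^ Suc n - sum (power_deriv w K (Suc n)) {..<Suc n} = R * w + P * K"
    unfolding sum_power_deriv_Suc by (simp add: R_def P_def power_Suc2 algebra_simps del: power_Suc)
  have "hs_norm (R * w + P * K) \<le> hs_norm R * norm w + norm P * hs_norm K"
    by (rule order_trans[OF hs_norm_triangle])
      (intro add_mono hs_norm_mult_left hs_norm_mult_right hilbert_schmidt_intros R K)+
  also have "\<dots> \<le> ((real n)\<^sup>2 * r ^ n * (norm K * hs_norm K)) * r + (real n * (r ^ n * r) * norm K) * hs_norm K"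
  proof (intro add_mono mult_mono R)
    show "norm w \<le> r"
      using norm_ge_zero[of K] r(2) by linarith
    have "real n * r ^ n * norm K \<le> real n * (r ^ n * r) * norm K"
      using r(1) by (intro mult_right_mono mult_left_mono) auto
    then show "norm P \<le> real n * (r ^ n * r) * norm K"
      unfolding P_def using norm_add_power_diff_le[of n] by linarith
  qed (use r in auto)
  also have "\<dots> = ((real n)\<^sup>2 + real n) * (r ^ Suc n * (norm K * hs_norm K))"
    by (simp add: algebra_simps)
  also have "\<dots> \<le> (real (Suc n))\<^sup>2 * (r ^ Suc n * (norm K * hs_norm K))"
    using r(1) by (intro mult_right_mono) (auto simp: power2_eq_square algebra_simps)
  finally show ?case
    unfolding eq using R K by (simp add: hilbert_schmidt_intros mult.assoc)
qed simp

lemma hs_exp_taylor: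
  assumes K: "hilbert_schmidt K" and Y: "(\<lambda>n. sum (power_deriv w K n) {..<n} /\<^sub>R fact n) sums Y"
  shows "hilbert_schmidt (exp (w + K) - exp w - Y)"
    "hs_norm (exp (w + K) - exp w - Y) \<le> exp (4 * r) * (norm K * hs_norm K)"
proof -
  define R where "R n = ((w + K) ^ n - w ^ n - sum (power_deriv w K n) {..<n}) /\<^sub>R fact n" for n
  have "(\<lambda>n. (w + K) ^ n /\<^sub>R fact n - w ^ n /\<^sub>R fact n - sum (power_deriv w K n) {..<n} /\<^sub>R fact n) sums (exp (w + K) - exp w - Y)"
    by (intro sums_diff exp_converges Y)
  then have sums: "R sums (exp (w + K) - exp w - Y)"
    by (simp add: R_def[abs_def] scaleR_diff_right)
  have hsR: "hilbert_schmidt (R n)" for n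
    unfolding R_def using hs_power_remainder[OF K] by (intro hilbert_schmidt_scaleR) blast
  have leR: "hs_norm (R n) \<le> ((4 * r) ^ n /\<^sub>R fact n) * (norm K * hs_norm K)" for n
  proof -
    \<comment> \<open>Absorbing n^2 into 4^n is the origin of the constant
      \<open>exp (4 * r)\<close>.\<close>
    have "(real n)\<^sup>2 \<le> (2 ^ n)\<^sup>2"
      by (intro power_mono) (auto intro: less_imp_le of_nat_less_two_power)
    then have "(real n)\<^sup>2 \<le> 4 ^ n"
      by (simp flip: power_mult_distrib add: power2_eq_square)
    then have "(real n)\<^sup>2 * r ^ n * (norm K * hs_norm K) \<le> 4 ^ n * r ^ n * (norm K * hs_norm K)"
      using r(1) by (intro mult_right_mono) auto
    moreover have "hs_norm (R n) = hs_norm ((w + K) ^ n - w ^ n - sum (power_deriv w K n) {..<n}) / fact n"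
      unfolding R_def using hs_power_remainder[OF K] by (simp add: hs_norm_scaleR divide_inverse_commute)
    moreover have "hs_norm ((w + K) ^ n - w ^ n - sum (power_deriv w K n) {..<n}) \<le> (real n)\<^sup>2 * r ^ n * (norm K * hs_norm K)"
      using hs_power_remainder[OF K] by blast
    ultimately have "hs_norm (R n) \<le> (4 ^ n * r ^ n * (norm K * hs_norm K)) / fact n"
      by (simp add: divide_right_mono)
    then show ?thesis
      by (simp add: power_mult_distrib divide_inverse mult_ac)
  qed
  have "(\<lambda>n. ((4 * r) ^ n /\<^sub>R fact n) * (norm K * hs_norm K)) sums (exp (4 * r) * (norm K * hs_norm K))"
    by (intro sums_mult2 exp_converges)
  from hs_norm_sums_le[OF sums hsR leR this]
  show "hilbert_schmidt (exp (w + K) - exp w - Y)"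
    "hs_norm (exp (w + K) - exp w - Y) \<le> exp (4 * r) * (norm K * hs_norm K)" .
qed

end

definition exp_divdiff :: "real \<Rightarrow> real \<Rightarrow> real" where
  "exp_divdiff a b = (if a = b then exp a else (exp a - exp b) / (a - b))"

lemma exp_divdiff_sums: "(\<lambda>n. (\<Sum>i<n. a ^ i * b ^ (n - Suc i)) /\<^sub>R fact n) sums exp_divdiff a b"
proof (cases "a = b")
  case True
  have sum_eq: "(\<Sum>i<n. a ^ i * a ^ (n - Suc i)) = real n * a ^ (n - 1)" for n
  proof -
    have "(\<Sum>i<n. a ^ i * a ^ (n - Suc i)) = (\<Sum>i<n. a ^ (n - 1))"
      by (rule sum.cong) (auto simp flip: power_add)
    then show ?thesis
      by simp
  qed
  have "(\<Sum>i<Suc n. a ^ i * a ^ (Suc n - Suc i)) /\<^sub>R fact (Suc n) = a ^ n /\<^sub>R fact n" for n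
    unfolding sum_eq by (simp add: divide_simps del: of_nat_Suc)
  then have "(\<lambda>n. (\<Sum>i<Suc n. a ^ i * a ^ (Suc n - Suc i)) /\<^sub>R fact (Suc n)) sums exp a"
    using exp_converges[of a] by (simp only:)
  then have "(\<lambda>n. (\<Sum>i<n. a ^ i * a ^ (n - Suc i)) /\<^sub>R fact n) sums exp a"
    by (subst (asm) sums_Suc_iff) simp
  then show ?thesis
    using True by (simp add: exp_divdiff_def)
next
  case False
  have "(\<Sum>i<n. a ^ i * b ^ (n - Suc i)) = (a ^ n - b ^ n) / (a - b)" for n
    using power_diff_sumr2[of a n b] False by (simp add: mult.commute)
  moreover have "(\<lambda>n. (a ^ n /\<^sub>R fact n - b ^ n /\<^sub>R fact n) / (a - b)) sums ((exp a - exp b) / (a - b))"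
    by (intro sums_divide sums_diff exp_converges)
  ultimately show ?thesis
    using False by (simp add: exp_divdiff_def right_diff_distrib diff_divide_distrib)
qed

lemma power_deriv_entry:
  assumes "eigenbasis w E l" "e \<in> E" "f \<in> E"
  shows "cinner e (bop_apply (sum (power_deriv w K n) {..<n}) f) =
    of_real (\<Sum>i<n. l e ^ i * l f ^ (n - Suc i)) * cinner e (bop_apply K f)"
proof -
  have pow: "eigenbasis (w ^ i) E (\<lambda>e. l e ^ i)" for i
    using assms(1) by (simp add: eigenbasis_def power_eigenvector)
  have "cinner e (bop_apply (power_deriv w K n i) f) = of_real (l e ^ i * l f ^ (n - Suc i)) * cinner e (bop_apply K f)" for i
    using eigenbasis_cinner_left[OF pow assms(2)] eigenbasis_apply[OF pow assms(3)]
    by (simp add: power_deriv_def cinner_simps)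
  moreover have "bop_apply (sum g A) f = (\<Sum>i\<in>A. bop_apply (g i) f)" for g :: "nat \<Rightarrow> 'a bop" and A
    by (induction A rule: infinite_finite_induct) auto
  ultimately show ?thesis
    by (simp only: cinner_sum_right of_real_sum sum_distrib_right)
qed

text \<open>The Daleckii-Krein formula: in an eigenbasis the derivative of exp multiplies each entry
  by a divided difference of exp.\<close>

lemma exp_deriv_entry:
  assumes E: "eigenbasis w E l" "e \<in> E" "f \<in> E"
    and Y: "(\<lambda>n. sum (power_deriv w K n) {..<n} /\<^sub>R fact n) sums Y"
  shows "cinner e (bop_apply Y f) = of_real (exp_divdiff (l e) (l f)) * cinner e (bop_apply K f)"
proof -
  have "bounded_linear (\<lambda>A. cinner e (bop_apply A f))"
    by (rule bounded_linear_compose[OF bounded_bilinear.bounded_linear_right[OF bounded_bilinear_cinner] bounded_linear_bop_apply])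
  from bounded_linear.sums[OF this Y]
  have 1: "(\<lambda>n. cinner e (bop_apply (sum (power_deriv w K n) {..<n} /\<^sub>R fact n) f)) sums cinner e (bop_apply Y f)" .
  have "(\<lambda>n. complex_of_real ((\<Sum>i<n. l e ^ i * l f ^ (n - Suc i)) /\<^sub>R fact n) * cinner e (bop_apply K f))
      sums (of_real (exp_divdiff (l e) (l f)) * cinner e (bop_apply K f))"
    by (intro sums_mult2 sums_of_real exp_divdiff_sums)
  moreover have "cinner e (bop_apply (sum (power_deriv w K n) {..<n} /\<^sub>R fact n) f)
      = complex_of_real ((\<Sum>i<n. l e ^ i * l f ^ (n - Suc i)) /\<^sub>R fact n) * cinner e (bop_apply K f)" for n
    using power_deriv_entry[OF E, of K n] by (simp add: cinner_simps)
  ultimately show ?thesis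
    using 1 by (simp only: sums_unique2)
qed

section \<open>The function \<open>u coth (u/2)\<close>\<close>

definition u_coth :: "real \<Rightarrow> real" where
  "u_coth u = (if u = 0 then 2 else u * (exp u + 1) / (exp u - 1))"

lemma u_coth_0 [simp]: "u_coth 0 = 2"
  by (simp add: u_coth_def)

lemma u_coth_minus: "u_coth (- u) = u_coth u"
  by (simp add: u_coth_def exp_minus divide_simps) (simp add: algebra_simps)

text \<open>This identity determines \<open>u_coth\<close>: the right side is the entry multiplier
  of x -> x e^w + e^w x.\<close>

lemma exp_divdiff_mult_u_coth: "exp_divdiff a b * u_coth (a - b) = exp a + exp b"
proof (cases "a = b")
  case False
  then have "exp (a - b) \<noteq> 1" "exp a \<noteq> exp b"
    by auto
  then show ?thesis
    using False by (simp add: exp_divdiff_def u_coth_def exp_diff divide_simps)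
qed (simp add: exp_divdiff_def)

lemma continuous_u_coth: "continuous_on UNIV u_coth"
  unfolding continuous_on_eq_continuous_at[OF open_UNIV]
proof
  fix x :: real
  show "isCont u_coth x"
  proof (cases "x = 0")
    case True
    have "((\<lambda>u::real. (exp u - 1) / u) \<longlongrightarrow> 1) (at 0)"
      using DERIV_exp[of 0] by (simp add: DERIV_def)
    then have "((\<lambda>u::real. (exp u + 1) / ((exp u - 1) / u)) \<longlongrightarrow> (exp 0 + 1) / 1) (at 0)"
      by (intro tendsto_intros) auto
    moreover have "(exp 0 + 1) / 1 = (2 :: real)"
      by simp
    ultimately have "((\<lambda>u::real. (exp u + 1) / ((exp u - 1) / u)) \<longlongrightarrow> 2) (at 0)"
      by (simp only:)
    then have "(u_coth \<longlongrightarrow> 2) (at 0)"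
      by (rule Lim_transform_eventually) (auto simp: u_coth_def eventually_at_filter mult.commute)
    then show ?thesis
      using True by (simp add: isCont_def)
  next
    case False
    have "isCont (\<lambda>u. u * (exp u + 1) / (exp u - 1)) x"
      using False by (intro continuous_intros) auto
    moreover have ev: "\<forall>\<^sub>F u in nhds x. u_coth u = u * (exp u + 1) / (exp u - 1)"
      using False by (intro eventually_mono[OF t1_space_nhds[of x 0]]) (auto simp: u_coth_def)
    ultimately show ?thesis
      using isCont_cong[OF ev] by simp
  qed
qed

section \<open>Functions of \<open>ad w\<close> on closed Lie triple systems\<close>

lemma spectral_theorem_HR:
  assumes "w \<in> HR"
  obtains E l where "eigenbasis w E l"
proof -
  obtain E l where E: "eigenbasis (hs_part w) E l"
    using spectral_theorem[OF hs_part_sa_hs[OF assms]] by blast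
  have "eigenbasis w E (\<lambda>e. l e + scalar_part w)"
    using eigenbasis_add[OF E eigenbasis_of_real[OF eigenbasis_onb[OF E]]] HR_decompose[OF assms] by metis
  then show thesis
    by (rule that)
qed

text \<open>This is [w, [w, x]], written with the bracketing under which
  \<open>lie_triple_system\<close> is stated.\<close>

definition ad_sq :: "'a::ring \<Rightarrow> 'a \<Rightarrow> 'a" where
  "ad_sq w x = - commutator (commutator w x) w"

lemma ad_sq_mem: "lie_triple_system m \<Longrightarrow> w \<in> m \<Longrightarrow> x \<in> m \<Longrightarrow> ad_sq w x \<in> m"
  unfolding lie_triple_system_def ad_sq_def using subspace_neg by blast

lemma ad_sq_entry:
  assumes "eigenbasis w E l" "e \<in> E" "f \<in> E"
  shows "cinner e (bop_apply (ad_sq w x) f) = of_real ((l e - l f)\<^sup>2) * cinner e (bop_apply x f)"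
  using eigenbasis_cinner_left[OF assms(1,2)] eigenbasis_apply[OF assms(1,3)]
  by (simp add: ad_sq_def commutator_def cinner_simps power2_eq_square algebra_simps)

lemma scalar_part_ad_sq:
  assumes "w \<in> HR" "x \<in> HR"
  shows "scalar_part (ad_sq w x) = 0"
proof -
  obtain a r b s where ab: "a \<in> sa_hs" "b \<in> sa_hs" and wx: "w = a + of_real r" "x = b + of_real s"
    using assms by (metis HR_E)
  have eq: "ad_sq w x = ad_sq a b"
    unfolding wx by (simp add: ad_sq_def commutator_def algebra_simps of_real_def)
  have "hilbert_schmidt (ad_sq a b)"
    unfolding ad_sq_def commutator_def by (intro hilbert_schmidt_intros sa_hsD(1) ab)
  then show ?thesis
    using scalar_part_eq[of "ad_sq a b" 0] eq by simp
qed

text \<open>Each application of \<open>ad_sq w\<close> stays in \<open>m\<close> and multiplies the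
  entry at e, f by the squared difference of eigenvalues. Brackets have no scalar part, so only the
  constant coefficient \<open>p 0\<close> acts on that of \<open>x\<close>.\<close>

lemma ad_polynomial:
  assumes m: "lie_triple_system m" and w: "w \<in> m" and x: "x \<in> m"
    and E: "eigenbasis w E l" and p: "real_polynomial_function p"
  shows "\<exists>k\<in>m. scalar_part k = p 0 * scalar_part x \<and>
    (\<forall>e\<in>E. \<forall>f\<in>E. cinner e (bop_apply k f) = of_real (p ((l e - l f)\<^sup>2)) * cinner e (bop_apply x f))"
proof -
  have sub: "subspace m" "m \<subseteq> HR"
    using m by (auto simp: lie_triple_system_def)
  obtain c N where p: "p = (\<lambda>t. \<Sum>i\<le>N. c i * t ^ i)"
    using p real_polynomial_function_iff_sum by blast
  define X where "X i = (ad_sq w ^^ i) x" for i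
  have X: "X i \<in> m" for i
    unfolding X_def by (induction i) (auto intro: x ad_sq_mem[OF m w])
  have entry_X: "cinner e (bop_apply (X i) f) = of_real (((l e - l f)\<^sup>2) ^ i) * cinner e (bop_apply x f)"
    if "e \<in> E" "f \<in> E" for e f i
    unfolding X_def by (induction i) (simp_all add: ad_sq_entry[OF E that])
  have scalar_X: "scalar_part (X i) = 0 ^ i * scalar_part x" for i
  proof (cases i)
    case (Suc j)
    have "X i = ad_sq w (X j)"
      by (simp add: X_def Suc)
    then show ?thesis
      using scalar_part_ad_sq[of w "X j"] w X sub(2) Suc by auto
  qed (simp add: X_def)
  have "(\<Sum>i\<le>k. c i *\<^sub>R X i) \<in> m \<and> scalar_part (\<Sum>i\<le>k. c i *\<^sub>R X i) = (\<Sum>i\<le>k. c i * 0 ^ i) * scalar_part x \<and>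
      (\<forall>e\<in>E. \<forall>f\<in>E. cinner e (bop_apply (\<Sum>i\<le>k. c i *\<^sub>R X i) f) =
        of_real (\<Sum>i\<le>k. c i * ((l e - l f)\<^sup>2) ^ i) * cinner e (bop_apply x f))" for k
  proof (induction k)
    case 0
    have "X 0 = x"
      by (simp add: X_def)
    then show ?case
      using x sub parts_scaleR[of x "c 0"] by (auto simp: subspace_scale cinner_simps)
  next
    case (Suc k)
    have 1: "c (Suc k) *\<^sub>R X (Suc k) \<in> m"
      using X sub(1) by (simp add: subspace_scale)
    have "scalar_part (c (Suc k) *\<^sub>R X (Suc k)) = c (Suc k) * 0 ^ Suc k * scalar_part x"
      using parts_scaleR[of "X (Suc k)"] X sub(2) scalar_X[of "Suc k"] by (auto simp del: power_Suc)
    then show ?case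
      using Suc 1 sub parts_add[of "\<Sum>i\<le>k. c i *\<^sub>R X i" "c (Suc k) *\<^sub>R X (Suc k)"]
      by (auto simp: subspace_add cinner_simps entry_X distrib_right simp del: power_Suc)
  qed
  then show ?thesis
    unfolding p by blast
qed

text \<open>A scalar operator has diagonal entries only, and there the multiplier is
  \<open>\<phi> 0\<close>; removing the scalar parts therefore respects the multiplier.\<close>

lemma hs_part_entry:
  assumes E: "eigenbasis w E l" "e \<in> E" "f \<in> E" and k: "k \<in> HR" and x: "x \<in> HR"
    and scalar: "scalar_part k = \<phi> 0 * scalar_part x"
    and entry: "cinner e (bop_apply k f) = of_real (\<phi> ((l e - l f)\<^sup>2)) * cinner e (bop_apply x f)"
  shows "cinner e (bop_apply (hs_part k) f) = of_real (\<phi> ((l e - l f)\<^sup>2)) * cinner e (bop_apply (hs_part x) f)"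
proof -
  have "cinner e f = (if e = f then 1 else 0)"
    using is_onb_orthonormal[OF eigenbasis_onb[OF E(1)]] E(2,3) by (simp add: orthonormal_def)
  then show ?thesis
    unfolding hs_part_def using entry scalar by (auto simp: cinner_simps algebra_simps)
qed

text \<open>The sequential form of closedness in \<open>topology2\<close>, as the approximation
  arguments consume it.\<close>

definition closed2 :: "'h::infdim_separable_hilbert bop set \<Rightarrow> bool" where
  "closed2 m \<longleftrightarrow> (\<forall>X z. (\<forall>n. X n \<in> m) \<longrightarrow> z \<in> HR \<longrightarrow> (\<lambda>n. norm2 (X n - z)) \<longlonglongrightarrow> 0 \<longrightarrow> z \<in> m)"

text \<open>Approximate the multiplier uniformly by polynomials. By
  \<open>hs_norm_le_entries\<close> and the bound on scalar parts, uniform closeness of multipliers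
  is closeness in \<open>norm2\<close>, so the approximants from \<open>m\<close> converge, and
  \<open>closed2\<close> keeps their limit in \<open>m\<close>.\<close>

lemma ad_functional_calculus:
  assumes m: "lie_triple_system m" "closed2 m" and w: "w \<in> m" and x: "x \<in> m"
    and E: "eigenbasis w E l" and \<phi>: "continuous_on {0..B} \<phi>"
    and B: "\<And>e f. e \<in> E \<Longrightarrow> f \<in> E \<Longrightarrow> (l e - l f)\<^sup>2 \<le> B"
  obtains k where "k \<in> m" "scalar_part k = \<phi> 0 * scalar_part x"
    "\<And>e f. e \<in> E \<Longrightarrow> f \<in> E \<Longrightarrow> cinner e (bop_apply k f) = of_real (\<phi> ((l e - l f)\<^sup>2)) * cinner e (bop_apply x f)"
proof -
  have sub: "subspace m" "m \<subseteq> HR"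
    using m by (auto simp: lie_triple_system_def)
  have xH: "x \<in> HR"
    using x sub by blast
  obtain e0 where "e0 \<in> E"
    using infinite_onb[OF eigenbasis_onb[OF E]] by (metis ex_in_conv finite.emptyI)
  then have "0 \<le> B"
    using B[of e0 e0] by simp
  obtain p where p: "\<And>n. real_polynomial_function (p n)"
      "\<And>n t. t \<in> {0..B} \<Longrightarrow> \<bar>\<phi> t - p n t\<bar> < 1 / Suc n"
    by (rule weierstrass_sequence[OF \<phi>], rule that)
  have "\<forall>n. \<exists>k. k \<in> m \<and> scalar_part k = p n 0 * scalar_part x \<and>
    (\<forall>e\<in>E. \<forall>f\<in>E. cinner e (bop_apply k f) = of_real (p n ((l e - l f)\<^sup>2)) * cinner e (bop_apply x f))"
    using ad_polynomial[OF m(1) w x E p(1)] by blast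
  from choice[OF this] obtain X where
    "\<forall>n. X n \<in> m \<and> scalar_part (X n) = p n 0 * scalar_part x \<and>
    (\<forall>e\<in>E. \<forall>f\<in>E. cinner e (bop_apply (X n) f) = of_real (p n ((l e - l f)\<^sup>2)) * cinner e (bop_apply x f))"
    by blast
  then have X: "\<And>n. X n \<in> m" "\<And>n. scalar_part (X n) = p n 0 * scalar_part x"
    "\<And>n e f. e \<in> E \<Longrightarrow> f \<in> E \<Longrightarrow> cinner e (bop_apply (X n) f) = of_real (p n ((l e - l f)\<^sup>2)) * cinner e (bop_apply x f)"
    by blast+
  have XH: "X n \<in> HR" for n
    using X(1) sub by blast
  define Q where "Q = 2 * hs_norm (hs_part x) + \<bar>scalar_part x\<bar>"
  have Q: "0 \<le> Q"
    by (simp add: Q_def)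
  have dist: "norm2 (X j - X k) \<le> (1 / Suc j + 1 / Suc k) * Q" for j k
  proof -
    let ?\<eta> = "1 / Suc j + 1 / Suc k"
    have p_diff: "\<bar>p j t - p k t\<bar> \<le> ?\<eta>" if "t \<in> {0..B}" for t
      using p(2)[OF that, of j] p(2)[OF that, of k] by linarith
    have "hs_norm (hs_part (X j - X k)) \<le> ?\<eta> * hs_norm (hs_part x)"
    proof (rule hs_norm_le_entries(2)[OF eigenbasis_onb[OF E] eigenbasis_onb[OF E] sa_hsD(1)[OF hs_part_sa_hs[OF xH]]])
      fix e f
      assume ef: "e \<in> E" "f \<in> E"
      have "cinner e (bop_apply (hs_part (X n)) f) = of_real (p n ((l e - l f)\<^sup>2)) * cinner e (bop_apply (hs_part x) f)" for n
        by (rule hs_part_entry[OF E ef XH xH X(2) X(3)[OF ef]])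
      then have "cinner e (bop_apply (hs_part (X j - X k)) f) =
          of_real (p j ((l e - l f)\<^sup>2) - p k ((l e - l f)\<^sup>2)) * cinner e (bop_apply (hs_part x) f)"
        using parts_diff[OF XH XH] by (simp add: cinner_simps left_diff_distrib)
      then have "cmod (cinner e (bop_apply (hs_part (X j - X k)) f)) =
          \<bar>p j ((l e - l f)\<^sup>2) - p k ((l e - l f)\<^sup>2)\<bar> * cmod (cinner e (bop_apply (hs_part x) f))"
        by (simp only: norm_mult norm_of_real)
      also have "\<dots> \<le> ?\<eta> * cmod (cinner e (bop_apply (hs_part x) f))"
        using B[OF ef] by (intro mult_right_mono p_diff) auto
      finally show "cmod (cinner e (bop_apply (hs_part (X j - X k)) f)) \<le> ?\<eta> * cmod (cinner e (bop_apply (hs_part x) f))" .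
    qed simp
    moreover have "\<bar>scalar_part (X j - X k)\<bar> \<le> ?\<eta> * \<bar>scalar_part x\<bar>"
    proof -
      have "scalar_part (X j - X k) = (p j 0 - p k 0) * scalar_part x"
        using parts_diff[OF XH XH] by (simp add: X(2) left_diff_distrib)
      then show ?thesis
        using p_diff[of 0] \<open>0 \<le> B\<close> by (simp only: abs_mult) (intro mult_right_mono, auto)
    qed
    ultimately show ?thesis
      using norm2_le[OF HR_diff[OF XH XH], of j k] by (simp add: Q_def distrib_left)
  qed
  have lim_inv: "(\<lambda>n. 1 / real (Suc n)) \<longlonglongrightarrow> 0"
    using LIMSEQ_inverse_real_of_nat by (simp add: inverse_eq_divide)
  obtain z where z: "z \<in> HR" "(\<lambda>n. norm2 (X n - z)) \<longlonglongrightarrow> 0" "X \<longlonglongrightarrow> z"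
  proof (rule HR_complete[OF XH])
    fix d :: real
    assume "d > 0"
    have "(\<lambda>n. 1 / real (Suc n) * Q) \<longlonglongrightarrow> 0 * Q"
      by (intro tendsto_mult tendsto_const lim_inv)
    then have "\<forall>\<^sub>F n in sequentially. 1 / real (Suc n) * Q < d / 2"
      by (rule order_tendstoD) (use \<open>d > 0\<close> in simp)
    then obtain N where N: "\<And>n. n \<ge> N \<Longrightarrow> 1 / real (Suc n) * Q < d / 2"
      unfolding eventually_sequentially by blast
    have "norm2 (X j - X k) < d" if "j \<ge> N" "k \<ge> N" for j k
      using dist[of j k] N[OF that(1)] N[OF that(2)] unfolding distrib_right by linarith
    then show "\<exists>N. \<forall>j\<ge>N. \<forall>k\<ge>N. norm2 (X j - X k) < d"
      by blast
  qed (use that in blast)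
  have lim_p: "(\<lambda>n. p n t) \<longlonglongrightarrow> \<phi> t" if "t \<in> {0..B}" for t
  proof (rule metric_tendsto_imp_tendsto[OF lim_inv])
    show "\<forall>\<^sub>F n in sequentially. dist (p n t) (\<phi> t) \<le> dist (1 / real (Suc n)) 0"
      using p(2)[OF that] by (intro always_eventually) (auto simp: dist_real_def abs_minus_commute intro: less_imp_le)
  qed
  show thesis
  proof (rule that)
    show "z \<in> m"
      using m(2) X(1) z(1,2) unfolding closed2_def by blast
    have "(\<lambda>n. scalar_part (X n)) \<longlonglongrightarrow> scalar_part z"
    proof (rule metric_tendsto_imp_tendsto[OF z(2)])
      show "\<forall>\<^sub>F n in sequentially. dist (scalar_part (X n)) (scalar_part z) \<le> dist (norm2 (X n - z)) 0"
        using scalar_part_le_norm2[OF HR_diff[OF XH z(1)]] parts_diff[OF XH z(1)] norm2_nonneg[OF HR_diff[OF XH z(1)]]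
        by (intro always_eventually) (auto simp: dist_real_def)
    qed
    moreover have "(\<lambda>n. scalar_part (X n)) \<longlonglongrightarrow> \<phi> 0 * scalar_part x"
      unfolding X(2) using \<open>0 \<le> B\<close> by (intro tendsto_mult lim_p tendsto_const) auto
    ultimately show "scalar_part z = \<phi> 0 * scalar_part x"
      by (rule LIMSEQ_unique)
    fix e f
    assume ef: "e \<in> E" "f \<in> E"
    have "(\<lambda>n. cinner e (bop_apply (X n) f)) \<longlonglongrightarrow> cinner e (bop_apply z f)"
      by (intro tendsto_cinner tendsto_bop_apply tendsto_const z)
    moreover have "(\<lambda>n. cinner e (bop_apply (X n) f)) \<longlonglongrightarrow> of_real (\<phi> ((l e - l f)\<^sup>2)) * cinner e (bop_apply x f)"
      unfolding X(3)[OF ef] using B[OF ef] by (intro tendsto_mult tendsto_of_real lim_p tendsto_const) auto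
    ultimately show "cinner e (bop_apply z f) = of_real (\<phi> ((l e - l f)\<^sup>2)) * cinner e (bop_apply x f)"
      by (rule LIMSEQ_unique)
  qed
qed

section \<open>Closed Lie triple systems are totally geodesic\<close>

lemma hs_exp_taylor_0:
  fixes K :: "'h::infdim_separable_hilbert bop"
  assumes K: "hilbert_schmidt K" and r: "1 \<le> r" "norm K \<le> r"
  shows "hilbert_schmidt (exp K - 1 - K)" "hs_norm (exp K - 1 - K) \<le> exp (4 * r) * (norm K * hs_norm K)"
proof -
  have r': "norm (0 :: 'h bop) + norm K \<le> r"
    using r by simp
  obtain Y where Y: "(\<lambda>n. sum (power_deriv 0 K n) {..<n} /\<^sub>R fact n) sums Y"
    by (rule power_deriv_sums[OF r(1) r'])
  obtain E :: "'h set" where E: "is_onb E"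
    using ex_onb by blast
  then have E0: "eigenbasis 0 E (\<lambda>_. 0)"
    by (simp add: eigenbasis_def)
  \<comment> \<open>For \<open>w = 0\<close> any orthonormal basis is an eigenbasis, and the divided
    difference of exp at 0, 0 is 1.\<close>
  have "Y = K"
    by (rule bop_eqI_onb_entries[OF E E]) (simp add: exp_deriv_entry[OF E0 _ _ Y] exp_divdiff_def)
  then show "hilbert_schmidt (exp K - 1 - K)" "hs_norm (exp K - 1 - K) \<le> exp (4 * r) * (norm K * hs_norm K)"
    using hs_exp_taylor[OF r(1) r' K Y] by simp_all
qed

text \<open>The sum of the error bounds in \<open>hs_exp_one_step\<close>: the Taylor remainder of
  e^(w+sk), the quadratic term (sx) e^w (sx), and two products with the Taylor remainder of e^(sx).
  The radius for the remainders is 1 + 2P.\<close>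

definition step_const :: "real \<Rightarrow> real" where
  "step_const P = exp (4 * (1 + 2 * P)) * P\<^sup>2 + P\<^sup>2 * exp P + 2 * (exp (4 * (1 + 2 * P)) * P\<^sup>2 * (exp P * exp P))"

text \<open>
  In an eigenbasis of \<open>w\<close>, the derivative of \<open>s \<mapsto> e\<^bsup>w + sk\<^esup>\<close> at 0 has the entries \<open>exp_divdiff (l e) (l f) \<cdot> k\<^sub>e\<^sub>f\<close>, so the
  choice of \<open>k\<close> makes it equal to the derivative \<open>x e\<^bsup>w\<^esup> + e\<^bsup>w\<^esup> x\<close> of \<open>s \<mapsto> e\<^bsup>sx\<^esup> e\<^bsup>w\<^esup> e\<^bsup>sx\<^esup>\<close>.
\<close>

lemma hs_exp_one_step:
  fixes w x k :: "'h::infdim_separable_hilbert bop"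
  assumes w: "w \<in> sa_hs" and x: "x \<in> sa_hs" and k: "k \<in> sa_hs" and E: "eigenbasis w E l"
    and entry: "\<And>e f. e \<in> E \<Longrightarrow> f \<in> E \<Longrightarrow>
      cinner e (bop_apply k f) = of_real (u_coth (l e - l f)) * cinner e (bop_apply x f)"
    and P: "norm w \<le> P" "hs_norm x \<le> P" "hs_norm k \<le> P" and s: "0 \<le> s" "s \<le> 1"
  shows "hilbert_schmidt (exp (w + s *\<^sub>R k) - exp (s *\<^sub>R x) * exp w * exp (s *\<^sub>R x))"
    "hs_norm (exp (w + s *\<^sub>R k) - exp (s *\<^sub>R x) * exp w * exp (s *\<^sub>R x)) \<le> step_const P * s\<^sup>2"
proof -
  define r where "r = 1 + 2 * P"
  define F where "F = exp (4 * r)"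
  have P0: "0 \<le> P"
    using P(1) norm_ge_zero order_trans by blast
  have r1: "1 \<le> r"
    using P0 by (simp add: r_def)
  have small: "hilbert_schmidt (s *\<^sub>R z)" "hs_norm (s *\<^sub>R z) \<le> s * P" "norm (s *\<^sub>R z) \<le> s * P" "norm (s *\<^sub>R z) \<le> P"
    if "z \<in> sa_hs" "hs_norm z \<le> P" for z :: "'h bop"
  proof -
    show hs: "hilbert_schmidt (s *\<^sub>R z)"
      by (intro hilbert_schmidt_scaleR sa_hsD that)
    show le: "hs_norm (s *\<^sub>R z) \<le> s * P"
      using that s(1) by (simp add: hs_norm_scaleR sa_hsD mult_left_mono)
    show le': "norm (s *\<^sub>R z) \<le> s * P"
      using norm_le_hs_norm[OF hs] le by linarith
    show "norm (s *\<^sub>R z) \<le> P"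
      using le' mult_right_mono[OF s(2) P0] by simp
  qed
  note sk = small[OF k P(3)] and sx = small[OF x P(2)]
  have r2: "norm w + norm (s *\<^sub>R k) \<le> r" "norm (s *\<^sub>R x) \<le> r"
    using P(1) sk(4) sx(4) P0 unfolding r_def by linarith+
  have prod: "norm (s *\<^sub>R z) * hs_norm (s *\<^sub>R z) \<le> P\<^sup>2 * s\<^sup>2" if "z \<in> sa_hs" "hs_norm z \<le> P" for z :: "'h bop"
    using mult_mono[OF small(3)[OF that] small(2)[OF that]] s(1) P0
    by (simp add: power2_eq_square mult_ac)
  obtain Y where Y: "(\<lambda>n. sum (power_deriv w (s *\<^sub>R k) n) {..<n} /\<^sub>R fact n) sums Y"
    by (rule power_deriv_sums[OF r1 r2(1)])
  have Y_eq: "Y = s *\<^sub>R x * exp w + exp w * s *\<^sub>R x"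
  proof (rule bop_eqI_onb_entries[OF eigenbasis_onb[OF E] eigenbasis_onb[OF E]])
    fix e f
    assume ef: "e \<in> E" "f \<in> E"
    have "cinner e (bop_apply Y f) = of_real (exp_divdiff (l e) (l f) * u_coth (l e - l f)) * (of_real s * cinner e (bop_apply x f))"
      using exp_deriv_entry[OF E ef Y] entry[OF ef] by (simp add: cinner_simps)
    also have "\<dots> = of_real (exp (l e) + exp (l f)) * (of_real s * cinner e (bop_apply x f))"
      by (simp only: exp_divdiff_mult_u_coth)
    also have "\<dots> = cinner e (bop_apply (s *\<^sub>R x * exp w + exp w * s *\<^sub>R x) f)"
      using eigenbasis_cinner_left[OF eigenbasis_exp[OF E] ef(1)] eigenbasis_apply[OF eigenbasis_exp[OF E] ef(2)]
      by (simp add: cinner_simps algebra_simps)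
    finally show "cinner e (bop_apply Y f) = cinner e (bop_apply (s *\<^sub>R x * exp w + exp w * s *\<^sub>R x) f)" .
  qed
  define T where "T = exp (w + s *\<^sub>R k) - exp w - Y"
  have T: "hilbert_schmidt T" "hs_norm T \<le> F * (P\<^sup>2 * s\<^sup>2)"
    unfolding T_def F_def
    by (rule hs_exp_taylor(1)[OF r1 r2(1) sk(1) Y],
        rule order_trans[OF hs_exp_taylor(2)[OF r1 r2(1) sk(1) Y] mult_left_mono[OF prod[OF k P(3)]]]) simp
  define X where "X = exp (s *\<^sub>R x)"
  define Q where "Q = X - 1 - s *\<^sub>R x"
  have Q: "hilbert_schmidt Q" "hs_norm Q \<le> F * (P\<^sup>2 * s\<^sup>2)"
    unfolding Q_def X_def F_def
    by (rule hs_exp_taylor_0(1)[OF sx(1) r1 r2(2)],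
        rule order_trans[OF hs_exp_taylor_0(2)[OF sx(1) r1 r2(2)] mult_left_mono[OF prod[OF x P(2)]]]) simp
  have ne: "norm (exp w) \<le> exp P"
    using norm_exp[of w] P(1) by (meson exp_le_cancel_iff order_trans)
  have nX: "norm X \<le> exp P"
    unfolding X_def using norm_exp[of "s *\<^sub>R x"] sx(4) by (meson exp_le_cancel_iff order_trans)
  have n1: "norm (1 + s *\<^sub>R x) \<le> exp P"
    using norm_triangle_ineq[of 1 "s *\<^sub>R x"] sx(4) exp_ge_add_one_self[of P] norm_one[where 'a = "'h bop"]
    by linarith
  \<comment> \<open>Expanding e^(sx) as 1 + sx + \<open>Q\<close> on both sides of e^w leaves e^w,
    the derivative \<open>Y\<close>, and these three terms of order s^2.\<close>
  define A1 where "A1 = s *\<^sub>R x * exp w * s *\<^sub>R x"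
  define A2 where "A2 = Q * exp w * X"
  define A3 where "A3 = (1 + s *\<^sub>R x) * exp w * Q"
  have A1: "hilbert_schmidt A1" "hs_norm A1 \<le> P\<^sup>2 * exp P * s\<^sup>2"
  proof -
    show "hilbert_schmidt A1"
      unfolding A1_def by (intro hilbert_schmidt_mult_right sx)
    have "hs_norm A1 \<le> hs_norm (s *\<^sub>R x) * norm (exp w) * norm (s *\<^sub>R x)"
      unfolding A1_def by (rule order_trans[OF hs_norm_mult_right])
        (intro mult_right_mono hs_norm_mult_right hilbert_schmidt_mult_right sx norm_ge_zero)+
    also have "\<dots> \<le> (s * P) * exp P * (s * P)"
      by (intro mult_mono sx ne) (use s P0 in auto)
    finally show "hs_norm A1 \<le> P\<^sup>2 * exp P * s\<^sup>2"
      by (simp add: power2_eq_square mult_ac)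
  qed
  have A2: "hilbert_schmidt A2" "hs_norm A2 \<le> F * P\<^sup>2 * (exp P * exp P) * s\<^sup>2"
  proof -
    show "hilbert_schmidt A2"
      unfolding A2_def by (intro hilbert_schmidt_mult_right Q)
    have "hs_norm A2 \<le> hs_norm Q * norm (exp w) * norm X"
      unfolding A2_def by (rule order_trans[OF hs_norm_mult_right])
        (intro mult_right_mono hs_norm_mult_right hilbert_schmidt_mult_right Q norm_ge_zero)+
    also have "\<dots> \<le> (F * (P\<^sup>2 * s\<^sup>2)) * exp P * exp P"
      by (intro mult_mono Q ne nX) (auto simp: F_def)
    finally show "hs_norm A2 \<le> F * P\<^sup>2 * (exp P * exp P) * s\<^sup>2"
      by (simp add: mult_ac)
  qed
  have A3: "hilbert_schmidt A3" "hs_norm A3 \<le> F * P\<^sup>2 * (exp P * exp P) * s\<^sup>2"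
  proof -
    show "hilbert_schmidt A3"
      unfolding A3_def by (intro hilbert_schmidt_mult_left Q)
    have "hs_norm A3 \<le> norm ((1 + s *\<^sub>R x) * exp w) * hs_norm Q"
      unfolding A3_def by (intro hs_norm_mult_left Q)
    also have "\<dots> \<le> (norm (1 + s *\<^sub>R x) * norm (exp w)) * hs_norm Q"
      by (intro mult_right_mono norm_mult_ineq hs_norm_nonneg)
    also have "\<dots> \<le> (exp P * exp P) * (F * (P\<^sup>2 * s\<^sup>2))"
      by (intro mult_mono Q ne n1) auto
    finally show "hs_norm A3 \<le> F * P\<^sup>2 * (exp P * exp P) * s\<^sup>2"
      by (simp add: mult_ac)
  qed
  have X_eq: "X = 1 + s *\<^sub>R x + Q"
    by (simp add: Q_def)
  have "X * exp w * X = (1 + s *\<^sub>R x) * exp w * (1 + s *\<^sub>R x) + A3 + A2"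
    unfolding A2_def A3_def by (subst (1 2) X_eq) (simp add: algebra_simps X_eq)
  also have "\<dots> = exp w + Y + A1 + A3 + A2"
    unfolding Y_eq A1_def by (simp add: algebra_simps)
  finally have eq: "exp (w + s *\<^sub>R k) - exp (s *\<^sub>R x) * exp w * exp (s *\<^sub>R x) = T + - (A1 + (A2 + A3))"
    unfolding X_def[symmetric] T_def by (simp add: algebra_simps)
  have A: "hilbert_schmidt (A1 + (A2 + A3))"
    by (intro hilbert_schmidt_add A1 A2 A3)
  show "hilbert_schmidt (exp (w + s *\<^sub>R k) - exp (s *\<^sub>R x) * exp w * exp (s *\<^sub>R x))"
    unfolding eq by (rule hilbert_schmidt_add[OF T(1) hilbert_schmidt_minus[OF A]])
  have "hs_norm (T + - (A1 + (A2 + A3))) \<le> hs_norm T + (hs_norm A1 + (hs_norm A2 + hs_norm A3))"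
    using hs_norm_triangle[OF T(1) hilbert_schmidt_minus[OF A]] hs_norm_minus[OF A]
      hs_norm_triangle[OF A1(1) hilbert_schmidt_add[OF A2(1) A3(1)]] hs_norm_triangle[OF A2(1) A3(1)] by linarith
  also have "\<dots> \<le> F * (P\<^sup>2 * s\<^sup>2) + (P\<^sup>2 * exp P * s\<^sup>2 + (F * P\<^sup>2 * (exp P * exp P) * s\<^sup>2 + F * P\<^sup>2 * (exp P * exp P) * s\<^sup>2))"
    by (intro add_mono T A1 A2 A3)
  also have "\<dots> = step_const P * s\<^sup>2"
    by (simp add: step_const_def F_def r_def algebra_simps)
  finally show "hs_norm (exp (w + s *\<^sub>R k) - exp (s *\<^sub>R x) * exp w * exp (s *\<^sub>R x)) \<le> step_const P * s\<^sup>2"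
    unfolding eq .
qed

text \<open>Here \<open>k\<close> is the velocity at s = 0 of ln(e^(sx) e^w e^(sx)); it lies in
  \<open>m\<close> because \<open>u_coth\<close> is even and so acts as a function of the squared
  bracket with \<open>w\<close>. \<open>C\<close> depends on \<open>w\<close> only through the bound
  \<open>R\<close>, so one constant serves all Euler steps. The inner product identity is the first
  variation: against \<open>w\<close> only the diagonal entries count, and their multiplier is
  2.\<close>

lemma conj_log_one_step:
  fixes m :: "'h::infdim_separable_hilbert bop set"
  assumes m: "lie_triple_system m" "closed2 m" and x: "x \<in> m" and R: "0 \<le> R"
  obtains C where "0 < C" "\<And>w. w \<in> m \<Longrightarrow> norm2 w \<le> R \<Longrightarrow> \<exists>k\<in>m. inner2 w k = 2 * inner2 w x \<and>
    (\<forall>s. 0 \<le> s \<longrightarrow> s \<le> 1 \<longrightarrow> C * s\<^sup>2 \<le> 1 \<longrightarrow> dist_fun (conj_log (s *\<^sub>R x) w) (w + s *\<^sub>R k) \<le> C * s\<^sup>2)"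
proof -
  have mHR: "m \<subseteq> HR"
    using m(1) by (simp add: lie_triple_system_def)
  have xH: "x \<in> HR"
    using x mHR by blast
  \<comment> \<open>The Hilbert-Schmidt part of \<open>w\<close> has eigenvalues of size at most
    \<open>R\<close>, so differences of eigenvalues stay below 4R.\<close>
  define B where "B = (4 * R)\<^sup>2"
  define \<phi> where "\<phi> t = u_coth (sqrt t)" for t
  have cont: "continuous_on {0..B} \<phi>"
    unfolding \<phi>_def by (intro continuous_on_compose2[OF continuous_u_coth] continuous_intros) auto
  have "compact (\<phi> ` {0..B})"
    by (intro compact_continuous_image cont compact_Icc)
  then obtain M where M: "0 < M" "\<And>t. t \<in> {0..B} \<Longrightarrow> \<bar>\<phi> t\<bar> \<le> M"
    using compact_imp_bounded bounded_pos[of "\<phi> ` {0..B}"] by auto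
  have \<phi>_sq: "\<phi> (u\<^sup>2) = u_coth u" for u
    by (cases "0 \<le> u") (simp_all add: \<phi>_def u_coth_minus[of u, symmetric] del: u_coth_minus)
  \<comment> \<open>One common bound for the Hilbert-Schmidt parts of \<open>w\<close>,
    \<open>x\<close> and \<open>k\<close>, as \<open>hs_exp_one_step\<close> demands.\<close>
  define P where "P = R + (M + 1) * norm2 x"
  note nx = norm2_nonneg[OF xH]
  have P: "0 \<le> P" "R \<le> P" "norm2 x \<le> P" "M * norm2 x \<le> P"
    using R M(1) nx by (auto simp: P_def algebra_simps)
  have hsx: "hs_norm (hs_part x) \<le> norm2 x"
    using hs_norm_le_norm2[OF xH] hs_norm_nonneg[of "hs_part x"] by linarith
  define C0 where "C0 = step_const P"
  have C0: "0 \<le> C0"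
    by (simp add: C0_def step_const_def)
  \<comment> \<open>The factor in front of \<open>C0\<close> comes from
    \<open>dist_fun_le_exp_diff\<close> at a point whose Hilbert-Schmidt part has norm at most 2P;
    the 1 keeps \<open>C\<close> positive.\<close>
  define C where "C = 4 * exp (2 * P) * C0 + 1"
  show thesis
  proof (rule that)
    show "0 < C"
      using C0 by (simp add: C_def add_nonneg_pos)
    fix w
    assume w: "w \<in> m" and wR: "norm2 w \<le> R"
    have wH: "w \<in> HR"
      using w mHR by blast
    obtain E l where E: "eigenbasis w E l"
      using spectral_theorem_HR[OF wH] by blast
    define l0 where "l0 e = l e - scalar_part w" for e
    have E0: "eigenbasis (hs_part w) E l0"
      unfolding hs_part_def l0_def by (rule eigenbasis_diff[OF E eigenbasis_of_real[OF eigenbasis_onb[OF E]]])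
    have hsw: "hs_norm (hs_part w) \<le> R" "norm (hs_part w) \<le> R"
      using hs_norm_le_norm2[OF wH] hs_norm_nonneg[of "hs_part w"] wR
        norm_le_hs_norm[OF sa_hsD(1)[OF hs_part_sa_hs[OF wH]]] by linarith+
    have diff_B: "(l e - l f)\<^sup>2 \<le> B" if "e \<in> E" "f \<in> E" for e f
    proof -
      have "\<bar>l e - l f\<bar> \<le> 4 * R"
        using eigenvalue_le_norm[OF E0 that(1)] eigenvalue_le_norm[OF E0 that(2)] hsw(2) R
        by (simp add: l0_def)
      then show ?thesis
        unfolding B_def using power_mono[of "\<bar>l e - l f\<bar>" "4 * R" 2] by simp
    qed
    obtain k where k: "k \<in> m" "scalar_part k = \<phi> 0 * scalar_part x"
      "\<And>e f. e \<in> E \<Longrightarrow> f \<in> E \<Longrightarrow> cinner e (bop_apply k f) = of_real (\<phi> ((l e - l f)\<^sup>2)) * cinner e (bop_apply x f)"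
      using ad_functional_calculus[OF m w x E cont diff_B] by blast
    have kH: "k \<in> HR"
      using k(1) mHR by blast
    have scalar_k: "scalar_part k = 2 * scalar_part x"
      using k(2) by (simp add: \<phi>_def)
    have entry: "cinner e (bop_apply (hs_part k) f) = of_real (\<phi> ((l e - l f)\<^sup>2)) * cinner e (bop_apply (hs_part x) f)"
      if "e \<in> E" "f \<in> E" for e f
      by (rule hs_part_entry[OF E that kH xH k(2) k(3)[OF that]])
    note sa = hs_part_sa_hs[OF wH] hs_part_sa_hs[OF xH] hs_part_sa_hs[OF kH]
    note hs = sa[THEN sa_hsD(1)]
    have hsk: "hs_norm (hs_part k) \<le> P"
    proof -
      have "hs_norm (hs_part k) \<le> M * hs_norm (hs_part x)"
      proof (rule hs_norm_le_entries(2)[OF eigenbasis_onb[OF E] eigenbasis_onb[OF E] hs(2)])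
        fix e f
        assume ef: "e \<in> E" "f \<in> E"
        show "cmod (cinner e (bop_apply (hs_part k) f)) \<le> M * cmod (cinner e (bop_apply (hs_part x) f))"
          unfolding entry[OF ef] norm_mult norm_of_real using diff_B[OF ef]
          by (intro mult_right_mono M(2)) auto
      qed (use M in simp)
      also have "\<dots> \<le> M * norm2 x"
        using hsx M(1) by (intro mult_left_mono) auto
      finally show ?thesis
        using P(4) by linarith
    qed
    have "hs_inner (hs_part w) (hs_part k) = 2 * hs_inner (hs_part w) (hs_part x)"
    proof (rule has_sum_unique)
      show "((\<lambda>e. Re (cinner (bop_apply (hs_part w) e) (bop_apply (hs_part k) e))) has_sum hs_inner (hs_part w) (hs_part k)) E"
        by (rule hs_inner_has_sum[OF hs(1) hs(3) eigenbasis_onb[OF E]])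
      have "((\<lambda>e. 2 * Re (cinner (bop_apply (hs_part w) e) (bop_apply (hs_part x) e))) has_sum 2 * hs_inner (hs_part w) (hs_part x)) E"
        by (intro has_sum_cmult_right hs_inner_has_sum[OF hs(1) hs(2) eigenbasis_onb[OF E]])
      moreover have "Re (cinner (bop_apply (hs_part w) e) (bop_apply (hs_part k) e)) =
          2 * Re (cinner (bop_apply (hs_part w) e) (bop_apply (hs_part x) e))" if "e \<in> E" for e
        using entry[OF that that] eigenbasis_apply[OF E0 that] by (simp add: cinner_simps \<phi>_def)
      ultimately show "((\<lambda>e. Re (cinner (bop_apply (hs_part w) e) (bop_apply (hs_part k) e))) has_sum 2 * hs_inner (hs_part w) (hs_part x)) E"
        by (simp cong: has_sum_cong)
    qed
    then have inner: "inner2 w k = 2 * inner2 w x"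
      by (simp add: inner2_eq wH kH xH scalar_k)
    have "dist_fun (conj_log (s *\<^sub>R x) w) (w + s *\<^sub>R k) \<le> C * s\<^sup>2" if s: "0 \<le> s" "s \<le> 1" "C * s\<^sup>2 \<le> 1" for s
    proof -
      define a where "a = conj_log (s *\<^sub>R x) w"
      define u where "u = w + s *\<^sub>R k"
      have sxH: "s *\<^sub>R x \<in> HR"
        by (rule HR_scaleR[OF xH])
      have a: "a \<in> HR"
        unfolding a_def by (rule conj_log_HR[OF sxH wH])
      have u: "u \<in> HR"
        unfolding u_def by (intro HR_intros wH kH)
      have scalar: "scalar_part a - scalar_part u = 0"
        unfolding a_def scalar_part_conj_log[OF sxH wH] u_def
        using parts_add[OF wH HR_scaleR[OF kH]] parts_scaleR[OF xH] parts_scaleR[OF kH] scalar_k by simp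
      have hs_u: "hs_part u = hs_part w + s *\<^sub>R hs_part k"
        unfolding u_def using parts_add[OF wH HR_scaleR[OF kH]] parts_scaleR[OF kH] by simp
      have exp_a: "exp (hs_part a) = exp (s *\<^sub>R hs_part x) * exp (hs_part w) * exp (s *\<^sub>R hs_part x)"
        unfolding a_def exp_hs_part_conj_log[OF sxH wH] using parts_scaleR[OF xH] by simp
      have entry_u_coth: "cinner e (bop_apply (hs_part k) f) = of_real (u_coth (l0 e - l0 f)) * cinner e (bop_apply (hs_part x) f)"
        if "e \<in> E" "f \<in> E" for e f
        using entry[OF that] by (simp add: \<phi>_sq l0_def)
      have w_P: "norm (hs_part w) \<le> P" and x_P: "hs_norm (hs_part x) \<le> P"
        using hsw(2) hsx P by linarith+
      note step = hs_exp_one_step[OF sa E0 entry_u_coth w_P x_P hsk s(1,2), folded exp_a hs_u C0_def]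
      then have step': "hs_norm (exp (hs_part a) - exp (hs_part u)) \<le> C0 * s\<^sup>2"
        using hs_norm_diff_commute[OF step(1)] by simp
      have "norm (s *\<^sub>R hs_part k) \<le> 1 * P"
        unfolding norm_scaleR using s norm_le_hs_norm[OF hs(3)] hsk by (intro mult_mono) auto
      then have "norm (hs_part u) \<le> 2 * P"
        unfolding hs_u using norm_triangle_ineq[of "hs_part w" "s *\<^sub>R hs_part k"] w_P by linarith
      then have le: "exp (norm (hs_part u)) * hs_norm (exp (hs_part a) - exp (hs_part u)) \<le> exp (2 * P) * (C0 * s\<^sup>2)"
        by (intro mult_mono step') auto
      have C_eq: "C * s\<^sup>2 = 4 * (exp (2 * P) * (C0 * s\<^sup>2)) + s\<^sup>2"
        by (simp add: C_def algebra_simps)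
      have "exp (2 * P) * (C0 * s\<^sup>2) \<le> 1 / 2"
        using C_eq s(3) zero_le_power2[of s] by linarith
      with le have "dist_fun a u \<le> 4 * exp (norm (hs_part u)) * hs_norm (exp (hs_part a) - exp (hs_part u)) + \<bar>scalar_part a - scalar_part u\<bar>"
        by (intro dist_fun_le_exp_diff a u) linarith
      then have "dist_fun a u \<le> 4 * (exp (norm (hs_part u)) * hs_norm (exp (hs_part a) - exp (hs_part u)))"
        by (simp add: scalar)
      then have "dist_fun a u \<le> C * s\<^sup>2"
        using le C_eq zero_le_power2[of s] by linarith
      then show ?thesis
        by (simp only: a_def u_def)
    qed
    with k(1) inner show "\<exists>k\<in>m. inner2 w k = 2 * inner2 w x \<and>
        (\<forall>s. 0 \<le> s \<longrightarrow> s \<le> 1 \<longrightarrow> C * s\<^sup>2 \<le> 1 \<longrightarrow> dist_fun (conj_log (s *\<^sub>R x) w) (w + s *\<^sub>R k) \<le> C * s\<^sup>2)"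
      by blast
  qed
qed

lemma conj_log_scaleR_add:
  assumes "x \<in> HR" "y \<in> HR"
  shows "conj_log (s *\<^sub>R x) (conj_log (t *\<^sub>R x) y) = conj_log ((s + t) *\<^sub>R x) y"
proof (rule conj_log_eqI)
  have "exp (conj_log ((s + t) *\<^sub>R x) y) = exp (s *\<^sub>R x) * exp (t *\<^sub>R x) * exp y * (exp (t *\<^sub>R x) * exp (s *\<^sub>R x))"
    by (simp add: exp_conj_log HR_scaleR assms exp_scaleR_mult add.commute)
  then show "exp (conj_log ((s + t) *\<^sub>R x) y) = exp (s *\<^sub>R x) * exp (conj_log (t *\<^sub>R x) y) * exp (s *\<^sub>R x)"
    by (simp add: exp_conj_log HR_scaleR assms mult.assoc)
qed (intro conj_log_HR HR_scaleR assms)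

text \<open>
  An Euler scheme inside \<open>m\<close> for \<open>t \<mapsto> ln (e\<^bsup>tx\<^esup> e\<^bsup>y\<^esup> e\<^bsup>tx\<^esup>)\<close>: the maps \<open>conj_log (s x)\<close> are isometries, so the \<open>n\<close> local
  errors of order \<open>1/n\<^sup>2\<close> add up to an error of order \<open>1/n\<close>.
\<close>

lemma conj_log_mem:
  fixes m :: "'h::infdim_separable_hilbert bop set"
  assumes m: "lie_triple_system m" "closed2 m" and x: "x \<in> m" and y: "y \<in> m"
  shows "conj_log x y \<in> m"
proof -
  have sub: "subspace m" "m \<subseteq> HR"
    using m(1) by (auto simp: lie_triple_system_def)
  have xH: "x \<in> HR" and yH: "y \<in> HR"
    using x y sub(2) by auto
  define g where "g t = conj_log (t *\<^sub>R x) y" for t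
  have gH: "g t \<in> HR" for t
    unfolding g_def by (intro conj_log_HR HR_scaleR xH yH)
  have g0: "g 0 = y"
    unfolding g_def by (rule conj_log_eqI[OF yH]) simp
  have g_step: "conj_log (s *\<^sub>R x) (g t) = g (t + s)" for s t
    unfolding g_def using conj_log_scaleR_add[OF xH yH] by (simp add: add.commute)
  \<comment> \<open>The extra 1 leaves room for the accumulated error of the Euler points.\<close>
  define R where "R = norm2 y + 2 * norm2 x + 1"
  have R: "0 \<le> R"
    using norm2_nonneg[OF xH] norm2_nonneg[OF yH] by (simp add: R_def)
  have g_bound: "norm2 (g t) \<le> norm2 y + 2 * norm2 x" if "0 \<le> t" "t \<le> 1" for t
  proof -
    \<comment> \<open>The isometry that moves \<open>y\<close> to \<open>g t\<close> moves 0 to 2tx,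
      so \<open>g t\<close> stays at distance \<open>norm2 y\<close> from that point.\<close>
    have "conj_log (t *\<^sub>R x) 0 = (2 * t) *\<^sub>R x"
      by (rule conj_log_eqI) (simp_all add: HR_scaleR xH exp_scaleR_mult)
    then have "dist_fun (g t) ((2 * t) *\<^sub>R x) = norm2 y"
      unfolding g_def using dist_fun_conj_log[OF HR_scaleR[OF xH] yH HR_0] dist_fun_0_right[OF yH] by metis
    moreover have "dist_fun (g t) 0 \<le> dist_fun (g t) ((2 * t) *\<^sub>R x) + dist_fun ((2 * t) *\<^sub>R x) 0"
      by (intro dist_fun_triangle gH HR_scaleR xH HR_0)
    moreover have "dist_fun ((2 * t) *\<^sub>R x) 0 = 2 * t * norm2 x"
      using that by (simp add: dist_fun_0_right HR_scaleR xH norm2_scaleR)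
    moreover have "2 * t * norm2 x \<le> 2 * 1 * norm2 x"
      using that norm2_nonneg[OF xH] by (intro mult_right_mono) auto
    ultimately show ?thesis
      using dist_fun_0_right[OF gH] by simp
  qed
  obtain C where C: "0 < C" "\<And>w. w \<in> m \<Longrightarrow> norm2 w \<le> R \<Longrightarrow> \<exists>k\<in>m. inner2 w k = 2 * inner2 w x \<and>
    (\<forall>s. 0 \<le> s \<longrightarrow> s \<le> 1 \<longrightarrow> C * s\<^sup>2 \<le> 1 \<longrightarrow> dist_fun (conj_log (s *\<^sub>R x) w) (w + s *\<^sub>R k) \<le> C * s\<^sup>2)"
    using conj_log_one_step[OF m x R] by blast
  \<comment> \<open>With step s = 1/n, the condition \<open>C \<le> n\<close> means C s is at most
    1: the one-step estimate applies, and the total error i C s^2 never exceeds 1.\<close>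
  have approx: "\<exists>u\<in>m. dist_fun (g 1) u \<le> C / n" if n: "C \<le> n" "0 < n" for n :: nat
  proof -
    define s where "s = 1 / real n"
    have s: "0 \<le> s" "s \<le> 1" "C * s \<le> 1" "n * s = 1"
      using n by (auto simp: s_def divide_le_eq)
    have "C * s * s \<le> 1 * 1"
      using s C(1) by (intro mult_mono) auto
    then have s2: "C * s\<^sup>2 \<le> 1"
      by (simp add: power2_eq_square mult.assoc)
    have "i \<le> n \<Longrightarrow> \<exists>u\<in>m. dist_fun (g (i * s)) u \<le> i * (C * s\<^sup>2)" for i :: nat
    proof (induction i)
      case 0
      have "dist_fun y y = 0"
        using dist_fun_line[OF yH, of 1 1] by simp
      then show ?case
        by (intro bexI[OF _ y]) (simp add: g0)
    next
      case (Suc i)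
      then obtain u where u: "u \<in> m" "dist_fun (g (i * s)) u \<le> i * (C * s\<^sup>2)"
        by auto
      have uH: "u \<in> HR"
        using u sub(2) by blast
      have t: "0 \<le> i * s" "i * s \<le> 1"
        using Suc.prems s mult_right_mono[of "real i" "real n" s] by auto
      have "i * (C * s\<^sup>2) = (i * s) * (C * s)"
        by (simp add: power2_eq_square)
      also have "\<dots> \<le> 1 * 1"
        using t s C(1) by (intro mult_mono) auto
      finally have "dist_fun (g (i * s)) u \<le> 1"
        using u(2) by linarith
      moreover have "dist_fun u 0 \<le> dist_fun u (g (i * s)) + dist_fun (g (i * s)) 0"
        by (intro dist_fun_triangle uH gH HR_0)
      ultimately have "norm2 u \<le> R"
        using g_bound[OF t] dist_fun_0_right[OF uH] dist_fun_0_right[OF gH] dist_fun_commute[OF uH gH]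
        by (simp add: R_def)
      then obtain k where k: "k \<in> m" "dist_fun (conj_log (s *\<^sub>R x) u) (u + s *\<^sub>R k) \<le> C * s\<^sup>2"
        using C(2)[OF u(1)] s s2 by blast
      have u': "u + s *\<^sub>R k \<in> m"
        using u k sub(1) by (simp add: subspace_add subspace_scale)
      have sxH: "s *\<^sub>R x \<in> HR"
        by (rule HR_scaleR[OF xH])
      have "dist_fun (g (Suc i * s)) (conj_log (s *\<^sub>R x) u) = dist_fun (g (i * s)) u"
        using dist_fun_conj_log[OF sxH gH uH, of "i * s"] by (simp add: g_step algebra_simps)
      moreover have "dist_fun (g (Suc i * s)) (u + s *\<^sub>R k) \<le>
          dist_fun (g (Suc i * s)) (conj_log (s *\<^sub>R x) u) + dist_fun (conj_log (s *\<^sub>R x) u) (u + s *\<^sub>R k)"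
        using u' sub(2) by (intro dist_fun_triangle gH conj_log_HR sxH uH) auto
      ultimately have "dist_fun (g (Suc i * s)) (u + s *\<^sub>R k) \<le> Suc i * (C * s\<^sup>2)"
        using u(2) k(2) by (simp add: distrib_right)
      with u' show ?case
        by blast
    qed
    from this[of n] obtain u where "u \<in> m" "dist_fun (g 1) u \<le> n * (C * s\<^sup>2)"
      using s(4) by auto
    moreover have "n * (C * s\<^sup>2) = C / n"
      using n by (simp add: s_def power2_eq_square)
    ultimately show ?thesis
      by auto
  qed
  define N where "N = nat \<lceil>C\<rceil>"
  have N: "C \<le> real (Suc (n + N))" "0 < Suc (n + N)" for n
    unfolding N_def by linarith+
  have "\<forall>n. \<exists>u. u \<in> m \<and> dist_fun (g 1) u \<le> C / real (Suc (n + N))"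
    using approx[OF N] by blast
  from choice[OF this] obtain U where U: "\<And>n. U n \<in> m" "\<And>n. dist_fun (g 1) (U n) \<le> C / real (Suc (n + N))"
    by blast
  have UH: "U n \<in> HR" for n
    using U(1) sub(2) by blast
  have up: "(\<lambda>n. C / real (Suc (n + N))) \<longlonglongrightarrow> 0"
    using LIMSEQ_ignore_initial_segment[OF lim_const_over_n[of C], of "Suc N"] by simp
  have "(\<lambda>n. norm2 (U n - g 1)) \<longlonglongrightarrow> 0"
  proof (rule tendsto_sandwich[OF _ _ tendsto_const up])
    show "\<forall>\<^sub>F n in sequentially. norm2 (U n - g 1) \<le> C / real (Suc (n + N))"
    proof (intro always_eventually allI)
      fix n
      show "norm2 (U n - g 1) \<le> C / real (Suc (n + N))"
        using norm2_diff_le_dist_fun[OF UH[of n] gH[of 1]] dist_fun_commute[OF UH[of n] gH[of 1]] U(2)[of n] by linarith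
    qed
  qed (use norm2_nonneg[OF HR_diff[OF UH gH]] in auto)
  then have "g 1 \<in> m"
    using m(2) U(1) gH unfolding closed2_def by blast
  then show ?thesis
    by (simp add: g_def)
qed

section \<open>The minimizer and the polar decomposition\<close>

text \<open>The first variation is taken at \<open>v\<close>, which need not lie in
  \<open>m\<close>; the one-step estimate is therefore applied with the whole space in place of
  \<open>m\<close>.\<close>

lemma lie_triple_system_HR: "lie_triple_system (HR :: 'h::infdim_separable_hilbert bop set)"
  unfolding lie_triple_system_def
proof (intro conjI ballI subset_refl)
  show "subspace (HR :: 'h bop set)"
    by (intro subspaceI HR_intros)
  fix x y z :: "'h bop"
  assume "x \<in> HR" "y \<in> HR" "z \<in> HR"
  then obtain a r b s c t where abc: "a \<in> sa_hs" "b \<in> sa_hs" "c \<in> sa_hs"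
    and xyz: "x = a + of_real r" "y = b + of_real s" "z = c + of_real t"
    by (metis HR_E)
  have "commutator (commutator x y) z = commutator (commutator a b) c"
    unfolding xyz by (simp add: commutator_def algebra_simps of_real_def)
  moreover have "hilbert_schmidt (commutator (commutator a b) c)"
    unfolding commutator_def by (intro hilbert_schmidt_intros sa_hsD(1) abc)
  moreover have "adj (commutator (commutator a b) c) = commutator (commutator a b) c"
    using abc[THEN sa_hsD(2)] by (simp add: commutator_def algebra_simps)
  ultimately show "commutator (commutator x y) z \<in> HR"
    using sa_hs_subset_HR[of "commutator (commutator a b) c"] by (simp add: sa_hs_def)
qed

lemma closed2_HR: "closed2 HR"
  by (simp add: closed2_def)

lemma nonneg_if_linear_perturbation:
  fixes b c s0 :: real
  assumes "0 < s0" "\<And>s. 0 < s \<Longrightarrow> s \<le> s0 \<Longrightarrow> 0 \<le> b + s * c"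
  shows "0 \<le> b"
proof (rule tendsto_lowerbound)
  show "((\<lambda>s. b + s * c) \<longlongrightarrow> b) (at_right 0)"
    by (rule tendsto_eq_intros refl | simp)+
  show "\<forall>\<^sub>F s in at_right 0. 0 \<le> b + s * c"
    using eventually_at_right_less[of 0] eventually_at_right[OF assms(1)] assms
    by (auto simp: eventually_at_right[OF assms(1)] intro!: exI[of _ s0])
qed simp

text \<open>
  If \<open>\<langle>v, z\<rangle> \<noteq> 0\<close>, moving along \<open>e\<^bsup>tz\<^esup>\<close> in the right direction decreases the distance to \<open>e\<^bsup>v\<^esup>\<close> to first order.
\<close>

lemma orthogonal_if_nearest:
  assumes v: "v \<in> HR" and z: "z \<in> HR" and min: "\<And>t. norm2 v \<le> dist_fun v (t *\<^sub>R z)"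
  shows "inner2 v z = 0"
proof (cases "v = 0")
  case True
  have "inner2 (0 *\<^sub>R v) z = 0 * inner2 v z"
    by (rule inner2_scaleR_left[OF v z])
  then show ?thesis
    using True by simp
next
  case False
  have v0: "0 < norm2 v"
    using norm2_nonneg[OF v] norm2_eq_0[OF v] False by force
  \<comment> \<open>A one-sided bound suffices, since it applies to both \<open>z\<close> and its
    negative.\<close>
  have nonneg: "0 \<le> inner2 v x" if x: "x \<in> HR" and xz: "x = c *\<^sub>R z" for x c
  proof -
    obtain C where C: "0 < C" "\<And>w. w \<in> HR \<Longrightarrow> norm2 w \<le> norm2 v \<Longrightarrow> \<exists>k\<in>HR. inner2 w k = 2 * inner2 w x \<and>
      (\<forall>s. 0 \<le> s \<longrightarrow> s \<le> 1 \<longrightarrow> C * s\<^sup>2 \<le> 1 \<longrightarrow> dist_fun (conj_log (s *\<^sub>R x) w) (w + s *\<^sub>R k) \<le> C * s\<^sup>2)"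
      using conj_log_one_step[OF lie_triple_system_HR closed2_HR x norm2_nonneg[OF v]] by blast
    obtain k where k: "k \<in> HR" "inner2 v k = 2 * inner2 v x"
      "\<And>s. 0 \<le> s \<Longrightarrow> s \<le> 1 \<Longrightarrow> C * s\<^sup>2 \<le> 1 \<Longrightarrow> dist_fun (conj_log (s *\<^sub>R x) v) (v + s *\<^sub>R k) \<le> C * s\<^sup>2"
      using C(2)[OF v order_refl] by blast
    \<comment> \<open>The first two bounds admit s in the one-step estimate; the third keeps
      \<open>norm2 v - C * s\<^sup>2\<close> nonnegative, so that inequalities can be
      squared.\<close>
    define s0 where "s0 = min 1 (min (1 / C) (norm2 v / C))"
    have s0: "0 < s0" "s0 \<le> 1" "C * s0 \<le> 1" "C * s0 \<le> norm2 v"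
    proof -
      show "0 < s0" "s0 \<le> 1"
        using C(1) v0 by (auto simp: s0_def)
      have "s0 \<le> 1 / C" "s0 \<le> norm2 v / C"
        by (simp_all add: s0_def)
      then show "C * s0 \<le> 1" "C * s0 \<le> norm2 v"
        using C(1) by (simp_all add: le_divide_eq mult.commute)
    qed
    have "0 \<le> 2 * inner2 v k + s * ((norm2 k)\<^sup>2 + 2 * C * norm2 v)" if s: "0 < s" "s \<le> s0" for s
    proof -
      have "C * s \<le> C * s0"
        using s C(1) by simp
      moreover have "C * s * s \<le> C * s * 1"
        using s s0 C(1) by (intro mult_left_mono) auto
      ultimately have Cs: "C * s\<^sup>2 \<le> 1" "C * s\<^sup>2 \<le> norm2 v"
        using s0 by (simp_all add: power2_eq_square mult.assoc)
      have sxH: "s *\<^sub>R x \<in> HR" and ukH: "v + s *\<^sub>R k \<in> HR"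
        by (intro HR_intros v k x)+
      \<comment> \<open>With this \<open>y\<close>, recentring \<open>v\<close> at \<open>y\<close>
        is exactly the move by \<open>s *\<^sub>R x\<close> studied in the one-step
        estimate.\<close>
      define y where "y = (- 2 * s) *\<^sub>R x"
      have yH: "y \<in> HR"
        unfolding y_def by (rule HR_scaleR[OF x])
      have y: "- (y /\<^sub>R 2) = s *\<^sub>R x" "y = (- 2 * s * c) *\<^sub>R z"
        by (simp_all add: y_def xz)
      have "norm2 v \<le> dist_fun v y"
        unfolding y(2) by (rule min)
      also have "\<dots> = dist_fun (conj_log (s *\<^sub>R x) v) 0"
        using dist_fun_alt[OF v yH] dist_fun_0_right[OF conj_log_HR[OF sxH v]] by (simp only: y(1))
      also have "\<dots> \<le> dist_fun (conj_log (s *\<^sub>R x) v) (v + s *\<^sub>R k) + dist_fun (v + s *\<^sub>R k) 0"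
        by (intro dist_fun_triangle conj_log_HR sxH v ukH HR_0)
      also have "\<dots> \<le> C * s\<^sup>2 + norm2 (v + s *\<^sub>R k)"
        using k(3)[of s] s s0 Cs by (simp add: dist_fun_0_right[OF ukH])
      finally have "norm2 v - C * s\<^sup>2 \<le> norm2 (v + s *\<^sub>R k)"
        by linarith
      then have "(norm2 v - C * s\<^sup>2)\<^sup>2 \<le> (norm2 (v + s *\<^sub>R k))\<^sup>2"
        using Cs by (intro power_mono) auto
      also have "\<dots> = (norm2 v)\<^sup>2 + s\<^sup>2 * (norm2 k)\<^sup>2 + 2 * (s * inner2 v k)"
        unfolding norm2_add_sq[OF v HR_scaleR[OF k(1)]]
        by (simp add: norm2_scaleR k inner2_scaleR_right v power_mult_distrib)
      finally have "0 \<le> s * (2 * inner2 v k + s * ((norm2 k)\<^sup>2 + 2 * C * norm2 v)) - (C * s\<^sup>2)\<^sup>2"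
        by (simp add: power2_diff algebra_simps power2_eq_square)
      then have "0 \<le> s * (2 * inner2 v k + s * ((norm2 k)\<^sup>2 + 2 * C * norm2 v))"
        using zero_le_power2[of "C * s\<^sup>2"] by linarith
      then show ?thesis
        using s(1) by (simp add: zero_le_mult_iff)
    qed
    from nonneg_if_linear_perturbation[OF s0(1) this] show ?thesis
      using k(2) by simp
  qed
  have "0 \<le> inner2 v z"
    by (rule nonneg[OF z, of 1]) simp
  moreover have "0 \<le> inner2 v ((-1) *\<^sub>R z)"
    by (rule nonneg[OF HR_scaleR[OF z] refl])
  ultimately show ?thesis
    using inner2_scaleR_right[OF z v, of "-1"] by simp
qed

lemma dist_fun_less:
  fixes m :: "'h::infdim_separable_hilbert bop set"
  assumes m: "lie_triple_system m" "closed2 m" and a: "a \<in> HR" and x: "x \<in> m" and v: "v \<in> orth_compl m"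
    and eq: "exp a = exp x * exp v * exp x" and y: "y \<in> m" "y \<noteq> 2 *\<^sub>R x"
  shows "dist_fun a (2 *\<^sub>R x) < dist_fun a y"
proof -
  have sub: "subspace m" "m \<subseteq> HR"
    using m(1) by (auto simp: lie_triple_system_def)
  have H: "x \<in> HR" "y \<in> HR" "v \<in> HR" "- x \<in> HR" "2 *\<^sub>R x \<in> HR"
    using x y v sub by (auto simp: orth_compl_def intro: HR_minus HR_scaleR)
  have "a = conj_log x v"
    using conj_log_eqI[OF a eq] by simp
  then have T_a: "conj_log (- x) a = v"
    using conj_log_cancel(1)[OF H(1,3)] by simp
  have T_2x: "conj_log (- x) (2 *\<^sub>R x) = 0"
    using conj_log_half_minus[OF H(5)] by simp
  define w where "w = conj_log (- x) y"
  have w: "w \<in> m" "w \<in> HR"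
    unfolding w_def using x y(1) sub by (auto intro!: conj_log_mem[OF m] conj_log_HR H simp: subspace_neg)
  \<comment> \<open>Strictness comes from here: \<open>conj_log x\<close> undoes the translation and
    sends 0 to 2x.\<close>
  have "w \<noteq> 0"
  proof
    assume "w = 0"
    then have "y = conj_log x 0"
      using conj_log_cancel(2)[OF H(1,2)] by (simp add: w_def)
    moreover have "conj_log x 0 = 2 *\<^sub>R x"
      using conj_log_cancel(2)[OF H(1,5)] T_2x by simp
    ultimately show False
      using y(2) by simp
  qed
  then have "0 < norm2 w"
    using norm2_nonneg[OF w(2)] norm2_eq_0[OF w(2)] by force
  have "inner2 v w = 0"
    using v w(1) by (simp add: orth_compl_def)
  then have "(norm2 (v - w))\<^sup>2 = (norm2 v)\<^sup>2 + (norm2 w)\<^sup>2"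
    using norm2_diff_sq[OF H(3) w(2)] by simp
  then have "(norm2 v)\<^sup>2 < (norm2 (v - w))\<^sup>2"
    using \<open>0 < norm2 w\<close> by simp
  then have "norm2 v < norm2 (v - w)"
    by (rule power2_less_imp_less) (rule norm2_nonneg[OF HR_diff[OF H(3) w(2)]])
  also have "\<dots> \<le> dist_fun v w"
    by (rule norm2_diff_le_dist_fun[OF H(3) w(2)])
  also have "\<dots> = dist_fun a y"
    using dist_fun_conj_log[OF H(4) a H(2)] by (simp add: T_a w_def)
  finally show ?thesis
    using dist_fun_conj_log[OF H(4) a H(5)] by (simp add: T_a T_2x dist_fun_0_right[OF H(3)])
qed

lemma ex_dist_fun_minimizer:
  fixes m :: "'h::infdim_separable_hilbert bop set"
  assumes m: "lie_triple_system m" "closed2 m" and a: "a \<in> HR"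
  obtains z where "z \<in> m" "\<And>y. y \<in> m \<Longrightarrow> dist_fun a z \<le> dist_fun a y"
proof -
  have sub: "subspace m" "m \<subseteq> HR"
    using m(1) by (auto simp: lie_triple_system_def)
  have "m \<noteq> {}"
    using subspace_0[OF sub(1)] by blast
  have semi: "\<exists>c\<in>m. (dist_fun y y')\<^sup>2 \<le> 2 * (dist_fun a y)\<^sup>2 + 2 * (dist_fun a y')\<^sup>2 - 4 * (dist_fun a c)\<^sup>2"
    if "y \<in> m" "y' \<in> m" for y y'
  proof
    show "(dist_fun y y')\<^sup>2 \<le> 2 * (dist_fun a y)\<^sup>2 + 2 * (dist_fun a y')\<^sup>2 -
        4 * (dist_fun a (conj_log (y /\<^sub>R 2) (conj_log (- (y /\<^sub>R 2)) y' /\<^sub>R 2)))\<^sup>2"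
      using that sub by (intro semi_parallelogram a) auto
    \<comment> \<open>The midpoint is built by two applications of \<open>conj_log\<close>, each of
      which stays in \<open>m\<close>: this is the geodesic convexity.\<close>
    show "conj_log (y /\<^sub>R 2) (conj_log (- (y /\<^sub>R 2)) y' /\<^sub>R 2) \<in> m"
      by (intro conj_log_mem[OF m] subspace_scale[OF sub(1)] subspace_neg[OF sub(1)] that)
  qed
  obtain s L where s: "\<And>n. s n \<in> m" "(\<lambda>n. (dist_fun a (s n))\<^sup>2) \<longlonglongrightarrow> L"
      "\<And>c. c \<in> m \<Longrightarrow> L \<le> (dist_fun a c)\<^sup>2" "\<And>j k. (dist_fun (s j) (s k))\<^sup>2 \<le> 2 / Suc j + 2 / Suc k"
  proof (rule minimizing_sequence[where f = "\<lambda>y. (dist_fun a y)\<^sup>2" and D = "\<lambda>y y'. (dist_fun y y')\<^sup>2",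
        OF \<open>m \<noteq> {}\<close> zero_le_power2])
    show "\<exists>c\<in>m. (dist_fun y y')\<^sup>2 \<le> 2 * (dist_fun a y)\<^sup>2 + 2 * (dist_fun a y')\<^sup>2 - 4 * (dist_fun a c)\<^sup>2"
      if "y \<in> m" "y' \<in> m" for y y'
      using semi that .
  qed (rule that)
  have sH: "s n \<in> HR" for n
    using s(1) sub by blast
  obtain z where z: "z \<in> HR" "(\<lambda>n. norm2 (s n - z)) \<longlonglongrightarrow> 0"
  proof (rule HR_complete[OF sH])
    fix d :: real
    assume "d > 0"
    then obtain N where "\<forall>j\<ge>N. \<forall>k\<ge>N. dist_fun (s j) (s k) < d"
      using Cauchy_of_sq_bound[OF s(4)] by blast
    then show "\<exists>N. \<forall>j\<ge>N. \<forall>k\<ge>N. norm2 (s j - s k) < d"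
      using norm2_diff_le_dist_fun[OF sH sH] le_less_trans by blast
  qed (use that in blast)
  have "z \<in> m"
    using m(2) s(1) z unfolding closed2_def by blast
  \<comment> \<open>The limit \<open>z\<close> was obtained in \<open>norm2\<close>, the weaker
    distance; \<open>dist_fun_tendsto_0\<close> returns to \<open>dist_fun\<close>. The root undoes
    the squares in \<open>minimizing_sequence\<close>.\<close>
  have "(\<lambda>n. sqrt ((dist_fun a (s n))\<^sup>2) + dist_fun (s n) z) \<longlonglongrightarrow> sqrt L + 0"
    by (intro tendsto_add tendsto_real_sqrt s(2) dist_fun_tendsto_0[OF sH z])
  moreover have "dist_fun a z \<le> sqrt ((dist_fun a (s n))\<^sup>2) + dist_fun (s n) z" for n
    using dist_fun_triangle[OF a sH z(1)] dist_fun_nonneg[OF a sH] by simp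
  ultimately have "dist_fun a z \<le> sqrt L + 0"
    by (intro LIMSEQ_le_const) auto
  moreover have "sqrt L \<le> dist_fun a y" if "y \<in> m" for y
  proof -
    have "y \<in> HR"
      using that sub by blast
    then show ?thesis
      using real_sqrt_le_mono[OF s(3)[OF that]] dist_fun_nonneg[OF a] by simp
  qed
  ultimately show thesis
    using \<open>z \<in> m\<close> that by force
qed

lemma ex_decomposition:
  fixes m :: "'h::infdim_separable_hilbert bop set"
  assumes m: "lie_triple_system m" "closed2 m" and a: "a \<in> HR"
  obtains x v where "x \<in> m" "v \<in> orth_compl m" "exp a = exp x * exp v * exp x"
proof -
  have sub: "subspace m" "m \<subseteq> HR"
    using m(1) by (auto simp: lie_triple_system_def)
  obtain z where z: "z \<in> m" "\<And>y. y \<in> m \<Longrightarrow> dist_fun a z \<le> dist_fun a y"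
    using ex_dist_fun_minimizer[OF m a] by blast
  define x where "x = z /\<^sub>R 2"
  have x: "x \<in> m"
    unfolding x_def by (rule subspace_scale[OF sub(1) z(1)])
  have H: "x \<in> HR" "z \<in> HR" "- x \<in> HR"
    using x z sub by (auto intro: HR_minus)
  define v where "v = conj_log (- x) a"
  have v: "v \<in> HR"
    unfolding v_def by (rule conj_log_HR[OF H(3) a])
  have "norm2 v = dist_fun a z"
    using dist_fun_alt[OF a H(2)] by (simp only: v_def x_def)
  \<comment> \<open>The translation by \<open>x\<close> maps \<open>m\<close> into itself, so
    minimality of \<open>z\<close> for \<open>a\<close> becomes minimality of 0 for
    \<open>v\<close>.\<close>
  have nearest: "norm2 v \<le> dist_fun v u" if u: "u \<in> m" for u
  proof -
    have uH: "u \<in> HR"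
      using u sub by blast
    have "dist_fun a z \<le> dist_fun a (conj_log x u)"
      by (rule z(2)[OF conj_log_mem[OF m x u]])
    also have "\<dots> = dist_fun v u"
      using dist_fun_conj_log[OF H(3) a conj_log_HR[OF H(1) uH]] conj_log_cancel(1)[OF H(1) uH]
      by (simp add: v_def)
    finally show ?thesis
      using \<open>norm2 v = dist_fun a z\<close> by simp
  qed
  have "inner2 v u = 0" if "u \<in> m" for u
    using that sub by (intro orthogonal_if_nearest v nearest subspace_scale) auto
  with v have "v \<in> orth_compl m"
    by (simp add: orth_compl_def)
  moreover have "exp a = exp x * exp v * exp x"
    using exp_conj_log[OF H(1) v] conj_log_cancel(2)[OF H(1) a] by (simp add: v_def)
  ultimately show thesis
    using x that by blast
qed

theorem theorem5p12:
  fixes m :: "'h :: infdim_separable_hilbert bop set" and a :: "'h bop"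
  assumes "lie_triple_system m"
    and "closedin topology2 m"
    and "a \<in> HR"
  shows "(\<exists>!(x, v). x \<in> m \<and> v \<in> orth_compl m \<and> exp a = exp x * exp v * exp x) \<and>
    (\<forall>x v. x \<in> m \<and> v \<in> orth_compl m \<and> exp a = exp x * exp v * exp x \<longrightarrow>
       (\<forall>y. is_arg_min (dist_fun a) (\<lambda>z. z \<in> m) y \<longleftrightarrow> y = 2 *\<^sub>R x))"
proof -
  note m = assms(1)
  have sub: "subspace m" "m \<subseteq> HR"
    using m by (auto simp: lie_triple_system_def)
  have m2: "closed2 m"
    unfolding closed2_def using closedin_topology2_limit[OF assms(2)] by blast
  note less = dist_fun_less[OF m m2 assms(3)]
  have arg_min: "is_arg_min (dist_fun a) (\<lambda>z. z \<in> m) y \<longleftrightarrow> y = 2 *\<^sub>R x"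
    if "x \<in> m" "v \<in> orth_compl m" "exp a = exp x * exp v * exp x" for x v y
  proof -
    have "2 *\<^sub>R x \<in> m"
      by (rule subspace_scale[OF sub(1) that(1)])
    then show ?thesis
      using less[OF that] unfolding is_arg_min_def by (metis less_asym)
  qed
  obtain x v where xv: "x \<in> m" "v \<in> orth_compl m" "exp a = exp x * exp v * exp x"
    using ex_decomposition[OF m m2 assms(3)] by blast
  \<comment> \<open>Every decomposition yields the unique minimizer as twice its first component, so
    the first components agree; the second is then recovered by cancellation.\<close>
  have unique: "x' = x \<and> v' = v" if xv': "x' \<in> m" "v' \<in> orth_compl m" "exp a = exp x' * exp v' * exp x'" for x' v'
  proof -
    have "2 *\<^sub>R x' = 2 *\<^sub>R x"
      using arg_min[OF xv] arg_min[OF xv'] by metis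
    then have "x' = x"
      by simp
    have "v \<in> HR" "v' \<in> HR" "x \<in> HR"
      using xv xv' sub by (auto simp: orth_compl_def)
    moreover have "conj_log x v = conj_log x v'"
      unfolding conj_log_def using xv xv' \<open>x' = x\<close> by simp
    ultimately have "v' = v"
      using conj_log_cancel(1) by metis
    with \<open>x' = x\<close> show ?thesis
      by simp
  qed
  have "\<exists>!(x, v). x \<in> m \<and> v \<in> orth_compl m \<and> exp a = exp x * exp v * exp x"
  proof (rule ex1I[of _ "(x, v)"])
    show "case (x, v) of (x, v) \<Rightarrow> x \<in> m \<and> v \<in> orth_compl m \<and> exp a = exp x * exp v * exp x"
      using xv by simp
    show "p = (x, v)" if "case p of (x, v) \<Rightarrow> x \<in> m \<and> v \<in> orth_compl m \<and> exp a = exp x * exp v * exp x" for p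
      using that unique by (cases p) auto
  qed
  with arg_min show ?thesis
    by blast
qed

end
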